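(* Let $K$ be a local field of characteristic $p$, let $\psi$ be a Drinfeld $A$-module of good reduction over $\mathcal O_K$, and let $\bar\phi$ be its reduction modulo $\mathfrak m_K$, viewed again as a Drinfeld module over $\mathcal O_K$ via $k\hookrightarrow\mathcal O_K$. Then the local Kummer pairings of $\psi$ and $\bar\phi$ correspond to each other under the isomorphism $\chi:(\mathcal P_{K^{\rm perf}},\bar\phi)\to(\mathcal P_{K^{\rm perf}},\psi)$ and the natural isomorphism $\mathrm{res}:T^\circ_{\rm ad}(\psi)\to T^\circ_{\rm ad}(\bar\phi)$; that is, for all $u\in\mathcal P_{K^{\rm perf}}$ and all $[\gamma]\in J_K$ we have $$\mathrm{res}\bigl([\chi(u),\gamma)_\psi\bigr)=[u,\gamma)_{\bar\phi}.$$
   Context: Fields. $K$ is a local field of characteristic $p$ with finite residue field $k$ and normalized valuation $v$, extended to a fixed algebraic closure $K^{\rm alg}$; $K^{\rm perf}\subset K^{\rm alg}$ is the perfection of $K$. For an intermediate field $K'$ of $K^{\rm alg}/K$, $\mathcal O_{K'}$ and $\mathfrak m_{K'}$ denote its valuation ring and maximal ideal; $\mathcal O_{K^{\rm alg}}/\mathfrak m_{K^{\rm alg}}=k^{\rm alg}$. There is a unique ring section $k\hookrightarrow\mathcal O_K$ of $\mathcal O_K\to k$. $\mathcal P_{K^{\rm perf}}:=K^{\rm perf}/\mathcal O_{K^{\rm perf}}$. $I_K\subset\mathrm{Gal}(K^{\rm alg}/K^{\rm perf})\cong\mathrm{Gal}(K^{\rm sep}/K)$ is the inertia group and $J_K:=I_K^{\rm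 ab}/(I_K^{\rm ab})^p$ its maximal quotient that is abelian of exponent $p$. Drinfeld modules. $A$ is the ring of elements of a global function field $F$ of characteristic $p$ that are regular outside a fixed place $\infty$. A Drinfeld $A$-module $\psi$ of good reduction over $\mathcal O_K$ is a ring homomorphism $A\to\mathcal O_K[\tau]$ ($\tau x=x^p\tau$), $a\mapsto\psi_a$, of positive rank, such that for every $a\ne0$ the highest coefficient of $\psi_a$ is a unit in $\mathcal O_K$. Polynomials $\sum f_i\tau^i$ act by $\xi\mapsto\sum f_i\xi^{p^i}$, and $(H,\psi)$ denotes $H$ with $A$ acting through $\psi$. The modified adelic Tate module is $T^\circ_{\rm ad}(\psi):=\mathrm{Hom}_A\bigl(F/A,(K^{\rm alg}/\mathfrak m_{K^{\rm alg}},\psi)\bigr)$, and likewise for $\bar\phi$. Isomorphism $\mathrm{res}$. Since $(K^{\rm alg}/\mathcal O_{K^{\rm alg}},\psi)$ is a torsion free $A$-module, any element of $T^\circ_{\rm ad}(\psi)$ takes values in $\mathcal O_{K^{\rm alg}}/\mathfrak m_{K^{\rm alg}}=k^{\rm alg}$, on which the actions of $A$ through $\psi$ and $\bar\phi$ coincide; the same holds for $\bar\phi$. Thus $T^\circ_{\rm ad}(\psi)=\mathrm{Hom}_A(F/A,(k^{\rm alg},\bar\phi))=T^\circ_{\rm ad}(\bar\phi)$, and this identification is $\mathrm{res}$. Local Kummer pairing. For $\xi\in K^{\rm perf}$ and $\gamma\in I_K$, $[\xi,\gamma)_\psi\in T^\circ_{\rm ad}(\psi)$ is the $A$-linear map sending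 $\frac ba+A$ ($a,b\in A$, $a\ne0$) to the class $[\psi_b(\gamma(\xi_a)-\xi_a)]\in K^{\rm alg}/\mathfrak m_{K^{\rm alg}}$, where $\xi_a\in K^{\rm alg}$ is any element with $\psi_a(\xi_a)=\xi$. It is well defined and depends only on $[\xi]\in\mathcal P_{K^{\rm perf}}$ and $[\gamma]\in J_K$. The same definition applies to $\bar\phi$. Isomorphism $\chi$. In the ring of Laurent series $\sum_i x_i\tau^i$ in $\tau^{-1}$ over $\mathcal O_{K^{\rm perf}}$ (with $\tau^ix=x^{p^i}\tau^i$) there is a unique $x=\sum_{j\le0}x_j\tau^j$ with all $x_j\in\mathcal O_K$, $x_0-1\in\mathfrak m_K$, $x_j\in\mathfrak m_K$ for $j<0$, and $\psi_ax=x\bar\phi_a$ for all $a\in A$. The map $\chi([\xi]):=\sum_{j\le0}[x_j\xi^{p^j}]$ (finitely many nonzero terms) is an isomorphism of $A$-modules $(\mathcal P_{K^{\rm perf}},\bar\phi)\to(\mathcal P_{K^{\rm perf}},\psi)$. *)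

theory Defs
  imports
    "HOL-Computational_Algebra.Polynomial"
    "HOL-Library.Extended_Real"
    "HOL-Library.Set_Algebras"
    "HOL-Algebra.Coset"
begin

text \<open>
  The algebraic closure of \<open>K\<close> is the whole type \<open>'l\<close>; \<open>K\<close> and the intermediate fields
  are subsets of it. The global function field \<open>F\<close> is the whole type \<open>'f\<close>.
  An element of a quotient \<open>S/M\<close> of additive groups is a coset \<open>x +o M\<close>, and cosets are added
  with the elementwise sum of \<^theory>\<open>HOL-Library.Set_Algebras\<close>.
\<close>

definition quot :: "'a::plus set \<Rightarrow> 'a set \<Rightarrow> 'a set set" where
  "quot S M = (\<lambda>x. x +o M) ` S"

definition is_subring :: "'a::field set \<Rightarrow> bool" where
  "is_subring R \<longleftrightarrow> 1 \<in> R \<and> (\<forall>x\<in>R. \<forall>y\<in>R. x - y \<in> R \<and> x * y \<in> R)"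

definition is_subfield :: "'a::field set \<Rightarrow> bool" where
  "is_subfield R \<longleftrightarrow> is_subring R \<and> (\<forall>x\<in>R. inverse x \<in> R)"

definition algebraic_over :: "'a::field set \<Rightarrow> 'a \<Rightarrow> bool" where
  "algebraic_over k x \<longleftrightarrow> (\<exists>f. f \<noteq> 0 \<and> (\<forall>i. coeff f i \<in> k) \<and> poly f x = 0)"


section \<open>Local fields of positive characteristic and their algebraic closure\<close>

definition is_valuation :: "('l::field \<Rightarrow> ereal) \<Rightarrow> bool" where
  "is_valuation v \<longleftrightarrow>
     v 0 = \<infinity> \<and> (\<forall>x. x \<noteq> 0 \<longrightarrow> \<bar>v x\<bar> \<noteq> \<infinity>) \<and>
     (\<forall>x y. v (x * y) = v x + v y) \<and> (\<forall>x y. v (x + y) \<ge> min (v x) (v y))"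

definition val_ring :: "('l::field \<Rightarrow> ereal) \<Rightarrow> 'l set \<Rightarrow> 'l set" where
  "val_ring v H = {x \<in> H. v x \<ge> 0}"

definition max_ideal :: "('l::field \<Rightarrow> ereal) \<Rightarrow> 'l set \<Rightarrow> 'l set" where
  "max_ideal v H = {x \<in> H. v x > 0}"

definition complete_wrt :: "('l::field \<Rightarrow> ereal) \<Rightarrow> 'l set \<Rightarrow> bool" where
  "complete_wrt v K \<longleftrightarrow>
     (\<forall>X :: nat \<Rightarrow> 'l.
        (\<forall>n. X n \<in> K) \<and> (\<forall>C::real. \<exists>N. \<forall>m\<ge>N. \<forall>n\<ge>N. v (X m - X n) \<ge> ereal C) \<longrightarrow>
        (\<exists>x\<in>K. \<forall>C::real. \<exists>N. \<forall>n\<ge>N. v (X n - x) \<ge> ereal C))"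

text \<open>
  \<open>K\<close> is a local field of characteristic \<open>p\<close> with algebraic closure \<open>'l\<close>, and \<open>v\<close> is the
  extension to \<open>'l\<close> of the normalized valuation of \<open>K\<close>.
\<close>

definition local_field :: "nat \<Rightarrow> 'l::alg_closed_field set \<Rightarrow> ('l \<Rightarrow> ereal) \<Rightarrow> bool" where
  "local_field p K v \<longleftrightarrow>
     prime p \<and> CHAR('l) = p \<and> is_subfield K \<and> (\<forall>x. algebraic_over K x) \<and>
     is_valuation v \<and> v ` (K - {0}) = range (\<lambda>n::int. ereal (of_int n)) \<and>
     complete_wrt v K \<and> finite (quot (val_ring v K) (max_ideal v K))"

definition perf :: "'l::field set \<Rightarrow> 'l set" where
  "perf K = {x. \<exists>n::nat. x ^ (CHAR('l) ^ n) \<in> K}"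

definition P_perf :: "'l::field set \<Rightarrow> ('l \<Rightarrow> ereal) \<Rightarrow> 'l set set" where
  "P_perf K v = quot (perf K) (val_ring v (perf K))"

definition galois_perf :: "'l::field set \<Rightarrow> ('l \<Rightarrow> 'l) set" where
  "galois_perf K =
     {\<gamma>. bij \<gamma> \<and> (\<forall>x y. \<gamma> (x + y) = \<gamma> x + \<gamma> y) \<and> (\<forall>x y. \<gamma> (x * y) = \<gamma> x * \<gamma> y) \<and>
         (\<forall>x\<in>perf K. \<gamma> x = x)}"

definition inertia :: "'l::field set \<Rightarrow> ('l \<Rightarrow> ereal) \<Rightarrow> ('l \<Rightarrow> 'l) monoid" where
  "inertia K v =
     \<lparr>carrier = {\<gamma> \<in> galois_perf K. \<forall>x\<in>val_ring v UNIV. \<gamma> x - x \<in> max_ideal v UNIV},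
      mult = (\<circ>), one = id\<rparr>"

text \<open>Closedness in the Krull topology: agreement on finite subsets of \<open>'l\<close> gives the
  basic neighbourhoods.\<close>

definition krull_closed_in :: "('l \<Rightarrow> 'l) set \<Rightarrow> ('l \<Rightarrow> 'l) set \<Rightarrow> bool" where
  "krull_closed_in G H \<longleftrightarrow>
     H \<subseteq> G \<and> (\<forall>\<gamma>\<in>G. (\<forall>T. finite T \<longrightarrow> (\<exists>\<sigma>\<in>H. \<forall>t\<in>T. \<sigma> t = \<gamma> t)) \<longrightarrow> \<gamma> \<in> H)"

text \<open>The maximal quotient of the profinite group \<open>I\<^sub>K\<close> that is abelian of exponent \<open>p\<close>:
  factor out the smallest closed normal subgroup with such a quotient.\<close>

definition J_kernel :: "'l::field set \<Rightarrow> ('l \<Rightarrow> ereal) \<Rightarrow> ('l \<Rightarrow> 'l) set" where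
  "J_kernel K v =
     \<Inter>{H. normal H (inertia K v) \<and> krull_closed_in (carrier (inertia K v)) H \<and>
          comm_group (inertia K v Mod H) \<and>
          (\<forall>c\<in>carrier (inertia K v Mod H).
             c [^]\<^bsub>inertia K v Mod H\<^esub> CHAR('l) = \<one>\<^bsub>inertia K v Mod H\<^esub>)}"

definition J_group :: "'l::field set \<Rightarrow> ('l \<Rightarrow> ereal) \<Rightarrow> ('l \<Rightarrow> 'l) set monoid" where
  "J_group K v = inertia K v Mod J_kernel K v"

definition is_residue_section ::
    "'l::field set \<Rightarrow> ('l \<Rightarrow> ereal) \<Rightarrow> ('l set \<Rightarrow> 'l) \<Rightarrow> bool" where
  "is_residue_section K v s \<longleftrightarrow>
     s \<in> quot (val_ring v K) (max_ideal v K) \<rightarrow>\<^sub>E val_ring v K \<and>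
     (\<forall>c\<in>quot (val_ring v K) (max_ideal v K). s c \<in> c) \<and>
     s (1 +o max_ideal v K) = 1 \<and>
     (\<forall>x\<in>val_ring v K. \<forall>y\<in>val_ring v K.
        s ((x + y) +o max_ideal v K) = s (x +o max_ideal v K) + s (y +o max_ideal v K) \<and>
        s ((x * y) +o max_ideal v K) = s (x +o max_ideal v K) * s (y +o max_ideal v K))"

definition residue_section :: "'l::field set \<Rightarrow> ('l \<Rightarrow> ereal) \<Rightarrow> 'l set \<Rightarrow> 'l" where
  "residue_section K v = (THE s. is_residue_section K v s)"


section \<open>Global function fields\<close>

definition prime_field :: "'f::field set" where
  "prime_field = range of_int"

definition rational_functions :: "'f::field \<Rightarrow> 'f set" where
  "rational_functions t =
     {poly f t / poly g t | f g.
        (\<forall>i. coeff f i \<in> prime_field) \<and> (\<forall>i. coeff g i \<in> prime_field) \<and> poly g t \<noteq> 0}"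

text \<open>\<open>'f\<close> has characteristic \<open>p\<close> and is finite over \<open>\<F>\<^sub>p(t)\<close> for some
  transcendental \<open>t\<close>.\<close>

definition global_function_field :: "nat \<Rightarrow> 'f::field itself \<Rightarrow> bool" where
  "global_function_field p _ \<longleftrightarrow>
     prime p \<and> CHAR('f) = p \<and>
     (\<exists>t::'f. \<not> algebraic_over prime_field t \<and>
        (\<exists>B::'f set. finite B \<and>
           (\<forall>x. \<exists>c. (\<forall>b\<in>B. c b \<in> rational_functions t) \<and> x = (\<Sum>b\<in>B. c b * b))))"

text \<open>A place is given by its valuation ring. The constants are finite over
  \<open>\<F>\<^sub>p\<close>, hence automatically contained in it.\<close>

definition is_place :: "'f::field set \<Rightarrow> bool" where
  "is_place R \<longleftrightarrow> is_subring R \<and> R \<noteq> UNIV \<and> (\<forall>x. x \<in> R \<or> inverse x \<in> R)"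

definition regular_outside :: "'f::field set \<Rightarrow> 'f set" where
  "regular_outside Oinf = \<Inter>{R. is_place R \<and> R \<noteq> Oinf}"


section \<open>Twisted Laurent series\<close>

definition frob_pow :: "int \<Rightarrow> 'l::field \<Rightarrow> 'l" where
  "frob_pow i x =
     (if 0 \<le> i then x ^ (CHAR('l) ^ nat i) else (THE y. y ^ (CHAR('l) ^ nat (- i)) = x))"

text \<open>A series \<open>\<Sum>\<^sub>i x\<^sub>i \<tau>\<^sup>i\<close> in \<open>\<tau>\<^sup>-\<^sup>1\<close> is the function \<open>i \<mapsto> x\<^sub>i\<close>; the index set below is
  finite if the supports of both factors are bounded above. The
  twisted polynomials are the series with finite support in nonnegative degrees and are
  encoded by \<open>'l poly\<close> with the variable standing for \<open>\<tau>\<close>; only its additive structure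
  is that of the type \<open>'l poly\<close>.\<close>

definition skew_mult :: "(int \<Rightarrow> 'l::field) \<Rightarrow> (int \<Rightarrow> 'l) \<Rightarrow> int \<Rightarrow> 'l" where
  "skew_mult x y n = (\<Sum>i | x i \<noteq> 0 \<and> y (n - i) \<noteq> 0. x i * frob_pow i (y (n - i)))"

definition series_of_poly :: "'l::field poly \<Rightarrow> int \<Rightarrow> 'l" where
  "series_of_poly f i = (if 0 \<le> i then coeff f (nat i) else 0)"

definition tau_eval :: "'l::field poly \<Rightarrow> 'l \<Rightarrow> 'l" where
  "tau_eval f \<xi> = (\<Sum>i\<le>degree f. coeff f i * \<xi> ^ (CHAR('l) ^ i))"


section \<open>Drinfeld modules\<close>

text \<open>The rank \<open>r\<close> is characterized by \<open>deg\<^sub>\<tau> \<psi>\<^sub>a = r \<cdot> dim (A/(a))\<close> for all nonzero \<open>a\<close>, with the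
  dimension taken over \<open>\<F>\<^sub>p\<close>, i.e. \<open>|A/(a)| = p\<^sup>d\<close> where \<open>d\<close> is the dimension.\<close>

definition drinfeld_rank :: "'f::field set \<Rightarrow> ('f \<Rightarrow> 'l::field poly) \<Rightarrow> nat" where
  "drinfeld_rank A \<psi> =
     (LEAST r. \<forall>a\<in>A - {0}. CHAR('l) ^ degree (\<psi> a) = card (quot A (a *o A)) ^ r)"

definition good_drinfeld_module ::
    "'l::field set \<Rightarrow> ('l \<Rightarrow> ereal) \<Rightarrow> 'f::field set \<Rightarrow> ('f \<Rightarrow> 'l poly) \<Rightarrow> bool" where
  "good_drinfeld_module K v A \<psi> \<longleftrightarrow>
     (\<forall>a\<in>A. \<forall>i. coeff (\<psi> a) i \<in> val_ring v K) \<and>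
     \<psi> 1 = 1 \<and>
     (\<forall>a\<in>A. \<forall>b\<in>A. \<psi> (a + b) = \<psi> a + \<psi> b) \<and>
     (\<forall>a\<in>A. \<forall>b\<in>A.
        series_of_poly (\<psi> (a * b)) = skew_mult (series_of_poly (\<psi> a)) (series_of_poly (\<psi> b))) \<and>
     drinfeld_rank A \<psi> > 0 \<and>
     (\<forall>a\<in>A - {0}. v (lead_coeff (\<psi> a)) = 0)"

text \<open>The reduction modulo \<open>\<mm>\<^sub>K\<close>, with its coefficients in \<open>k\<close> mapped back into \<open>\<O>\<^sub>K\<close>.\<close>

definition reduction ::
    "'l::field set \<Rightarrow> ('l \<Rightarrow> ereal) \<Rightarrow> ('f \<Rightarrow> 'l poly) \<Rightarrow> 'f \<Rightarrow> 'l poly" where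
  "reduction K v \<psi> a = map_poly (\<lambda>x. residue_section K v (x +o max_ideal v K)) (\<psi> a)"

text \<open>The set \<open>Hom\<^sub>A(F/A, (K\<^sup>a\<^sup>l\<^sup>g/\<mm>, \<psi>))\<close>. The class of \<open>a x\<close> is \<open>(a *o c) + A\<close> for any class \<open>c\<close>
  of \<open>x\<close> in \<open>F/A\<close>, and similarly for the action of \<open>\<psi>\<^sub>a\<close> on \<open>K\<^sup>a\<^sup>l\<^sup>g/\<mm>\<close>.\<close>

definition T_ad ::
    "('l::field \<Rightarrow> ereal) \<Rightarrow> 'f::field set \<Rightarrow> ('f \<Rightarrow> 'l poly) \<Rightarrow> ('f set \<Rightarrow> 'l set) set" where
  "T_ad v A \<psi> =
     {f \<in> quot UNIV A \<rightarrow>\<^sub>E quot UNIV (max_ideal v UNIV).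
        (\<forall>c\<in>quot UNIV A. \<forall>d\<in>quot UNIV A. f (c + d) = f c + f d) \<and>
        (\<forall>a\<in>A. \<forall>c\<in>quot UNIV A. f ((a *o c) + A) = tau_eval (\<psi> a) ` f c + max_ideal v UNIV)}"

text \<open>\<open>\<O>/\<mm>\<close> is a subset of \<open>K\<^sup>a\<^sup>l\<^sup>g/\<mm>\<close>; \<open>res\<close> sends a homomorphism to the one with the same
  values in \<open>\<O>/\<mm> = k\<^sup>a\<^sup>l\<^sup>g\<close>.\<close>

definition res ::
    "'l::field set \<Rightarrow> ('l \<Rightarrow> ereal) \<Rightarrow> 'f::field set \<Rightarrow> ('f \<Rightarrow> 'l poly) \<Rightarrow>
     ('f set \<Rightarrow> 'l set) \<Rightarrow> 'f set \<Rightarrow> 'l set" where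
  "res K v A \<psi> =
     (\<lambda>f\<in>T_ad v A \<psi>. THE g. g \<in> T_ad v A (reduction K v \<psi>) \<and>
        (\<forall>c\<in>quot UNIV A. g c \<in> quot (val_ring v UNIV) (max_ideal v UNIV) \<and> g c = f c))"


section \<open>The local Kummer pairing\<close>

definition kummer_elem ::
    "('l::field \<Rightarrow> ereal) \<Rightarrow> 'f::field set \<Rightarrow> ('f \<Rightarrow> 'l poly) \<Rightarrow> 'l \<Rightarrow> ('l \<Rightarrow> 'l) \<Rightarrow>
     'f set \<Rightarrow> 'l set" where
  "kummer_elem v A \<psi> \<xi> \<gamma> =
     (THE f. f \<in> T_ad v A \<psi> \<and>
        (\<forall>a\<in>A - {0}. \<forall>b\<in>A. \<forall>\<xi>a. tau_eval (\<psi> a) \<xi>a = \<xi> \<longrightarrow>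
           f ((b / a) +o A) = tau_eval (\<psi> b) (\<gamma> \<xi>a - \<xi>a) +o max_ideal v UNIV))"

text \<open>The pairing depends only on the classes of \<open>\<xi>\<close> and \<open>\<gamma>\<close>, so arbitrary
  representatives may be chosen.\<close>

definition kummer_pairing ::
    "('l::field \<Rightarrow> ereal) \<Rightarrow> 'f::field set \<Rightarrow> ('f \<Rightarrow> 'l poly) \<Rightarrow> 'l set \<Rightarrow> ('l \<Rightarrow> 'l) set \<Rightarrow>
     'f set \<Rightarrow> 'l set" where
  "kummer_pairing v A \<psi> u g = kummer_elem v A \<psi> (SOME \<xi>. \<xi> \<in> u) (SOME \<gamma>. \<gamma> \<in> g)"


section \<open>The isomorphism between the two actions\<close>

definition chi_series ::
    "'l::field set \<Rightarrow> ('l \<Rightarrow> ereal) \<Rightarrow> 'f::field set \<Rightarrow> ('f \<Rightarrow> 'l poly) \<Rightarrow> int \<Rightarrow> 'l" where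
  "chi_series K v A \<psi> =
     (THE x. (\<forall>j>0. x j = 0) \<and> (\<forall>j\<le>0. x j \<in> val_ring v K) \<and>
        x 0 - 1 \<in> max_ideal v K \<and> (\<forall>j<0. x j \<in> max_ideal v K) \<and>
        (\<forall>a\<in>A. skew_mult (series_of_poly (\<psi> a)) x =
                skew_mult x (series_of_poly (reduction K v \<psi> a))))"

text \<open>The sum runs over the finitely many nonzero terms in \<open>K\<^sup>p\<^sup>e\<^sup>r\<^sup>f/\<O>\<close>, and \<open>\<xi>\<close> is an
  arbitrary representative of \<open>u\<close>.\<close>

definition chi ::
    "'l::field set \<Rightarrow> ('l \<Rightarrow> ereal) \<Rightarrow> 'f::field set \<Rightarrow> ('f \<Rightarrow> 'l poly) \<Rightarrow> 'l set \<Rightarrow> 'l set" where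
  "chi K v A \<psi> u =
     (let x = chi_series K v A \<psi>; \<xi> = (SOME \<xi>. \<xi> \<in> u) in
      (\<Sum>j | j \<le> 0 \<and> x j * frob_pow j \<xi> \<notin> val_ring v (perf K). x j * frob_pow j \<xi>)
        +o val_ring v (perf K))"

end

theory Submission
  imports Defs
begin

text \<open>
Write \<open>\<phi>\<close> for the reduction of \<open>\<psi>\<close>. The pairing \<open>[\<xi>, \<gamma>)\<^sub>\<psi>\<close> sends \<open>b / a\<close> to the class of
\<open>\<psi>\<^sub>b (\<gamma> \<theta> - \<theta>)\<close>, where \<open>\<psi>\<^sub>a \<theta> = \<xi>\<close>.
The series \<open>x\<close> behind \<open>\<chi>\<close> satisfies \<open>\<psi>\<^sub>a x = x \<phi>\<^sub>a\<close>, so a root \<open>\<eta>\<close> of \<open>\<phi>\<^sub>a \<eta> = u\<close> should give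
the root \<open>\<Sum> x\<^sub>j \<eta>\<^bsup>p^j\<^esup>\<close> of \<open>\<psi>\<^sub>a \<theta> = \<chi> u\<close>. The series need not converge, but a long enough
truncation \<open>X \<eta>\<close> solves the equation up to an integral error (\<open>chi_trunc_intertwines\<close>).
Good reduction turns this into an integral error \<open>\<theta> - X \<eta>\<close>, and such an error is
invisible to the pairing, because inertia moves integral elements only within the maximal
ideal. As the coefficients of \<open>x\<close> lie in \<open>K\<close>, \<open>\<gamma> (X \<eta>) - X \<eta> = X (\<gamma> \<eta> - \<eta>)\<close>. Here
\<open>\<gamma> \<eta> - \<eta>\<close> is killed by \<open>\<phi>\<^sub>a\<close>, hence integral, and \<open>x\<close> is congruent to \<open>1\<close>, so
\<open>X (\<gamma> \<eta> - \<eta>)\<close> is congruent to \<open>\<gamma> \<eta> - \<eta>\<close>. On integral elements \<open>\<psi>\<^sub>b\<close> and \<open>\<phi>\<^sub>b\<close> agree modulo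
the maximal ideal. Thus the two pairings have the same values, all of them integral
(\<open>kummer_value_cong_M\<close>, \<open>kummer_elem_reduction\<close>), and \<open>res\<close> does not change values.

The remaining work is to show that the objects introduced by definite description exist
and are unique. Three facts carry it.

First, an equation \<open>u z = f z\<^bsup>p^d\<^esup> + c\<close> with \<open>u\<close> a unit, \<open>f\<close> integral, \<open>d > 0\<close> and \<open>c\<close> in the
maximal ideal of \<open>K\<close> has exactly one solution \<open>z\<close> in that ideal (\<open>artin_schreier_exists\<close>,
\<open>artin_schreier_unique\<close>). It gives the section of the residue field, as the set of
solutions of \<open>y\<^bsup>p^e\<^esup> = y\<close> for a period \<open>e\<close> of Frobenius on the residue field,
and then the coefficients of \<open>x\<close> one after the other, for a single
\<open>a\<close> with \<open>\<psi>\<^sub>a\<close> of positive degree. For any other \<open>b\<close>, the defect \<open>\<psi>\<^sub>b x - x \<phi>\<^sub>b\<close> again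
intertwines \<open>\<psi>\<^sub>a\<close> and \<open>\<phi>\<^sub>a\<close> but has coefficients in the maximal ideal, and therefore vanishes.

Second, the field of fractions of \<open>A\<close> is \<open>F\<close> (\<open>fraction_field\<close>); without it the values at
the classes of \<open>b / a\<close> would not determine a homomorphism on \<open>F / A\<close>. The Drinfeld module
itself provides a transcendental element: positive rank gives some \<open>a\<close> with \<open>\<psi>\<^sub>a\<close>
nonconstant, and the degree in \<open>\<tau>\<close> shows that no nonzero polynomial over the prime field
kills \<open>a\<close>. A count of dimensions makes every \<open>y\<close> in \<open>F\<close> algebraic over the polynomials in
\<open>a\<close>; after multiplication with a leading coefficient \<open>y\<close> becomes integral over them, and
valuation rings are integrally closed.

Third, the value \<open>\<psi>\<^sub>b (\<gamma> \<theta> - \<theta>)\<close> depends only on the class of \<open>b / a\<close>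
(\<open>kummer_independent\<close>), which is a computation with a common denominator.
\<close>

section \<open>Cosets of additive subgroups\<close>

lemma coset_eq_iff:
  fixes M :: "'a::ab_group_add set"
  assumes "0 \<in> M" "\<And>x y. x \<in> M \<Longrightarrow> y \<in> M \<Longrightarrow> x - y \<in> M"
  shows "x +o M = y +o M \<longleftrightarrow> x - y \<in> M"
proof
  assume "x +o M = y +o M"
  then have "x \<in> y +o M" using assms(1) by (metis add.right_neutral set_plus_intro2)
  then show "x - y \<in> M" by (rule set_plus_imp_minus)
next
  assume xy: "x - y \<in> M"
  then have yx: "y - x \<in> M" using assms(2)[OF assms(1) xy] by simp
  have "z - x \<in> M \<longleftrightarrow> z - y \<in> M" for z
    using assms(2)[OF _ xy, of "z - y"] assms(2)[OF _ yx, of "z - x"] by auto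
  then show "x +o M = y +o M" by (auto simp flip: set_minus_plus)
qed

lemma subgroup_plus_self:
  fixes M :: "'a::ab_group_add set"
  assumes "0 \<in> M" "\<And>x y. x \<in> M \<Longrightarrow> y \<in> M \<Longrightarrow> x - y \<in> M"
  shows "M + M = M"
proof -
  have neg: "- y \<in> M" if "y \<in> M" for y using assms(2)[OF assms(1) that] by simp
  have "x + y \<in> M" if "x \<in> M" "y \<in> M" for x y using assms(2)[OF that(1) neg[OF that(2)]] by simp
  moreover have "x \<in> M + M" if "x \<in> M" for x using set_plus_intro[OF that assms(1)] by simp
  ultimately show ?thesis by (auto elim: set_plus_elim)
qed

lemma coset_plus_coset:
  fixes M :: "'a::ab_group_add set"
  assumes "0 \<in> M" "\<And>x y. x \<in> M \<Longrightarrow> y \<in> M \<Longrightarrow> x - y \<in> M"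
  shows "(x +o M) + (y +o M) = (x + y) +o M"
  by (simp add: set_plus_rearrange subgroup_plus_self[OF assms])

lemma image_coset_plus:
  fixes M :: "'a::ab_group_add set" and N :: "'b::ab_group_add set"
  assumes h: "\<And>x y. h (x + y) = h x + h y" and hM: "\<And>x. x \<in> M \<Longrightarrow> h x \<in> N" and M: "0 \<in> M"
    and N: "0 \<in> N" "\<And>x y. x \<in> N \<Longrightarrow> y \<in> N \<Longrightarrow> x - y \<in> N"
  shows "h ` (x +o M) + N = h x +o N"
proof -
  have "h 0 + h 0 = h 0" using h[of 0 0] by simp
  then have h0: "h 0 = 0" by simp
  have "x +o M = (\<lambda>y. x + y) ` M" "h x +o (h ` M) = (\<lambda>y. h x + h y) ` M"
    by (auto simp: elt_set_plus_def)
  then have "h ` (x +o M) = h x +o (h ` M)" by (simp add: image_image h)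
  then have "h ` (x +o M) + N = h x +o (h ` M + N)" by (simp add: set_plus_rearrange3)
  also have "h ` M + N = N"
  proof
    have "h ` M + N \<subseteq> N + N" using hM by (intro set_plus_mono2) auto
    then show "h ` M + N \<subseteq> N" by (simp add: subgroup_plus_self[OF N])
    show "N \<subseteq> h ` M + N" using M h0 by (intro set_zero_plus2) force
  qed
  finally show ?thesis .
qed

section \<open>Integral powers of Frobenius\<close>

locale frobenius_field =
  fixes ty :: "'l::alg_closed_field itself"
  assumes prime_char: "prime CHAR('l)"
begin

lemma char_gt_1: "CHAR('l) > 1"
  using prime_char by (rule prime_gt_1_nat)

lemma power_char_add: "(x + y :: 'l) ^ (CHAR('l) ^ n) = x ^ (CHAR('l) ^ n) + y ^ (CHAR('l) ^ n)"
  using freshmans_dream'[OF prime_char refl] .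

lemma power_char_diff: "(x - y :: 'l) ^ (CHAR('l) ^ n) = x ^ (CHAR('l) ^ n) - y ^ (CHAR('l) ^ n)"
  using power_char_add[of "x - y" y n] by simp

text \<open>
Frobenius is injective because a field has no nilpotent elements.
\<close>

lemma power_char_inj:
  assumes "(x :: 'l) ^ (CHAR('l) ^ n) = y ^ (CHAR('l) ^ n)"
  shows "x = y"
proof -
  have "x ^ (CHAR('l) ^ n) = (x - y) ^ (CHAR('l) ^ n) + y ^ (CHAR('l) ^ n)"
    using power_char_add[of "x - y" y n] by simp
  with assms have "(x - y) ^ (CHAR('l) ^ n) = 0" by simp
  then show ?thesis by simp
qed

lemma frob_pow_nat: "frob_pow (int n) (x :: 'l) = x ^ (CHAR('l) ^ n)"
  by (simp add: frob_pow_def)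

lemma frob_pow_root: "(frob_pow (- int n) (x :: 'l)) ^ (CHAR('l) ^ n) = x"
proof (cases "n = 0")
  case False
  have "\<exists>y. y ^ (CHAR('l) ^ n) = x"
    using nth_root_exists[of "CHAR('l) ^ n" x] char_gt_1 by auto
  then have "\<exists>!y. y ^ (CHAR('l) ^ n) = x"
    using power_char_inj by blast
  from theI'[OF this] False show ?thesis by (simp add: frob_pow_def)
qed (simp add: frob_pow_def)

text \<open>
Raising to a high power of \<open>p\<close> turns negative powers of Frobenius into nonnegative ones.
With the injectivity of Frobenius this reduces every identity about \<open>frob_pow\<close> to one
about ordinary powers; \<open>frob_pow_eqI\<close> packages the argument.
\<close>

lemma frob_pow_power_char: "(frob_pow i (x :: 'l)) ^ (CHAR('l) ^ n) = frob_pow (i + int n) x"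
proof (cases "i \<ge> 0")
  case True
  then obtain m where "i = int m" by (metis nonneg_int_cases)
  then show ?thesis
    using frob_pow_nat[of m x] frob_pow_nat[of "m + n" x]
    by (simp add: power_add power_mult)
next
  case False
  then obtain m where i: "i = - int m" by (metis int_cases2 of_nat_0_le_iff)
  show ?thesis
  proof (cases "m \<le> n")
    case True
    then obtain l where n: "n = m + l" using le_Suc_ex by blast
    then have "(frob_pow i x) ^ (CHAR('l) ^ n) = x ^ (CHAR('l) ^ l)"
      by (simp add: i power_add power_mult frob_pow_root)
    then show ?thesis using frob_pow_nat[of l x] by (simp add: i n)
  next
    case False
    then obtain l where m: "m = n + l" using le_Suc_ex nat_le_linear by blast
    have "((frob_pow i x) ^ (CHAR('l) ^ n)) ^ (CHAR('l) ^ l) = x"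
      using frob_pow_root[of m x] by (simp add: i m power_add power_mult)
    also have "\<dots> = (frob_pow (i + int n) x) ^ (CHAR('l) ^ l)"
      using frob_pow_root[of l x] by (simp add: i m)
    finally show ?thesis by (rule power_char_inj)
  qed
qed

lemma frob_pow_eqI:
  assumes "i + int n \<ge> 0" "y ^ (CHAR('l) ^ n) = (x :: 'l) ^ (CHAR('l) ^ nat (i + int n))"
  shows "frob_pow i x = y"
  using assms power_char_inj[of "frob_pow i x" n y] frob_pow_nat[of "nat (i + int n)" x]
  by (simp add: frob_pow_power_char)

lemma frob_pow_power_char_nat:
  assumes "i + int n \<ge> 0"
  shows "(frob_pow i (x :: 'l)) ^ (CHAR('l) ^ n) = x ^ (CHAR('l) ^ nat (i + int n))"
  using assms frob_pow_nat[of "nat (i + int n)" x] by (simp add: frob_pow_power_char)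

lemma frob_pow_add: "frob_pow i (x + y :: 'l) = frob_pow i x + frob_pow i y"
  by (rule frob_pow_eqI[of _ "nat \<bar>i\<bar>"]) (simp_all add: power_char_add frob_pow_power_char_nat)

lemma frob_pow_mult: "frob_pow i (x * y :: 'l) = frob_pow i x * frob_pow i y"
  by (rule frob_pow_eqI[of _ "nat \<bar>i\<bar>"]) (simp_all add: power_mult_distrib frob_pow_power_char_nat)

lemma frob_pow_0 [simp]: "frob_pow i (0 :: 'l) = 0"
  using frob_pow_add[of i 0 0] by (simp only: add_0_right add_cancel_right_right)

lemma frob_pow_diff: "frob_pow i (x - y :: 'l) = frob_pow i x - frob_pow i y"
  using frob_pow_add[of i "x - y" y] by simp

lemma frob_pow_sum: "frob_pow i (\<Sum>s\<in>S. f s :: 'l) = (\<Sum>s\<in>S. frob_pow i (f s))"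
  by (induction S rule: infinite_finite_induct) (simp_all add: frob_pow_add)

lemma frob_pow_frob_pow: "frob_pow i (frob_pow j (x :: 'l)) = frob_pow (i + j) x"
proof (rule frob_pow_eqI[of _ "nat \<bar>i\<bar>"])
  let ?n = "nat \<bar>i\<bar>"
  have "i + j + int ?n = j + int (nat (i + int ?n))" by linarith
  then have "(frob_pow (i + j) x) ^ (CHAR('l) ^ ?n) = frob_pow (j + int (nat (i + int ?n))) x"
    by (simp only: frob_pow_power_char)
  also have "\<dots> = (frob_pow j x) ^ (CHAR('l) ^ nat (i + int ?n))"
    by (simp only: frob_pow_power_char)
  finally show "(frob_pow (i + j) x) ^ (CHAR('l) ^ ?n) = (frob_pow j x) ^ (CHAR('l) ^ nat (i + int ?n))" .
qed simp

lemma frob_pow_index_0 [simp]: "frob_pow 0 (x :: 'l) = x"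
  using frob_pow_nat[of 0 x] by simp

lemma frob_pow_eq_0_iff [simp]: "frob_pow i (x :: 'l) = 0 \<longleftrightarrow> x = 0"
proof
  assume "frob_pow i x = 0"
  then have "frob_pow (- i) (frob_pow i x) = 0" by simp
  then show "x = 0" by (simp add: frob_pow_frob_pow)
qed simp


section \<open>Twisted Laurent series\<close>

definition tau_degree_le :: "(int \<Rightarrow> 'l) \<Rightarrow> int \<Rightarrow> bool" where
  "tau_degree_le x a \<longleftrightarrow> (\<forall>i>a. x i = 0)"

lemma skew_mult_eq_sum:
  assumes "finite S" "\<And>i. x i \<noteq> 0 \<Longrightarrow> y (n - i) \<noteq> 0 \<Longrightarrow> i \<in> S"
  shows "skew_mult x y n = (\<Sum>i\<in>S. x i * frob_pow i (y (n - i) :: 'l))"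
  unfolding skew_mult_def using assms by (intro sum.mono_neutral_left) auto

lemma skew_mult_eq_interval:
  assumes "tau_degree_le x a" "tau_degree_le y b" "l \<le> n - b" "a \<le> u"
  shows "skew_mult x y n = (\<Sum>i=l..u. x i * frob_pow i (y (n - i) :: 'l))"
  using assms by (intro skew_mult_eq_sum) (force simp: tau_degree_le_def not_less)+

lemma tau_degree_le_skew_mult:
  assumes "tau_degree_le x a" "tau_degree_le y b"
  shows "tau_degree_le (skew_mult x y) (a + b)"
  unfolding tau_degree_le_def
  using skew_mult_eq_interval[OF assms order_refl order_refl] by simp

lemma tau_degree_le_diff:
  "tau_degree_le x a \<Longrightarrow> tau_degree_le y a \<Longrightarrow> tau_degree_le (\<lambda>i. x i - y i) a"
  by (simp add: tau_degree_le_def)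

lemma skew_mult_diff_left:
  assumes "tau_degree_le x a" "tau_degree_le x' a" "tau_degree_le y b"
  shows "skew_mult (\<lambda>i. x i - x' i) y = (\<lambda>n. skew_mult x y n - skew_mult x' y n)"
  by (rule ext) (simp add: assms skew_mult_eq_interval[OF _ assms(3) order_refl order_refl, of _ a]
      tau_degree_le_diff left_diff_distrib sum_subtractf)

lemma skew_mult_diff_right:
  assumes "tau_degree_le x a" "tau_degree_le y b" "tau_degree_le y' b"
  shows "skew_mult x (\<lambda>i. y i - y' i) = (\<lambda>n. skew_mult x y n - skew_mult x y' n)"
  by (rule ext) (simp add: assms skew_mult_eq_interval[OF assms(1) _ order_refl order_refl, of _ b]
      tau_degree_le_diff right_diff_distrib sum_subtractf frob_pow_diff)

text \<open>
The bounds on the three supports cut both sides down to the same finite double sum, over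
the exponent \<open>i\<close> taken from \<open>x\<close> and the exponent \<open>k\<close> taken from \<open>x y\<close>.
\<close>

lemma skew_mult_assoc:
  assumes x: "tau_degree_le x a" and y: "tau_degree_le y b" and z: "tau_degree_le z c"
  shows "skew_mult (skew_mult x y) z = skew_mult x (skew_mult y z)"
proof
  fix n
  have "skew_mult (skew_mult x y) z n
      = (\<Sum>k=n-c..a+b. skew_mult x y k * frob_pow k (z (n - k)))"
    using tau_degree_le_skew_mult[OF x y] z by (rule skew_mult_eq_interval) simp_all
  also have "\<dots> = (\<Sum>k=n-c..a+b. (\<Sum>i=n-b-c..a. x i * frob_pow i (y (k - i))) * frob_pow k (z (n - k)))"
    by (intro sum.cong refl arg_cong2[where f = "(*)"] skew_mult_eq_interval[OF x y]) auto
  also have "\<dots> = (\<Sum>k=n-c..a+b. \<Sum>i=n-b-c..a. x i * frob_pow i (y (k - i) * frob_pow (k - i) (z (n - k))))"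
    by (simp add: sum_distrib_right frob_pow_mult frob_pow_frob_pow mult.assoc)
  also have "\<dots> = (\<Sum>i=n-b-c..a. \<Sum>k=n-c..a+b. x i * frob_pow i (y (k - i) * frob_pow (k - i) (z (n - k))))"
    by (rule sum.swap)
  also have "\<dots> = (\<Sum>i=n-b-c..a. x i * frob_pow i (\<Sum>k=n-c..a+b. y (k - i) * frob_pow (k - i) (z (n - k))))"
    by (simp add: sum_distrib_left frob_pow_sum)
  also have "\<dots> = (\<Sum>i=n-b-c..a. x i * frob_pow i (skew_mult y z (n - i)))"
  proof (intro sum.cong refl arg_cong2[where f = "(*)"] arg_cong2[where f = frob_pow])
    fix i assume i: "i \<in> {n-b-c..a}"
    have "(\<Sum>k=n-c..a+b. y (k - i) * frob_pow (k - i) (z (n - k)))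
        = (\<Sum>l=n-c-i..a+b-i. y l * frob_pow l (z (n - i - l)))"
      by (rule sum.reindex_bij_witness[of _ "\<lambda>l. l + i" "\<lambda>k. k - i"]) (auto simp: algebra_simps)
    also have "\<dots> = skew_mult y z (n - i)"
      using i by (intro skew_mult_eq_interval[OF y z, symmetric]) auto
    finally show "(\<Sum>k=n-c..a+b. y (k - i) * frob_pow (k - i) (z (n - k))) = skew_mult y z (n - i)" .
  qed
  also have "\<dots> = skew_mult x (skew_mult y z) n"
    by (rule skew_mult_eq_interval[OF x tau_degree_le_skew_mult[OF y z], symmetric]) auto
  finally show "skew_mult (skew_mult x y) z n = skew_mult x (skew_mult y z) n" .
qed

lemma tau_degree_le_series_of_poly: "tau_degree_le (series_of_poly f) (int (degree f))"
  by (auto simp: tau_degree_le_def series_of_poly_def coeff_eq_0)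

lemma series_of_poly_nat [simp]: "series_of_poly f (int n) = coeff f n"
  by (simp add: series_of_poly_def)

lemma series_of_poly_neg [simp]: "i < 0 \<Longrightarrow> series_of_poly f i = 0"
  by (simp add: series_of_poly_def)

lemma skew_mult_poly_left:
  assumes "degree f \<le> d"
  shows "skew_mult (series_of_poly f) y n = (\<Sum>i\<le>d. coeff f i * (y (n - int i) :: 'l) ^ (CHAR('l) ^ i))"
proof -
  have "skew_mult (series_of_poly f) y n
      = (\<Sum>i\<in>int ` {..d}. series_of_poly f i * frob_pow i (y (n - i)))"
  proof (rule skew_mult_eq_sum)
    fix i assume "series_of_poly f i \<noteq> 0"
    then have "i = int (nat i)" "nat i \<le> d"
      using assms by (auto simp: series_of_poly_def split: if_splits dest!: le_degree)
    then show "i \<in> int ` {..d}" by (metis atMost_iff image_eqI)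
  qed simp
  then show ?thesis by (simp add: sum.reindex frob_pow_nat)
qed

lemma skew_mult_poly_right:
  assumes "degree g \<le> d"
  shows "skew_mult y (series_of_poly g) n
       = (\<Sum>i\<le>d. y (n - int i) * frob_pow (n - int i) (coeff g i :: 'l))"
proof -
  have "skew_mult y (series_of_poly g) n
      = (\<Sum>j\<in>(\<lambda>i. n - int i) ` {..d}. y j * frob_pow j (series_of_poly g (n - j)))"
  proof (rule skew_mult_eq_sum)
    fix j assume "series_of_poly g (n - j) \<noteq> 0"
    then have "j = n - int (nat (n - j))" "nat (n - j) \<le> d"
      using assms by (auto simp: series_of_poly_def split: if_splits dest!: le_degree)
    then show "j \<in> (\<lambda>i. n - int i) ` {..d}" by (metis atMost_iff image_eqI)
  qed simp
  also have "\<dots> = (\<Sum>i\<le>d. y (n - int i) * frob_pow (n - int i) (coeff g i))"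
    by (subst sum.reindex) (auto intro: inj_onI)
  finally show ?thesis .
qed

lemma tau_eval_eq_sum:
  assumes "l \<le> 0" "int (degree f) \<le> u"
  shows "tau_eval f (\<xi> :: 'l) = (\<Sum>i=l..u. series_of_poly f i * frob_pow i \<xi>)"
proof -
  have "tau_eval f \<xi> = (\<Sum>i\<in>int ` {..degree f}. series_of_poly f i * frob_pow i \<xi>)"
    by (simp add: tau_eval_def sum.reindex frob_pow_nat)
  also have "\<dots> = (\<Sum>i=l..u. series_of_poly f i * frob_pow i \<xi>)"
  proof (rule sum.mono_neutral_left)
    show "\<forall>i\<in>{l..u} - int ` {..degree f}. series_of_poly f i * frob_pow i \<xi> = 0"
    proof
      fix i assume i: "i \<in> {l..u} - int ` {..degree f}"
      show "series_of_poly f i * frob_pow i \<xi> = 0"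
      proof (cases "i < 0")
        case False
        then have "int (nat i) = i" by simp
        then have "degree f < nat i" using i by (metis DiffD2 atMost_iff imageI not_less)
        then show ?thesis by (simp add: series_of_poly_def coeff_eq_0)
      qed simp
    qed
  qed (use assms in auto)
  finally show ?thesis .
qed

lemma tau_eval_add: "tau_eval f (x + y :: 'l) = tau_eval f x + tau_eval f y"
  by (simp add: tau_eval_def power_char_add ring_distribs sum.distrib)

lemma tau_eval_diff: "tau_eval f (x - y :: 'l) = tau_eval f x - tau_eval f y"
  using tau_eval_add[of f "x - y" y] by simp

lemma tau_eval_0 [simp]: "tau_eval f (0 :: 'l) = 0"
  using tau_eval_diff[of f 0 0] by simp

lemma series_of_poly_add:
  "series_of_poly (f + g) i = series_of_poly f i + series_of_poly g i"
  by (simp add: series_of_poly_def)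

lemma tau_eval_poly_add: "tau_eval (f + g) (x :: 'l) = tau_eval f x + tau_eval g x"
proof -
  let ?d = "int (max (degree f) (degree g))"
  have "int (degree (f + g)) \<le> ?d" using degree_add_le_max[of f g] by linarith
  then show ?thesis
    by (simp add: tau_eval_eq_sum[of 0 _ ?d] series_of_poly_add ring_distribs sum.distrib)
qed

lemma tau_eval_poly_uminus: "tau_eval (- f) (x :: 'l) = - tau_eval f x"
  by (simp add: tau_eval_def sum_negf)

lemma tau_eval_poly_diff: "tau_eval (f - g) (x :: 'l) = tau_eval f x - tau_eval g x"
  using tau_eval_poly_add[of f "- g" x] by (simp add: tau_eval_poly_uminus)

text \<open>
Evaluation of twisted polynomials turns the twisted product into composition: \<open>\<tau> a = a\<^sup>p \<tau>\<close>
is the rule for moving Frobenius past a multiplication.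
\<close>

lemma tau_eval_skew_mult:
  assumes h: "series_of_poly h = skew_mult (series_of_poly f) (series_of_poly (g :: 'l poly))"
  shows "tau_eval h \<xi> = tau_eval f (tau_eval g \<xi>)"
proof -
  let ?f = "series_of_poly f" and ?g = "series_of_poly g"
  let ?m = "int (degree f)" and ?n = "int (degree g)"
  note fg = tau_degree_le_series_of_poly[of f] tau_degree_le_series_of_poly[of g]
  have "tau_degree_le (series_of_poly h) (?m + ?n)"
    unfolding h using fg by (rule tau_degree_le_skew_mult)
  then have "int (degree h) \<le> ?m + ?n"
    by (metis degree_0 leading_coeff_0_iff linorder_not_le of_nat_0 of_nat_0_le_iff
        series_of_poly_nat tau_degree_le_def add_nonneg_nonneg)
  then have "tau_eval h \<xi> = (\<Sum>k=-?n..?m+?n. skew_mult ?f ?g k * frob_pow k \<xi>)"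
    by (simp add: h[symmetric] tau_eval_eq_sum)
  also have "\<dots> = (\<Sum>k=-?n..?m+?n. (\<Sum>i=-2*?n..?m. ?f i * frob_pow i (?g (k - i))) * frob_pow k \<xi>)"
    by (intro sum.cong refl arg_cong2[where f = "(*)"] skew_mult_eq_interval[OF fg]) auto
  also have "\<dots> = (\<Sum>k=-?n..?m+?n. \<Sum>i=-2*?n..?m. ?f i * frob_pow i (?g (k - i) * frob_pow (k - i) \<xi>))"
    by (simp add: sum_distrib_right frob_pow_mult frob_pow_frob_pow mult.assoc)
  also have "\<dots> = (\<Sum>i=-2*?n..?m. \<Sum>k=-?n..?m+?n. ?f i * frob_pow i (?g (k - i) * frob_pow (k - i) \<xi>))"
    by (rule sum.swap)
  also have "\<dots> = (\<Sum>i=-2*?n..?m. ?f i * frob_pow i (\<Sum>k=-?n..?m+?n. ?g (k - i) * frob_pow (k - i) \<xi>))"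
    by (simp add: sum_distrib_left frob_pow_sum)
  also have "\<dots> = (\<Sum>i=-2*?n..?m. ?f i * frob_pow i (tau_eval g \<xi>))"
  proof (intro sum.cong refl)
    fix i assume i: "i \<in> {-2*?n..?m}"
    show "?f i * frob_pow i (\<Sum>k=-?n..?m+?n. ?g (k - i) * frob_pow (k - i) \<xi>)
        = ?f i * frob_pow i (tau_eval g \<xi>)"
    proof (cases "i < 0")
      case False
      have "(\<Sum>k=-?n..?m+?n. ?g (k - i) * frob_pow (k - i) \<xi>)
          = (\<Sum>l=-?n-i..?m+?n-i. ?g l * frob_pow l \<xi>)"
        by (rule sum.reindex_bij_witness[of _ "\<lambda>l. l + i" "\<lambda>k. k - i"]) auto
      also have "\<dots> = tau_eval g \<xi>"
        using i False by (intro tau_eval_eq_sum[symmetric]) auto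
      finally show ?thesis by simp
    qed simp
  qed
  also have "\<dots> = tau_eval f (tau_eval g \<xi>)"
    by (rule tau_eval_eq_sum[symmetric]) auto
  finally show ?thesis .
qed

end


section \<open>The valuation\<close>

locale char_p_local_field =
  fixes p :: nat and K :: "'l::alg_closed_field set" and v :: "'l \<Rightarrow> ereal"
  assumes local_field: "local_field p K v"
begin

sublocale frobenius_field "TYPE('l)"
  using local_field by unfold_locales (simp add: local_field_def)

abbreviation "\<O> \<equiv> val_ring v UNIV"
abbreviation "\<M> \<equiv> max_ideal v UNIV"
abbreviation "\<O>K \<equiv> val_ring v K"
abbreviation "\<M>K \<equiv> max_ideal v K"

lemma valuation: "is_valuation v"
  using local_field by (simp add: local_field_def)

lemma v_0 [simp]: "v 0 = \<infinity>"
  using valuation by (simp add: is_valuation_def)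

lemma v_finite: "x \<noteq> 0 \<Longrightarrow> \<bar>v x\<bar> \<noteq> \<infinity>"
  using valuation by (simp add: is_valuation_def)

lemma v_mult: "v (x * y) = v x + v y"
  using valuation by (simp add: is_valuation_def)

lemma v_add: "v (x + y) \<ge> min (v x) (v y)"
  using valuation by (simp add: is_valuation_def)

lemma v_1 [simp]: "v 1 = 0"
  using v_mult[of 1 1] v_finite[of 1] by (cases "v 1") (auto simp: zero_ereal_def)

lemma v_uminus [simp]: "v (- x) = v x"
proof -
  have "v (- 1) + v (- 1) = 0" using v_mult[of "- 1" "- 1"] by simp
  then have "v (- 1) = 0" by (cases "v (- 1)") (auto simp: zero_ereal_def)
  then show ?thesis using v_mult[of "- 1" x] by simp
qed

lemma v_diff: "v (x - y) \<ge> min (v x) (v y)"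
  using v_add[of x "- y"] by simp

lemma v_inverse: "v (inverse x) = - v x" if "x \<noteq> 0"
proof -
  have "v x + v (inverse x) = 0" using v_mult[of x "inverse x"] that by simp
  then show ?thesis using v_finite[OF that]
    by (cases "v x"; cases "v (inverse x)") (auto simp: zero_ereal_def)
qed

lemma v_power: "v (x ^ n) = ereal (real n) * v x" if "x \<noteq> 0"
proof -
  from v_finite[OF that] obtain r where r: "v x = ereal r" by (cases "v x") auto
  show ?thesis by (induction n) (simp_all add: v_mult r zero_ereal_def ring_distribs)
qed

lemma O_iff: "x \<in> \<O> \<longleftrightarrow> 0 \<le> v x" by (simp add: val_ring_def)
lemma M_iff: "x \<in> \<M> \<longleftrightarrow> 0 < v x" by (simp add: max_ideal_def)
lemma OK_iff: "x \<in> \<O>K \<longleftrightarrow> x \<in> K \<and> x \<in> \<O>" by (auto simp add: val_ring_def)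
lemma MK_iff: "x \<in> \<M>K \<longleftrightarrow> x \<in> K \<and> x \<in> \<M>" by (auto simp add: max_ideal_def)

lemma O_0 [simp]: "0 \<in> \<O>" and O_1 [simp]: "1 \<in> \<O>" and M_0 [simp]: "0 \<in> \<M>"
  and one_notin_M [simp]: "1 \<notin> \<M>"
  by (simp_all add: O_iff M_iff)

lemma M_imp_O: "x \<in> \<M> \<Longrightarrow> x \<in> \<O>"
  by (simp add: O_iff M_iff)

lemma O_add: "x \<in> \<O> \<Longrightarrow> y \<in> \<O> \<Longrightarrow> x + y \<in> \<O>"
  using v_add[of x y] by (simp add: O_iff min_def split: if_splits)

lemma O_diff: "x \<in> \<O> \<Longrightarrow> y \<in> \<O> \<Longrightarrow> x - y \<in> \<O>"
  using v_diff[of x y] by (simp add: O_iff min_def split: if_splits)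

lemma O_mult: "x \<in> \<O> \<Longrightarrow> y \<in> \<O> \<Longrightarrow> x * y \<in> \<O>"
  by (simp add: O_iff v_mult)

lemma O_power: "x \<in> \<O> \<Longrightarrow> x ^ n \<in> \<O>"
  by (induction n) (simp_all add: O_mult)

lemma O_sum: "(\<And>s. s \<in> S \<Longrightarrow> f s \<in> \<O>) \<Longrightarrow> (\<Sum>s\<in>S. f s) \<in> \<O>"
  by (induction S rule: infinite_finite_induct) (simp_all add: O_add)

lemma M_add: "x \<in> \<M> \<Longrightarrow> y \<in> \<M> \<Longrightarrow> x + y \<in> \<M>"
  using v_add[of x y] by (simp add: M_iff min_def split: if_splits)

lemma M_diff: "x \<in> \<M> \<Longrightarrow> y \<in> \<M> \<Longrightarrow> x - y \<in> \<M>"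
  using v_diff[of x y] by (simp add: M_iff min_def split: if_splits)

lemma M_uminus_iff [simp]: "- x \<in> \<M> \<longleftrightarrow> x \<in> \<M>" by (simp add: M_iff)

lemma M_mult_left: "x \<in> \<O> \<Longrightarrow> y \<in> \<M> \<Longrightarrow> x * y \<in> \<M>"
  by (simp add: O_iff M_iff v_mult add_nonneg_pos)

lemma M_mult_right: "x \<in> \<M> \<Longrightarrow> y \<in> \<O> \<Longrightarrow> x * y \<in> \<M>"
  using M_mult_left[of y x] by (simp add: mult.commute)

lemma M_power: "x \<in> \<M> \<Longrightarrow> n > 0 \<Longrightarrow> x ^ n \<in> \<M>"
  by (cases n) (simp_all add: M_mult_right O_power M_imp_O)

lemma M_sum: "(\<And>s. s \<in> S \<Longrightarrow> f s \<in> \<M>) \<Longrightarrow> (\<Sum>s\<in>S. f s) \<in> \<M>"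
  by (induction S rule: infinite_finite_induct) (simp_all add: M_add)

lemma M_diff_trans: "x - y \<in> \<M> \<Longrightarrow> y - z \<in> \<M> \<Longrightarrow> x - z \<in> \<M>"
  using M_add[of "x - y" "y - z"] by simp

lemma M_diff_commute: "x - y \<in> \<M> \<longleftrightarrow> y - x \<in> \<M>"
  using M_uminus_iff[of "x - y"] by simp

lemma M_diff_mult:
  "x - x' \<in> \<M> \<Longrightarrow> y - y' \<in> \<M> \<Longrightarrow> x' \<in> \<O> \<Longrightarrow> y \<in> \<O> \<Longrightarrow> x * y - x' * y' \<in> \<M>"
  using M_add[OF M_mult_right[of "x - x'" y] M_mult_left[of x' "y - y'"]]
  by (simp add: algebra_simps)

lemma inverse_in_M: "x \<notin> \<O> \<Longrightarrow> inverse x \<in> \<M>"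
  using v_inverse[of x] by (cases "x = 0") (auto simp: O_iff M_iff not_le)

lemma O_of_power: "x ^ n \<in> \<O> \<Longrightarrow> n > 0 \<Longrightarrow> x \<in> \<O>"
proof (rule ccontr)
  assume x: "x ^ n \<in> \<O>" "n > 0" "x \<notin> \<O>"
  then have "x ^ n * inverse x ^ n \<in> \<M>" by (intro M_mult_left M_power inverse_in_M)
  moreover have "x \<noteq> 0" using x by auto
  ultimately show False by (simp add: power_inverse)
qed

lemma unit_iff: "v x = 0 \<longleftrightarrow> x \<in> \<O> \<and> x \<notin> \<M>"
  by (auto simp: O_iff M_iff)

lemma unit_inverse: "v x = 0 \<Longrightarrow> v (inverse x) = 0"
  using v_inverse[of x] by (cases "x = 0") auto

lemma M_of_power: "x ^ n \<in> \<M> \<Longrightarrow> n > 0 \<Longrightarrow> x \<in> \<M>"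
proof (rule ccontr)
  assume x: "x ^ n \<in> \<M>" "n > 0" "x \<notin> \<M>"
  then have u: "v x = 0" using O_of_power[of x n] by (auto simp: unit_iff M_imp_O)
  then have "v (x ^ n) = 0" by (induction n) (simp_all add: v_mult)
  then show False using x by (simp add: unit_iff)
qed

lemma char_pos: "CHAR('l) > 0"
  using char_gt_1 by simp

text \<open>
Valuation rings are closed under roots, so that negative powers of Frobenius preserve
integrality as well.
\<close>

lemma frob_pow_O: "x \<in> \<O> \<Longrightarrow> frob_pow i x \<in> \<O>"
  by (rule O_of_power[of _ "CHAR('l) ^ nat \<bar>i\<bar>"])
    (simp_all add: frob_pow_power_char_nat O_power char_pos)

lemma frob_pow_M: "x \<in> \<M> \<Longrightarrow> frob_pow i x \<in> \<M>"
  by (rule M_of_power[of _ "CHAR('l) ^ nat \<bar>i\<bar>"])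
    (simp_all add: frob_pow_power_char_nat M_power char_pos)

lemma frob_pow_unit: "v x = 0 \<Longrightarrow> v (frob_pow i x) = 0"
  using frob_pow_O[of x i] frob_pow_M[of "frob_pow i x" "- i"]
  by (auto simp: unit_iff frob_pow_frob_pow)

lemma K_diff: "x \<in> K \<Longrightarrow> y \<in> K \<Longrightarrow> x - y \<in> K"
  and K_mult: "x \<in> K \<Longrightarrow> y \<in> K \<Longrightarrow> x * y \<in> K"
  and K_1 [simp]: "1 \<in> K" and K_inverse: "x \<in> K \<Longrightarrow> inverse x \<in> K"
  using local_field by (simp_all add: local_field_def is_subfield_def is_subring_def)

lemma K_0 [simp]: "0 \<in> K" using K_diff[of 1 1] by simp

lemma K_uminus: "x \<in> K \<Longrightarrow> - x \<in> K" using K_diff[of 0 x] by simp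

lemma K_add: "x \<in> K \<Longrightarrow> y \<in> K \<Longrightarrow> x + y \<in> K"
  using K_diff[of x "- y"] K_uminus by simp

lemma K_power: "x \<in> K \<Longrightarrow> x ^ n \<in> K" by (induction n) (simp_all add: K_mult)

lemma K_sum: "(\<And>s. s \<in> S \<Longrightarrow> f s \<in> K) \<Longrightarrow> (\<Sum>s\<in>S. f s) \<in> K"
  by (induction S rule: infinite_finite_induct) (simp_all add: K_add)

lemma v_K: "x \<in> K \<Longrightarrow> x \<noteq> 0 \<Longrightarrow> \<exists>n::int. v x = ereal (of_int n)"
  using local_field unfolding local_field_def by blast

lemma v_MK: "x \<in> \<M>K \<Longrightarrow> v x \<ge> 1"
  using v_K[of x] by (cases "x = 0") (auto simp: MK_iff M_iff one_ereal_def)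

lemma uniformizer: obtains \<pi> where "\<pi> \<in> \<M>K" "v \<pi> = 1"
proof -
  have "ereal (of_int 1) \<in> v ` (K - {0})"
    using local_field unfolding local_field_def by blast
  then obtain \<pi> where "ereal (of_int 1) = v \<pi>" "\<pi> \<in> K" by auto
  then have "\<pi> \<in> K" "v \<pi> = 1" by (simp_all add: one_ereal_def)
  then show ?thesis using that[of \<pi>] by (auto simp: MK_iff M_iff one_ereal_def zero_ereal_def)
qed

lemma v_top: "v x = \<infinity> \<Longrightarrow> x = 0" using v_finite[of x] by auto

section \<open>Additive equations over a complete field\<close>

lemma v_mult_ge: "x \<in> \<O> \<Longrightarrow> C \<le> v y \<Longrightarrow> C \<le> v (x * y)"
  by (simp add: O_iff v_mult add_increasing)

lemma char_power_Suc_Suc: "d > 0 \<Longrightarrow> \<exists>m. CHAR('l) ^ d = Suc (Suc m)"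
proof -
  assume "d > 0"
  then have "1 < CHAR('l) ^ d" by (rule one_less_power[OF char_gt_1])
  then show ?thesis by (intro exI[of _ "CHAR('l) ^ d - 2"]) linarith
qed

text \<open>
The difference \<open>w\<close> of two solutions satisfies \<open>u w = f w\<^bsup>p^d\<^esup>\<close>. If \<open>w \<noteq> 0\<close>, division by \<open>w\<close>
exhibits the unit \<open>u\<close> as a multiple of a positive power of \<open>w\<close>.
\<close>

lemma artin_schreier_unique:
  assumes u: "v u = 0" and f: "f \<in> \<O>" and d: "d > 0"
    and z: "z - z' \<in> \<M>"
    and eq: "u * z - f * z ^ (CHAR('l) ^ d) = u * z' - f * z' ^ (CHAR('l) ^ d)"
  shows "z = z'"
proof (rule ccontr)
  define w where "w = z - z'"
  assume "z \<noteq> z'"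
  then have w0: "w \<noteq> 0" by (simp add: w_def)
  let ?q = "CHAR('l) ^ d"
  have pow: "w ^ ?q + z' ^ ?q = z ^ ?q" using power_char_add[of w z' d] by (simp add: w_def)
  have "u * w = (u * z - f * z ^ ?q) - (u * z' - f * z' ^ ?q) + f * (z ^ ?q - z' ^ ?q)"
    by (simp add: w_def algebra_simps)
  also have "\<dots> = f * w ^ ?q" unfolding eq by (simp add: algebra_simps flip: pow)
  also obtain m where q: "?q = Suc (Suc m)" using char_power_Suc_Suc[OF d] by blast
  have "f * w ^ ?q = (f * w ^ Suc m) * w" unfolding q by simp
  finally have "u = f * w ^ Suc m" using w0 by simp
  also have "\<dots> \<in> \<M>" using z f by (intro M_mult_left M_power) (simp_all add: w_def)
  finally show False using u by (simp add: unit_iff)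
qed

text \<open>
The map \<open>z \<mapsto> (f z\<^bsup>p^d\<^esup> + c) / u\<close> contracts the maximal ideal: it is additive up to the
constant \<open>c / u\<close> and \<open>v (w\<^bsup>p^d\<^esup>) \<ge> 2 v w \<ge> v w + 1\<close>. Hence its iterates from \<open>0\<close> converge.
\<close>

lemma artin_schreier_exists:
  assumes u: "u \<in> K" "v u = 0" and f: "f \<in> \<O>K" and c: "c \<in> \<M>K" and d: "d > 0"
  shows "\<exists>z\<in>\<M>K. u * z = f * z ^ (CHAR('l) ^ d) + c"
proof -
  let ?q = "CHAR('l) ^ d"
  have q: "?q > 1" by (rule one_less_power[OF char_gt_1 d])
  obtain m where m: "?q = Suc (Suc m)" using char_power_Suc_Suc[OF d] by blast
  have u0: "u \<noteq> 0" using u by auto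
  have iu: "inverse u \<in> K" "inverse u \<in> \<O>"
    using u K_inverse unit_inverse[of u] by (auto simp: unit_iff)
  define z where "z = rec_nat 0 (\<lambda>n y. inverse u * (f * y ^ ?q + c))"
  have z_0: "z 0 = 0" and z_Suc: "z (Suc n) = inverse u * (f * z n ^ ?q + c)" for n
    by (simp_all add: z_def)
  have zM: "z n \<in> \<M>K" for n
  proof (induction n)
    case (Suc n)
    then show ?case
      using f c iu q unfolding z_Suc MK_iff OK_iff
      by (auto intro!: K_mult K_add K_power M_mult_left M_add M_power char_pos)
  qed (simp add: z_0 MK_iff)
  (* each iteration gains at least 1, because nonzero valuations on the maximal ideal of K are \<ge> 1 *)
  have step: "v (z (Suc n) - z n) \<ge> ereal (real (Suc n))" for n
  proof (induction n)
    case 0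
    then show ?case
      using v_MK[OF zM[of "Suc 0"]] by (simp only: z_0 one_ereal_def diff_zero of_nat_Suc of_nat_0 add_0 add_0_right)
  next
    case (Suc n)
    define w where "w = z (Suc n) - z n"
    have wM: "w \<in> \<M>K" using zM by (auto simp: w_def MK_iff K_diff M_diff)
    have sum: "w ^ ?q + z n ^ ?q = z (Suc n) ^ ?q"
      using power_char_add[of w "z n" d] by (simp add: w_def)
    have "z (Suc n) ^ ?q - z n ^ ?q = w ^ ?q"
      by (simp only: add_diff_cancel_right' flip: sum)
    also have "w ^ ?q = w ^ m * (w * w)" by (simp add: m)
    finally have pow: "z (Suc n) ^ ?q - z n ^ ?q = w ^ m * (w * w)" .
    have "z (Suc (Suc n)) - z (Suc n) = inverse u * f * (z (Suc n) ^ ?q - z n ^ ?q)"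
      by (simp only: z_Suc algebra_simps)
    then have eq: "z (Suc (Suc n)) - z (Suc n) = (inverse u * f * w ^ m) * (w * w)"
      by (simp only: pow mult.assoc)
    have "ereal (real (Suc (Suc n))) = 1 + ereal (real (Suc n))" by (simp add: one_ereal_def)
    also have "\<dots> \<le> v w + v w"
      using Suc v_MK[OF wM] by (intro add_mono) (simp_all add: w_def)
    also have "\<dots> = v (w * w)" by (simp add: v_mult)
    also have "\<dots> \<le> v ((inverse u * f * w ^ m) * (w * w))"
      using iu f wM by (intro v_mult_ge[OF _ order_refl] O_mult O_power) (auto simp: OK_iff MK_iff M_imp_O)
    finally show ?case by (simp add: eq)
  qed
  have diff: "v (z (n + k) - z n) \<ge> ereal (real n)" for n k
  proof (induction k)
    case (Suc k)
    have "ereal (real n) \<le> ereal (real (Suc (n + k)))" by simp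
    also have "\<dots> \<le> v (z (Suc (n + k)) - z (n + k))" by (rule step)
    finally have "ereal (real n) \<le> min (v (z (Suc (n + k)) - z (n + k))) (v (z (n + k) - z n))"
      using Suc by simp
    also have "\<dots> \<le> v (z (n + Suc k) - z n)"
      using v_add[of "z (Suc (n + k)) - z (n + k)" "z (n + k) - z n"] by simp
    finally show ?case .
  qed simp
  have "\<exists>N. \<forall>m\<ge>N. \<forall>n\<ge>N. v (z m - z n) \<ge> ereal C" for C :: real
  proof (intro exI allI impI)
    fix m n assume mn: "nat \<lceil>C\<rceil> \<le> m" "nat \<lceil>C\<rceil> \<le> n"
    let ?N = "nat \<lceil>C\<rceil>"
    have "v (z m - z n) \<ge> min (v (z m - z ?N)) (v (z n - z ?N))"
      using v_diff[of "z m - z ?N" "z n - z ?N"] by simp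
    moreover have "v (z m - z ?N) \<ge> ereal (real ?N)" "v (z n - z ?N) \<ge> ereal (real ?N)"
      using diff[of ?N "m - ?N"] diff[of ?N "n - ?N"] mn by simp_all
    ultimately have "v (z m - z n) \<ge> ereal (real ?N)" by (meson min.boundedI order_trans)
    moreover have "ereal C \<le> ereal (real ?N)" by simp linarith
    ultimately show "ereal C \<le> v (z m - z n)" by (rule order_trans[rotated])
  qed
  moreover have "\<forall>n. z n \<in> K" using zM by (simp add: MK_iff)
  ultimately have "\<exists>l\<in>K. \<forall>C::real. \<exists>N. \<forall>n\<ge>N. v (z n - l) \<ge> ereal C"
    using local_field unfolding local_field_def complete_wrt_def by simp
  then obtain l where l: "l \<in> K"
    and lim: "\<And>C::real. \<exists>N. \<forall>n\<ge>N. v (z n - l) \<ge> ereal C"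
    by blast
  have lM: "l \<in> \<M>"
  proof -
    obtain n where "v (z n - l) \<ge> ereal 1" using lim[of 1] by blast
    moreover have "0 < ereal 1" by simp
    ultimately have "z n - l \<in> \<M>" unfolding M_iff by (rule less_le_trans[rotated])
    then have "z n - (z n - l) \<in> \<M>" using zM[of n] M_diff[of "z n" "z n - l"] by (simp add: MK_iff)
    then show ?thesis by simp
  qed
  have "v (u * l - (f * l ^ ?q + c)) = \<infinity>"
  proof (rule ereal_top)
    fix C :: real
    obtain N where N: "\<And>n. n \<ge> N \<Longrightarrow> v (z n - l) \<ge> ereal C" using lim by blast
    let ?w = "z N - l"
    have sum: "?w ^ ?q + l ^ ?q = z N ^ ?q" using power_char_add[of ?w l d] by simp
    have "z N ^ ?q - l ^ ?q = ?w ^ ?q"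
      by (simp only: add_diff_cancel_right' flip: sum)
    also have "?w ^ ?q = ?w ^ Suc m * ?w" by (simp add: m mult.commute)
    finally have pow: "z N ^ ?q - l ^ ?q = ?w ^ Suc m * ?w" .
    have "u * z (Suc N) = f * z N ^ ?q + c"
      using u0 by (simp add: z_Suc)
    then have "u * l - (f * l ^ ?q + c) = f * (z N ^ ?q - l ^ ?q) - u * (z (Suc N) - l)"
      by (simp add: algebra_simps)
    also have "f * (z N ^ ?q - l ^ ?q) = (f * ?w ^ Suc m) * ?w"
      by (simp only: pow mult.assoc)
    finally have "v (u * l - (f * l ^ ?q + c))
        \<ge> min (v ((f * ?w ^ Suc m) * ?w)) (v (u * (z (Suc N) - l)))"
      using v_diff by simp
    moreover have "?w \<in> \<O>" using zM[of N] lM by (intro M_imp_O M_diff) (auto simp: MK_iff)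
    then have "v ((f * ?w ^ Suc m) * ?w) \<ge> ereal C"
      using f N[of N] by (intro v_mult_ge O_mult O_power) (auto simp: OK_iff)
    moreover have "v (u * (z (Suc N) - l)) \<ge> ereal C"
      using u N[of "Suc N"] by (intro v_mult_ge) (auto simp: unit_iff)
    ultimately show "ereal C \<le> v (u * l - (f * l ^ ?q + c))"
      by (meson min.boundedI order_trans)
  qed
  then have "u * l = f * l ^ ?q + c" using v_top by force
  then show ?thesis using l lM by (auto simp: MK_iff)
qed

section \<open>The section of the residue field\<close>

lemma MK_coset_eq_iff: "x \<in> K \<Longrightarrow> y \<in> K \<Longrightarrow> x +o \<M>K = y +o \<M>K \<longleftrightarrow> x - y \<in> \<M>"
  by (subst coset_eq_iff) (auto simp: MK_iff K_diff M_diff)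

text \<open>
Two powers of Frobenius agree on the class of \<open>x\<close> by the pigeonhole principle, and
Frobenius is injective on the residue field, so the smaller one can be cancelled.
\<close>

lemma residue_frobenius_orbit:
  assumes x: "x \<in> \<O>K"
  shows "\<exists>k\<in>{1..card (quot \<O>K \<M>K)}. x ^ (CHAR('l) ^ k) - x \<in> \<M>"
proof -
  let ?Q = "quot \<O>K \<M>K" and ?f = "\<lambda>n. x ^ (CHAR('l) ^ n) +o \<M>K"
  have fin: "finite ?Q" using local_field by (simp add: local_field_def)
  have "\<not> inj_on ?f {0..card ?Q}"
  proof
    assume "inj_on ?f {0..card ?Q}"
    moreover have "?f ` {0..card ?Q} \<subseteq> ?Q"
      using x by (auto simp: quot_def OK_iff K_power O_power)
    ultimately have "card {0..card ?Q} \<le> card ?Q" using fin by (rule card_inj_on_le)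
    then show False by simp
  qed
  then obtain i j where ij: "i < j" "j \<le> card ?Q" and eq: "?f i = ?f j"
    unfolding inj_on_def by (metis atLeastAtMost_iff linorder_neqE_nat)
  have "x ^ (CHAR('l) ^ j) - x ^ (CHAR('l) ^ i) \<in> \<M>"
    using eq x MK_coset_eq_iff[of "x ^ (CHAR('l) ^ j)" "x ^ (CHAR('l) ^ i)"]
    by (simp add: OK_iff K_power)
  also have "x ^ (CHAR('l) ^ j) - x ^ (CHAR('l) ^ i) = (x ^ (CHAR('l) ^ (j - i)) - x) ^ (CHAR('l) ^ i)"
    using ij by (simp add: power_char_diff flip: power_mult power_add)
  finally have "x ^ (CHAR('l) ^ (j - i)) - x \<in> \<M>"
    by (rule M_of_power) (simp add: char_pos)
  then show ?thesis using ij by (intro bexI[of _ "j - i"]) auto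
qed

text \<open>
The factorial is a common multiple of the periods of all classes.
\<close>

lemma residue_frobenius_period:
  "\<exists>e>0. \<forall>x\<in>\<O>K. x ^ (CHAR('l) ^ e) - x \<in> \<M>"
proof (intro exI conjI ballI)
  let ?c = "card (quot \<O>K \<M>K)"
  show "fact ?c > (0 :: nat)" by simp
  fix x assume x: "x \<in> \<O>K"
  then obtain k where k: "k \<in> {1..?c}" "x ^ (CHAR('l) ^ k) - x \<in> \<M>"
    using residue_frobenius_orbit by blast
  have iter: "x ^ (CHAR('l) ^ (k * m)) - x \<in> \<M>" for m
  proof (induction m)
    case (Suc m)
    have "(x ^ (CHAR('l) ^ k) - x) ^ (CHAR('l) ^ (k * m)) \<in> \<M>"
      using k by (intro M_power) (simp_all add: char_pos)
    then have "x ^ (CHAR('l) ^ (k * Suc m)) - x ^ (CHAR('l) ^ (k * m)) \<in> \<M>"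
      by (simp add: power_char_diff power_add flip: power_mult)
    then show ?case using Suc by (rule M_diff_trans)
  qed simp
  have "k dvd fact ?c" using k by (intro dvd_fact) auto
  then show "x ^ (CHAR('l) ^ fact ?c) - x \<in> \<M>" using iter by auto
qed

text \<open>
Any common period will do; it is a multiple of the degree of the residue field over the
prime field.
\<close>

definition frobenius_period :: nat where
  "frobenius_period = (SOME e. e > 0 \<and> (\<forall>x\<in>\<O>K. x ^ (CHAR('l) ^ e) - x \<in> \<M>))"

lemma frobenius_period: "frobenius_period > 0" "x \<in> \<O>K \<Longrightarrow> x ^ (CHAR('l) ^ frobenius_period) - x \<in> \<M>"
  using someI_ex[OF residue_frobenius_period] unfolding frobenius_period_def by blast+

lemma frobenius_fixed_unique:
  assumes "y ^ (CHAR('l) ^ frobenius_period) = y" "z ^ (CHAR('l) ^ frobenius_period) = z" "y - z \<in> \<M>"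
  shows "y = z"
  using artin_schreier_unique[of 1 1 frobenius_period y z] assms frobenius_period(1) by simp

lemma frobenius_fixed_exists:
  assumes x: "x \<in> \<O>K"
  shows "\<exists>y\<in>\<O>K. y - x \<in> \<M> \<and> y ^ (CHAR('l) ^ frobenius_period) = y"
proof -
  have "x ^ (CHAR('l) ^ frobenius_period) - x \<in> \<M>K"
    using x frobenius_period(2)[OF x] by (auto simp: MK_iff OK_iff K_diff K_power)
  then obtain z where z: "z \<in> \<M>K" "1 * z = 1 * z ^ (CHAR('l) ^ frobenius_period) + (x ^ (CHAR('l) ^ frobenius_period) - x)"
    using artin_schreier_exists[of 1 1, OF _ _ _ _ frobenius_period(1)] by (auto simp: OK_iff)
  have "x + z = x + (z ^ (CHAR('l) ^ frobenius_period) + (x ^ (CHAR('l) ^ frobenius_period) - x))"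
    using z(2) by simp
  also have "\<dots> = (x + z) ^ (CHAR('l) ^ frobenius_period)"
    by (simp add: power_char_add)
  finally have "(x + z) ^ (CHAR('l) ^ frobenius_period) = x + z" by (rule sym)
  then show ?thesis
    using x z by (intro bexI[of _ "x + z"]) (auto simp: OK_iff MK_iff K_add O_add M_imp_O)
qed

text \<open>
The Teichmueller representative of the class of \<open>x\<close>. Being the only Frobenius-periodic
element of that class, it is automatically additive and multiplicative in \<open>x\<close>.
\<close>

definition teich :: "'l \<Rightarrow> 'l" where
  "teich x = (THE y. y \<in> \<O>K \<and> y - x \<in> \<M> \<and> y ^ (CHAR('l) ^ frobenius_period) = y)"

lemma teich:
  assumes "x \<in> \<O>K"
  shows "teich x \<in> \<O>K" "teich x - x \<in> \<M>" "teich x ^ (CHAR('l) ^ frobenius_period) = teich x"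
proof -
  have "\<exists>!y. y \<in> \<O>K \<and> y - x \<in> \<M> \<and> y ^ (CHAR('l) ^ frobenius_period) = y"
    using frobenius_fixed_exists[OF assms] frobenius_fixed_unique M_diff_trans M_diff_commute
    by meson
  from theI'[OF this]
  show "teich x \<in> \<O>K" "teich x - x \<in> \<M>" "teich x ^ (CHAR('l) ^ frobenius_period) = teich x"
    unfolding teich_def by blast+
qed

lemma teich_eqI:
  assumes "x \<in> \<O>K" "y - x \<in> \<M>" "y ^ (CHAR('l) ^ frobenius_period) = y"
  shows "teich x = y"
  using teich[OF assms(1)] assms by (meson M_diff_commute M_diff_trans frobenius_fixed_unique)

lemma OK_add: "x \<in> \<O>K \<Longrightarrow> y \<in> \<O>K \<Longrightarrow> x + y \<in> \<O>K"
  and OK_mult: "x \<in> \<O>K \<Longrightarrow> y \<in> \<O>K \<Longrightarrow> x * y \<in> \<O>K"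
  and OK_power: "x \<in> \<O>K \<Longrightarrow> x ^ n \<in> \<O>K"
  and OK_0 [simp]: "0 \<in> \<O>K" and OK_1 [simp]: "1 \<in> \<O>K"
  by (simp_all add: OK_iff K_add O_add K_mult O_mult K_power O_power)

lemma OK_sum: "(\<And>s. s \<in> S \<Longrightarrow> f s \<in> \<O>K) \<Longrightarrow> (\<Sum>s\<in>S. f s) \<in> \<O>K"
  by (simp add: OK_iff K_sum O_sum)

lemma teich_cong: "x \<in> \<O>K \<Longrightarrow> y \<in> \<O>K \<Longrightarrow> x - y \<in> \<M> \<Longrightarrow> teich x = teich y"
  by (rule teich_eqI) (use teich[of y] in \<open>auto intro: M_diff_trans simp: M_diff_commute\<close>)

lemma teich_add: "x \<in> \<O>K \<Longrightarrow> y \<in> \<O>K \<Longrightarrow> teich (x + y) = teich x + teich y"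
  using M_add[OF teich(2)[of x] teich(2)[of y]]
  by (intro teich_eqI) (simp_all add: OK_add power_char_add teich algebra_simps)

lemma teich_mult: "x \<in> \<O>K \<Longrightarrow> y \<in> \<O>K \<Longrightarrow> teich (x * y) = teich x * teich y"
  using teich[of x] teich[of y]
  by (intro teich_eqI M_diff_mult OK_mult) (auto simp: power_mult_distrib OK_iff)

lemma teich_0 [simp]: "teich 0 = 0" and teich_1 [simp]: "teich 1 = 1"
  by (rule teich_eqI; simp add: char_pos)+

lemma teich_power: "x \<in> \<O>K \<Longrightarrow> teich (x ^ n) = teich x ^ n"
  by (induction n) (simp_all add: teich_mult OK_power)

lemma teich_sum: "(\<And>s. s \<in> S \<Longrightarrow> f s \<in> \<O>K) \<Longrightarrow> teich (\<Sum>s\<in>S. f s) = (\<Sum>s\<in>S. teich (f s))"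
  by (induction S rule: infinite_finite_induct) (simp_all add: teich_add OK_sum)

lemma teich_unit: "x \<in> K \<Longrightarrow> v x = 0 \<Longrightarrow> v (teich x) = 0"
  using teich[of x] M_diff[of "teich x" "teich x - x"] by (auto simp: unit_iff OK_iff)

text \<open>
On the residue field, a negative power of Frobenius is also a positive one. This keeps the
coefficients of \<open>x \<phi>\<^sub>a\<close> in \<open>K\<close>, although \<open>K\<close> is not perfect.
\<close>

lemma frob_pow_teich: "x \<in> \<O>K \<Longrightarrow> frob_pow j (teich x) \<in> \<O>K"
proof -
  assume x: "x \<in> \<O>K"
  let ?y = "teich x"
  have per: "frob_pow (int (k * frobenius_period)) ?y = ?y" for k
  proof (induction k)
    case (Suc k)
    have "frob_pow (int (Suc k * frobenius_period)) ?y
        = frob_pow (int (k * frobenius_period)) (frob_pow (int frobenius_period) ?y)"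
      by (simp add: frob_pow_frob_pow algebra_simps)
    also have "frob_pow (int frobenius_period) ?y = ?y"
      using teich(3)[OF x] by (simp only: frob_pow_nat)
    finally show ?case using Suc by simp
  qed simp
  let ?N = "int (nat \<bar>j\<bar> * frobenius_period)"
  have "\<bar>j\<bar> * 1 \<le> \<bar>j\<bar> * int frobenius_period"
    using frobenius_period(1) by (intro mult_left_mono) auto
  then have "j + ?N \<ge> 0" by simp
  then obtain n where n: "j + ?N = int n" by (metis nonneg_int_cases)
  have "frob_pow j ?y = frob_pow j (frob_pow ?N ?y)" by (simp only: per[of "nat \<bar>j\<bar>"])
  also have "\<dots> = ?y ^ (CHAR('l) ^ n)" unfolding frob_pow_frob_pow n by (rule frob_pow_nat)
  finally show ?thesis using teich(1)[OF x] by (simp add: OK_power)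
qed

text \<open>
A multiplicative section preserves the identity \<open>x\<^bsup>p^e\<^esup> = x\<close>, which holds in the residue field
for the Frobenius period \<open>e\<close>.
\<close>

lemma is_residue_section_unique:
  assumes s: "is_residue_section K v s" and x: "x \<in> \<O>K"
  shows "s (x +o \<M>K) = teich x"
proof -
  have c: "y +o \<M>K \<in> quot \<O>K \<M>K" if "y \<in> \<O>K" for y using that by (auto simp: quot_def)
  have pow: "s (x ^ n +o \<M>K) = s (x +o \<M>K) ^ n" for n
  proof (induction n)
    case (Suc n)
    then show ?case using s x OK_power[OF x, of n] unfolding is_residue_section_def by simp
  qed (use s in \<open>simp add: is_residue_section_def\<close>)
  have "s (x +o \<M>K) \<in> x +o \<M>K"
    using s c[OF x] unfolding is_residue_section_def by blast
  then have "s (x +o \<M>K) - x \<in> \<M>" using set_plus_imp_minus MK_iff by blast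
  moreover have "x ^ (CHAR('l) ^ frobenius_period) +o \<M>K = x +o \<M>K"
    using x frobenius_period(2)[OF x] by (subst MK_coset_eq_iff) (auto simp: OK_iff K_power)
  then have "s (x +o \<M>K) ^ (CHAR('l) ^ frobenius_period) = s (x +o \<M>K)"
    by (simp flip: pow)
  ultimately show ?thesis using teich_eqI[OF x] by simp
qed

lemma is_residue_section_exists: "\<exists>s. is_residue_section K v s"
proof
  define s where "s = (\<lambda>c\<in>quot \<O>K \<M>K. teich (SOME x. x \<in> \<O>K \<and> c = x +o \<M>K))"
  have s_eq: "s (x +o \<M>K) = teich x" if x: "x \<in> \<O>K" for x
  proof -
    have c: "x +o \<M>K \<in> quot \<O>K \<M>K" using x by (auto simp: quot_def)
    let ?y = "SOME y. y \<in> \<O>K \<and> x +o \<M>K = y +o \<M>K"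
    have y: "?y \<in> \<O>K \<and> x +o \<M>K = ?y +o \<M>K" by (rule someI[of _ x]) (simp add: x)
    then have "x - ?y \<in> \<M>" using x MK_coset_eq_iff[of x ?y] by (simp add: OK_iff)
    then have "teich x = teich ?y" using x y by (intro teich_cong) auto
    then show ?thesis using c by (simp add: s_def)
  qed
  have "s \<in> quot \<O>K \<M>K \<rightarrow>\<^sub>E \<O>K"
  proof
    fix c assume "c \<in> quot \<O>K \<M>K"
    then show "s c \<in> \<O>K" by (auto simp: quot_def s_eq teich)
  qed (simp add: s_def)
  moreover have "s c \<in> c" if "c \<in> quot \<O>K \<M>K" for c
  proof -
    from that obtain x where x: "x \<in> \<O>K" "c = x +o \<M>K" by (auto simp: quot_def)
    then have "teich x - x \<in> \<M>K" using teich[of x] by (auto simp: MK_iff OK_iff K_diff)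
    then show ?thesis using x by (simp add: s_eq set_minus_imp_plus)
  qed
  ultimately show "is_residue_section K v s"
    unfolding is_residue_section_def by (simp add: s_eq teich_add teich_mult OK_add OK_mult)
qed

lemma residue_section_coset: "x \<in> \<O>K \<Longrightarrow> residue_section K v (x +o \<M>K) = teich x"
proof -
  have "s = t" if s: "is_residue_section K v s" and t: "is_residue_section K v t" for s t
  proof (rule PiE_ext)
    show "s \<in> quot \<O>K \<M>K \<rightarrow>\<^sub>E \<O>K" "t \<in> quot \<O>K \<M>K \<rightarrow>\<^sub>E \<O>K"
      using s t by (simp_all add: is_residue_section_def)
    show "s c = t c" if "c \<in> quot \<O>K \<M>K" for c
      using that is_residue_section_unique[OF s] is_residue_section_unique[OF t]
      by (auto simp: quot_def)
  qed
  then have "is_residue_section K v (residue_section K v)"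
    unfolding residue_section_def using is_residue_section_exists by (metis theI)
  then show "x \<in> \<O>K \<Longrightarrow> residue_section K v (x +o \<M>K) = teich x"
    by (rule is_residue_section_unique)
qed

section \<open>Series that intertwine two twisted polynomials\<close>

text \<open>
Comparison of the leading coefficients of \<open>f y\<close> and \<open>y g\<close> gives an equation \<open>u w = f\<^sub>d w\<^bsup>p^d\<^esup>\<close>
for the leading coefficient \<open>w\<close> of \<open>y\<close>, which has no nonzero solution in the maximal ideal.
\<close>

lemma skew_intertwiner_eq_0:
  assumes d: "degree f = d" "degree g = d" "d > 0"
    and lead: "v (coeff f d) = 0" "v (coeff g d) = 0"
    and y: "tau_degree_le y b" "\<And>n. y n \<in> \<M>"
    and eq: "skew_mult (series_of_poly f) y = skew_mult y (series_of_poly g)"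
  shows "y n = 0"
proof (rule ccontr)
  assume "y n \<noteq> 0"
  then have "n \<le> b" using y(1) by (force simp: tau_degree_le_def)
  then have ex: "\<exists>k. y (b - int k) \<noteq> 0" using \<open>y n \<noteq> 0\<close> by (intro exI[of _ "nat (b - n)"]) simp
  define m where "m = b - int (LEAST k. y (b - int k) \<noteq> 0)"
  have m: "y m \<noteq> 0" unfolding m_def using ex by (rule LeastI_ex)
  have top: "y i = 0" if "i > m" for i
  proof (cases "i > b")
    case False
    then have "i = b - int (nat (b - i))" by simp
    moreover have "nat (b - i) < (LEAST k. y (b - int k) \<noteq> 0)" using that False by (simp add: m_def)
    ultimately show ?thesis using not_less_Least by metis
  qed (use y(1) in \<open>simp add: tau_degree_le_def\<close>)
  have "skew_mult (series_of_poly f) y (m + int d) = (\<Sum>i\<le>d. coeff f i * (y (m + int d - int i)) ^ (CHAR('l) ^ i))"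
    using d by (simp add: skew_mult_poly_left)
  also have "\<dots> = (\<Sum>i\<in>{d}. coeff f i * (y (m + int d - int i)) ^ (CHAR('l) ^ i))"
    using char_pos by (intro sum.mono_neutral_right) (auto intro!: top)
  finally have 1: "skew_mult (series_of_poly f) y (m + int d) = coeff f d * y m ^ (CHAR('l) ^ d)" by simp
  have "skew_mult y (series_of_poly g) (m + int d)
      = (\<Sum>i\<le>d. y (m + int d - int i) * frob_pow (m + int d - int i) (coeff g i))"
    using d by (simp add: skew_mult_poly_right)
  also have "\<dots> = (\<Sum>i\<in>{d}. y (m + int d - int i) * frob_pow (m + int d - int i) (coeff g i))"
    by (intro sum.mono_neutral_right) (auto intro!: top)
  finally have 2: "skew_mult y (series_of_poly g) (m + int d) = frob_pow m (coeff g d) * y m"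
    by (simp add: mult.commute)
  have "y m = 0"
    using artin_schreier_unique[of "frob_pow m (coeff g d)" "coeff f d" d "y m" 0]
      lead frob_pow_unit[of "coeff g d" m] d y(2)[of m] 1 2 eq by (simp add: unit_iff char_pos)
  with m show False by simp
qed

text \<open>
The normalization that singles out the series behind \<open>\<chi>\<close> among all solutions of
\<open>\<psi>\<^sub>a x = x \<phi>\<^sub>a\<close>: it is congruent to \<open>1\<close> modulo the maximal ideal.
\<close>

definition principal_series :: "(int \<Rightarrow> 'l) \<Rightarrow> bool" where
  "principal_series x \<longleftrightarrow> (\<forall>j>0. x j = 0) \<and> (\<forall>j\<le>0. x j \<in> \<O>K) \<and>
     x 0 - 1 \<in> \<M>K \<and> (\<forall>j<0. x j \<in> \<M>K)"

text \<open>
A single term of the coefficients of \<open>f x - x g\<close>: modulo the maximal ideal \<open>f\<close> and \<open>g\<close>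
coincide and \<open>x\<close> is \<open>1\<close>.
\<close>

lemma intertwining_defect_in_M:
  assumes j: "j \<le> 0" and w: "w \<in> \<O>" "j = 0 \<Longrightarrow> w - 1 \<in> \<M>" "j < 0 \<Longrightarrow> w \<in> \<M>"
    and f: "f \<in> \<O>" and g: "g \<in> \<O>" "f - g \<in> \<M>"
  shows "f * w ^ (CHAR('l) ^ i) - w * frob_pow j g \<in> \<M>"
proof (cases "j = 0")
  case True
  have "w ^ (CHAR('l) ^ i) - 1 = (w - 1) ^ (CHAR('l) ^ i)" by (simp add: power_char_diff)
  also have "\<dots> \<in> \<M>" using w(2)[OF True] by (intro M_power) (simp_all add: char_pos)
  finally have "f * w ^ (CHAR('l) ^ i) - f * 1 \<in> \<M>"
    using f w(1) by (intro M_diff_mult) (auto intro: O_power)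
  moreover have "w * g - 1 * f \<in> \<M>"
    using w(2)[OF True] g f by (intro M_diff_mult) (simp_all add: M_diff_commute)
  then have "f * 1 - w * g \<in> \<M>" by (simp add: M_diff_commute)
  ultimately show ?thesis using True M_diff_trans by auto
next
  case False
  then have "w \<in> \<M>" using j w by simp
  then show ?thesis
    using f frob_pow_O[OF g(1)]
    by (intro M_diff M_mult_left[OF f] M_mult_right M_power) (simp_all add: char_pos)
qed

text \<open>
In degree \<open>d - n\<close> the equation \<open>f x = x g\<close> involves no coefficient of \<open>x\<close> of index below \<open>- n\<close>.
Once those of higher index are known, it is an equation of the type \<open>u z = f z\<^bsup>p^d\<^esup> + c\<close> for the
coefficient of index \<open>- n\<close>, so the coefficients can be found recursively.
\<close>

lemma principal_intertwiner_exists: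
  assumes d: "degree f = d" "degree g = d" "d > 0"
    and lead: "v (coeff f d) = 0" "v (coeff g d) = 0"
    and f: "\<And>i. coeff f i \<in> \<O>K"
    and g: "\<And>i j. frob_pow j (coeff g i) \<in> \<O>K"
    and fg: "\<And>i. coeff f i - coeff g i \<in> \<M>"
  shows "\<exists>x. principal_series x \<and> skew_mult (series_of_poly f) x = skew_mult x (series_of_poly g)"
proof -
  let ?q = "CHAR('l)"
  (* X n stands for the coefficient of index - n, and l = d - i for the term of degree i in f or g;
     c X n collects the terms with coefficients found earlier *)
  define c where "c = (\<lambda>X n. \<Sum>l=1..min d n.
     coeff f (d - l) * X (n - l) ^ (?q ^ (d - l)) - X (n - l) * frob_pow (- int (n - l)) (coeff g (d - l)))"
  define P where "P = (\<lambda>X n r. r \<in> \<O>K \<and> r - (if n = 0 then 1 else 0) \<in> \<M> \<and>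
     frob_pow (- int n) (coeff g d) * r = coeff f d * r ^ (?q ^ d) + c X n)"
  have g': "coeff g i \<in> \<O>K" for i using g[of 0 i] by simp
  have "\<exists>X. \<forall>n. P X n (X n)"
  proof (rule dependent_wf_choice[OF wf_less])
    fix X Y :: "nat \<Rightarrow> 'l" and n r
    assume "\<And>m. (m, n) \<in> {(x, y). x < y} \<Longrightarrow> X m = Y m"
    then have "c X n = c Y n" unfolding c_def by (intro sum.cong) auto
    then show "P X n r = P Y n r" by (simp add: P_def)
  next
    fix n and X :: "nat \<Rightarrow> 'l"
    assume "\<And>m. (m, n) \<in> {(x, y). x < y} \<Longrightarrow> P X m (X m)"
    then have IH: "P X m (X m)" if "m < n" for m using that by auto
    have cK: "c X n \<in> K"
      unfolding c_def using IH f g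
      by (intro K_sum K_diff K_mult K_power) (auto simp: P_def OK_iff)
    have cM: "c X n \<in> \<M>"
      unfolding c_def
    proof (rule M_sum)
      fix l assume l: "l \<in> {1..min d n}"
      then have "P X (n - l) (X (n - l))" by (intro IH) auto
      then show "coeff f (d - l) * X (n - l) ^ (?q ^ (d - l))
          - X (n - l) * frob_pow (- int (n - l)) (coeff g (d - l)) \<in> \<M>"
        using f g' fg by (intro intertwining_defect_in_M) (auto simp: P_def OK_iff)
    qed
    let ?u = "frob_pow (- int n) (coeff g d)"
    have u: "?u \<in> K" "v ?u = 0" using g frob_pow_unit lead by (auto simp: OK_iff)
    show "\<exists>r. P X n r"
    proof (cases "n = 0")
      case True
      (* the first coefficient is 1 + z, and 1 solves the equation modulo the maximal ideal *)
      have "coeff f d - coeff g d \<in> \<M>K" using fg f g' by (auto simp: MK_iff OK_iff K_diff)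
      then obtain z where z: "z \<in> \<M>K" "?u * z = coeff f d * z ^ (?q ^ d) + (coeff f d - coeff g d)"
        using artin_schreier_exists[OF u f _ d(3)] by blast
      then have "?u * (1 + z) = coeff f d * (1 + z) ^ (?q ^ d) + c X n"
        by (simp add: True c_def power_char_add algebra_simps)
      then have "P X n (1 + z)"
        using z(1) True by (auto simp: P_def OK_iff MK_iff K_add O_add M_imp_O)
      then show ?thesis by blast
    next
      case False
      have "c X n \<in> \<M>K" using cK cM by (simp add: MK_iff)
      then obtain z where "z \<in> \<M>K" "?u * z = coeff f d * z ^ (?q ^ d) + c X n"
        using artin_schreier_exists[OF u f _ d(3)] by blast
      then have "P X n z" using False by (auto simp: P_def OK_iff MK_iff M_imp_O)
      then show ?thesis by blast
    qed
  qed
  then obtain X where X: "\<And>n. P X n (X n)" by blast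
  define x where "x j = (if j \<le> 0 then X (nat (- j)) else 0)" for j :: int
  have "principal_series x"
    unfolding principal_series_def
  proof (intro conjI allI impI)
    show "x 0 - 1 \<in> \<M>K" using X[of 0] by (auto simp: x_def P_def MK_iff OK_iff K_diff)
    show "x j \<in> \<M>K" if "j < 0" for j
      using that X[of "nat (- j)"] by (auto simp: x_def P_def MK_iff OK_iff)
  qed (use X in \<open>auto simp: x_def P_def\<close>)
  moreover have "skew_mult (series_of_poly f) x = skew_mult x (series_of_poly g)"
  proof
    fix m
    let ?t = "\<lambda>i. coeff f i * x (m - int i) ^ (?q ^ i) - x (m - int i) * frob_pow (m - int i) (coeff g i)"
    have "skew_mult (series_of_poly f) x m - skew_mult x (series_of_poly g) m = (\<Sum>i\<le>d. ?t i)"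
      using d by (simp add: skew_mult_poly_left[of _ d] skew_mult_poly_right[of _ d] sum_subtractf)
    also have "\<dots> = 0"
    proof (cases "m > int d")
      case True
      then show ?thesis by (intro sum.neutral) (auto simp: x_def char_pos)
    next
      case False
      define n where "n = nat (int d - m)"
      have m: "m = int d - int n" using False by (simp add: n_def)
      have x_eq: "x (m - int (d - l)) = (if l \<le> n then X (n - l) else 0)" if "l \<le> d" for l
        using that by (auto simp: x_def m intro!: arg_cong[where f = X])
      define T where "T l = (if l \<le> n then coeff f (d - l) * X (n - l) ^ (?q ^ (d - l))
          - X (n - l) * frob_pow (- int (n - l)) (coeff g (d - l)) else 0)" for l
      have t_eq: "?t (d - l) = T l" if "l \<le> d" for l
      proof -
        have "m - int (d - l) = - int (n - l)" if "l \<le> n" using that \<open>l \<le> d\<close> by (simp add: m)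
        then show ?thesis using x_eq[OF that] by (auto simp: T_def char_pos)
      qed
      have "(\<Sum>i\<le>d. ?t i) = (\<Sum>l\<le>d. ?t (d - l))"
        by (rule sum.reindex_bij_witness[of _ "\<lambda>l. d - l" "\<lambda>l. d - l"]) auto
      also have "\<dots> = (\<Sum>l\<le>d. T l)"
        by (rule sum.cong[OF refl], rule t_eq) simp
      also have "\<dots> = T 0 + (\<Sum>l=1..d. T l)"
        by (simp add: atMost_atLeast0 sum.atLeast_Suc_atMost)
      also have "(\<Sum>l=1..d. T l) = c X n"
        unfolding c_def by (rule sum.mono_neutral_cong_right) (auto simp: T_def)
      also have "T 0 = coeff f d * X n ^ (?q ^ d) - X n * frob_pow (- int n) (coeff g d)"
        by (simp add: T_def)
      also have "\<dots> + c X n = 0" using X[of n] by (simp add: P_def mult.commute)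
      finally show ?thesis .
    qed
    finally show "skew_mult (series_of_poly f) x m = skew_mult x (series_of_poly g) m" by simp
  qed
  ultimately show ?thesis by blast
qed

end

section \<open>Modules of good reduction and their reduction\<close>

text \<open>
The properties of a Drinfeld module of good reduction apart from the rank. They pass to
the reduction, so that the results below apply to \<open>\<psi>\<close> and to \<open>\<phi>\<close> alike.
\<close>

locale good_reduction_module = char_p_local_field p K v
  for p and K :: "'l::alg_closed_field set" and v +
  fixes A :: "'f::field set" and \<psi> :: "'f \<Rightarrow> 'l poly"
  assumes A_subring: "is_subring A"
    and coeffs_OK: "a \<in> A \<Longrightarrow> coeff (\<psi> a) i \<in> \<O>K"
    and psi_1: "\<psi> 1 = 1"
    and psi_add: "a \<in> A \<Longrightarrow> b \<in> A \<Longrightarrow> \<psi> (a + b) = \<psi> a + \<psi> b"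
    and psi_mult: "a \<in> A \<Longrightarrow> b \<in> A \<Longrightarrow>
      series_of_poly (\<psi> (a * b)) = skew_mult (series_of_poly (\<psi> a)) (series_of_poly (\<psi> b))"
    and lead_unit: "a \<in> A \<Longrightarrow> a \<noteq> 0 \<Longrightarrow> v (lead_coeff (\<psi> a)) = 0"
begin

lemma A_1: "1 \<in> A" and A_diff: "a \<in> A \<Longrightarrow> b \<in> A \<Longrightarrow> a - b \<in> A"
  and A_mult: "a \<in> A \<Longrightarrow> b \<in> A \<Longrightarrow> a * b \<in> A"
  using A_subring by (simp_all add: is_subring_def)

lemma A_0: "0 \<in> A" using A_diff[OF A_1 A_1] by simp

lemma A_uminus: "a \<in> A \<Longrightarrow> - a \<in> A" using A_diff[OF A_0] by simp

lemma A_add: "a \<in> A \<Longrightarrow> b \<in> A \<Longrightarrow> a + b \<in> A" using A_diff[of a "- b"] A_uminus by simp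

lemma psi_diff: "a \<in> A \<Longrightarrow> b \<in> A \<Longrightarrow> \<psi> (a - b) = \<psi> a - \<psi> b"
  using psi_add[of "a - b" b] A_diff by simp

lemma psi_0 [simp]: "\<psi> 0 = 0" using psi_diff[OF A_0 A_0] by simp

lemma psi_eval_mult: "a \<in> A \<Longrightarrow> b \<in> A \<Longrightarrow> tau_eval (\<psi> (a * b)) x = tau_eval (\<psi> a) (tau_eval (\<psi> b) x)"
  by (rule tau_eval_skew_mult) (rule psi_mult)

lemma lead_nonzero: "a \<in> A \<Longrightarrow> a \<noteq> 0 \<Longrightarrow> lead_coeff (\<psi> a) \<noteq> 0"
  using lead_unit[of a] by auto

abbreviation "\<phi> \<equiv> reduction K v \<psi>"

lemma coeff_reduction: "a \<in> A \<Longrightarrow> coeff (\<phi> a) i = teich (coeff (\<psi> a) i)"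
  unfolding reduction_def using residue_section_coset[OF OK_0]
  by (subst coeff_map_poly) (simp_all add: residue_section_coset coeffs_OK)

text \<open>
The highest coefficient is a unit and therefore does not reduce to \<open>0\<close>.
\<close>

lemma degree_reduction: "a \<in> A \<Longrightarrow> degree (\<phi> a) = degree (\<psi> a)"
proof (cases "a = 0")
  assume a: "a \<in> A" "a \<noteq> 0"
  have "coeff (\<phi> a) (degree (\<psi> a)) \<noteq> 0"
    using teich_unit[OF _ lead_unit[OF a]] coeffs_OK[OF a(1)] by (auto simp: coeff_reduction a OK_iff)
  then have "degree (\<psi> a) \<le> degree (\<phi> a)" by (rule le_degree)
  moreover have "degree (\<phi> a) \<le> degree (\<psi> a)"
    by (rule degree_le) (simp add: coeff_reduction a coeff_eq_0)
  ultimately show ?thesis by simp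
qed (simp add: reduction_def)

lemma series_reduction: "a \<in> A \<Longrightarrow> series_of_poly (\<phi> a) n = teich (series_of_poly (\<psi> a) n)"
  by (simp add: series_of_poly_def coeff_reduction)

lemma series_OK: "a \<in> A \<Longrightarrow> series_of_poly (\<psi> a) n \<in> \<O>K"
  by (simp add: series_of_poly_def coeffs_OK)

lemma reduction_good: "good_reduction_module p K v A \<phi>"
proof unfold_locales
  show "coeff (\<phi> a) i \<in> \<O>K" if "a \<in> A" for a i
    using that by (simp add: coeff_reduction teich coeffs_OK)
  show "\<phi> 1 = 1"
    by (rule poly_eqI) (simp add: coeff_reduction A_1 psi_1)
  show "\<phi> (a + b) = \<phi> a + \<phi> b" if "a \<in> A" "b \<in> A" for a b
    using that by (intro poly_eqI) (simp add: coeff_reduction A_add psi_add teich_add coeffs_OK)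
  show "v (lead_coeff (\<phi> a)) = 0" if "a \<in> A" "a \<noteq> 0" for a
    using that teich_unit[OF _ lead_unit[OF that]] coeffs_OK[of a]
    by (simp add: coeff_reduction degree_reduction OK_iff)
  show "series_of_poly (\<phi> (a * b)) = skew_mult (series_of_poly (\<phi> a)) (series_of_poly (\<phi> b))"
    if ab: "a \<in> A" "b \<in> A" for a b
  proof
    fix n
    have "series_of_poly (\<phi> (a * b)) n
        = teich (\<Sum>i\<le>degree (\<psi> a). coeff (\<psi> a) i * series_of_poly (\<psi> b) (n - int i) ^ (CHAR('l) ^ i))"
      using ab by (simp add: series_reduction A_mult psi_mult skew_mult_poly_left[OF order_refl])
    also have "\<dots> = (\<Sum>i\<le>degree (\<psi> a). teich (coeff (\<psi> a) i) * teich (series_of_poly (\<psi> b) (n - int i)) ^ (CHAR('l) ^ i))"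
      using ab coeffs_OK series_OK
      by (simp add: teich_sum teich_mult teich_power OK_mult OK_power)
    also have "\<dots> = skew_mult (series_of_poly (\<phi> a)) (series_of_poly (\<phi> b)) n"
      using ab by (simp add: series_reduction coeff_reduction degree_reduction
          skew_mult_poly_left[of "\<phi> a" "degree (\<psi> a)"])
    finally show "series_of_poly (\<phi> (a * b)) n = skew_mult (series_of_poly (\<phi> a)) (series_of_poly (\<phi> b)) n" .
  qed
qed (rule A_subring)

lemma coeff_diff_reduction: "a \<in> A \<Longrightarrow> coeff (\<psi> a) i - coeff (\<phi> a) i \<in> \<M>"
  using teich(2)[OF coeffs_OK] by (simp add: coeff_reduction M_diff_commute)

lemma frob_pow_coeff_reduction: "a \<in> A \<Longrightarrow> frob_pow j (coeff (\<phi> a) i) \<in> \<O>K"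
  by (simp add: coeff_reduction frob_pow_teich coeffs_OK)

text \<open>
As \<open>a\<close> and \<open>b\<close> commute, the defect \<open>y = \<psi>\<^sub>b x - x \<phi>\<^sub>b\<close> satisfies \<open>\<psi>\<^sub>a y = y \<phi>\<^sub>a\<close>. Its
coefficients lie in the maximal ideal, so it vanishes.
\<close>

lemma principal_intertwiner_all:
  assumes a: "a \<in> A" "degree (\<psi> a) > 0" and b: "b \<in> A"
    and x: "principal_series x"
    and eq: "skew_mult (series_of_poly (\<psi> a)) x = skew_mult x (series_of_poly (\<phi> a))"
  shows "skew_mult (series_of_poly (\<psi> b)) x = skew_mult x (series_of_poly (\<phi> b))"
proof -
  interpret red: good_reduction_module p K v A \<phi> by (rule reduction_good)
  let ?s = "\<lambda>f :: 'l poly. series_of_poly f"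
  define y where "y = (\<lambda>n. skew_mult (?s (\<psi> b)) x n - skew_mult x (?s (\<phi> b)) n)"
  have a0: "a \<noteq> 0" using a by auto
  have tx: "tau_degree_le x 0" using x by (simp add: principal_series_def tau_degree_le_def)
  note ts = tau_degree_le_series_of_poly
  have db: "degree (\<phi> b) = degree (\<psi> b)" using b by (rule degree_reduction)
  have da: "degree (\<phi> a) = degree (\<psi> a)" using a by (intro degree_reduction)
  let ?n = "int (degree (\<psi> b))"
  have t1: "tau_degree_le (skew_mult (?s (\<psi> b)) x) ?n" using tau_degree_le_skew_mult[OF ts tx] by simp
  have t2: "tau_degree_le (skew_mult x (?s (\<phi> b))) ?n" using tau_degree_le_skew_mult[OF tx ts[of "\<phi> b"]] db by simp
  have ty: "tau_degree_le y ?n" unfolding y_def using t1 t2 by (rule tau_degree_le_diff)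
  have "y n \<in> \<M>" for n
  proof -
    have "y n = (\<Sum>i\<le>degree (\<psi> b). coeff (\<psi> b) i * x (n - int i) ^ (CHAR('l) ^ i)
        - x (n - int i) * frob_pow (n - int i) (coeff (\<phi> b) i))"
      by (simp add: y_def db sum_subtractf skew_mult_poly_left[OF order_refl]
          skew_mult_poly_right[of _ "degree (\<psi> b)"])
    also have "\<dots> \<in> \<M>"
    proof (rule M_sum)
      fix i
      show "coeff (\<psi> b) i * x (n - int i) ^ (CHAR('l) ^ i)
        - x (n - int i) * frob_pow (n - int i) (coeff (\<phi> b) i) \<in> \<M>"
      proof (cases "n - int i \<le> 0")
        case True
        then show ?thesis
          using x b coeffs_OK red.coeffs_OK coeff_diff_reduction
          by (intro intertwining_defect_in_M) (auto simp: principal_series_def OK_iff MK_iff)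
      next
        case False
        then have "x (n - int i) = 0" using x by (simp add: principal_series_def)
        moreover have zero: "(0 :: 'l) ^ (CHAR('l) ^ i) = 0" by (rule zero_power) (simp add: char_pos)
        ultimately show ?thesis by (simp only: zero) simp
      qed
    qed
    finally show ?thesis .
  qed
  moreover have "skew_mult (?s (\<psi> a)) y = skew_mult y (?s (\<phi> a))"
  proof -
    have "skew_mult (?s (\<psi> a)) y = (\<lambda>n. skew_mult (?s (\<psi> a)) (skew_mult (?s (\<psi> b)) x) n
        - skew_mult (?s (\<psi> a)) (skew_mult x (?s (\<phi> b))) n)"
      unfolding y_def by (rule skew_mult_diff_right[OF ts t1 t2])
    also have "skew_mult (?s (\<psi> a)) (skew_mult (?s (\<psi> b)) x) = skew_mult (?s (\<psi> (b * a))) x"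
      using a b by (simp add: mult.commute[of b a] psi_mult skew_mult_assoc[OF ts ts tx])
    also have "\<dots> = skew_mult (skew_mult (?s (\<psi> b)) x) (?s (\<phi> a))"
      using a b by (simp add: psi_mult skew_mult_assoc[OF ts ts tx] skew_mult_assoc[OF ts tx ts] eq)
    also have "skew_mult (?s (\<psi> a)) (skew_mult x (?s (\<phi> b))) = skew_mult x (?s (\<phi> (a * b)))"
      using a b by (simp add: red.psi_mult skew_mult_assoc[OF ts tx ts, symmetric] skew_mult_assoc[OF tx ts ts, symmetric] eq)
    also have "\<dots> = skew_mult (skew_mult x (?s (\<phi> b))) (?s (\<phi> a))"
      using a b by (simp add: mult.commute[of a b] red.psi_mult skew_mult_assoc[OF tx ts ts])
    also have "(\<lambda>n. skew_mult (skew_mult (?s (\<psi> b)) x) (?s (\<phi> a)) n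
        - skew_mult (skew_mult x (?s (\<phi> b))) (?s (\<phi> a)) n) = skew_mult y (?s (\<phi> a))"
      unfolding y_def by (rule skew_mult_diff_left[OF t1 t2 ts, symmetric])
    finally show ?thesis .
  qed
  ultimately have "y n = 0" for n
    using ty a da lead_unit[OF a(1) a0] red.lead_unit[OF a(1) a0]
    by (intro skew_intertwiner_eq_0[of "\<psi> a" "degree (\<psi> a)" "\<phi> a" y]) simp_all
  then show ?thesis by (simp add: y_def fun_eq_iff)
qed

text \<open>
The difference of two such series has coefficients in the maximal ideal, which gives
uniqueness by the same vanishing lemma.
\<close>

lemma chi_series:
  assumes a: "a \<in> A" "degree (\<psi> a) > 0"
  shows "principal_series (chi_series K v A \<psi>)"
    and "b \<in> A \<Longrightarrow> skew_mult (series_of_poly (\<psi> b)) (chi_series K v A \<psi>)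
       = skew_mult (chi_series K v A \<psi>) (series_of_poly (\<phi> b))"
proof -
  interpret red: good_reduction_module p K v A \<phi> by (rule reduction_good)
  let ?s = "\<lambda>f :: 'l poly. series_of_poly f"
  define P where "P x \<longleftrightarrow> principal_series x \<and>
    (\<forall>b\<in>A. skew_mult (?s (\<psi> b)) x = skew_mult x (?s (\<phi> b)))" for x
  have a0: "a \<noteq> 0" using a by auto
  have da: "degree (\<phi> a) = degree (\<psi> a)" using a by (intro degree_reduction)
  note leads = lead_unit[OF a(1) a0] red.lead_unit[OF a(1) a0]
  note ts = tau_degree_le_series_of_poly
  obtain x where "principal_series x" "skew_mult (?s (\<psi> a)) x = skew_mult x (?s (\<phi> a))"
    using principal_intertwiner_exists[of "\<psi> a" "degree (\<psi> a)" "\<phi> a"] a da leads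
      coeffs_OK frob_pow_coeff_reduction coeff_diff_reduction by auto
  then have ex: "P x" using principal_intertwiner_all[OF a] by (auto simp: P_def)
  have unique: "x = x'" if x: "P x" "P x'" for x x'
  proof
    fix n
    have t: "tau_degree_le x 0" "tau_degree_le x' 0"
      using x by (simp_all add: P_def principal_series_def tau_degree_le_def)
    have "x n - x' n = 0"
    proof (rule skew_intertwiner_eq_0[of "\<psi> a" "degree (\<psi> a)" "\<phi> a" "\<lambda>n. x n - x' n" 0])
      show "skew_mult (?s (\<psi> a)) (\<lambda>n. x n - x' n) = skew_mult (\<lambda>n. x n - x' n) (?s (\<phi> a))"
        using x a by (simp add: P_def skew_mult_diff_right[OF ts t] skew_mult_diff_left[OF t ts])
      show "x m - x' m \<in> \<M>" for m
        using x M_diff[of "x m" "x' m"] M_diff[of "x 0 - 1" "x' 0 - 1"]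
        by (cases m "0 :: int" rule: linorder_cases) (auto simp: P_def principal_series_def MK_iff)
    qed (use a da leads t in \<open>simp_all add: tau_degree_le_diff\<close>)
    then show "x n = x' n" by simp
  qed
  have "chi_series K v A \<psi> = (THE x. P x)"
    by (simp add: chi_series_def P_def principal_series_def)
  moreover have "P (THE x. P x)" by (rule theI[of P x, OF ex]) (rule unique[OF _ ex])
  ultimately have "P (chi_series K v A \<psi>)" by simp
  then show "principal_series (chi_series K v A \<psi>)"
    and "b \<in> A \<Longrightarrow> skew_mult (?s (\<psi> b)) (chi_series K v A \<psi>) = skew_mult (chi_series K v A \<psi>) (?s (\<phi> b))"
    by (simp_all add: P_def)
qed

end

section \<open>Algebraic dependence in a global function field\<close>

text \<open>
The monomials \<open>x\<^sup>i y\<^sup>j\<close> with \<open>i, j \<le> n\<close> grow quadratically in number, while the dimension of the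
space that contains them grows linearly in \<open>n\<close>.
\<close>

lemma pigeonhole_power_growth:
  fixes k b C :: nat
  assumes "k \<ge> 2"
  shows "\<exists>n. k ^ (b * ((2 * n + 1) * C + 1)) < k ^ ((n + 1) * (n + 1))"
proof
  (* (n + 1)^2 = n^2 + 2n + 1 with n^2 = n b (2C + 1) exceeds b (2n + 1) C + b *)
  let ?n = "b * (2 * C + 1)"
  have "b * ((2 * ?n + 1) * C + 1) \<le> b * ((2 * ?n + 1) * C + 1) + (?n * b + b * C)" by simp
  also have "\<dots> < (?n + 1) * (?n + 1)" by (simp add: algebra_simps)
  finally show "k ^ (b * ((2 * ?n + 1) * C + 1)) < k ^ ((?n + 1) * (?n + 1))"
    using assms by (intro power_strict_increasing) auto
qed

lemma prime_field_closed:
  "x \<in> prime_field \<Longrightarrow> y \<in> prime_field \<Longrightarrow> x - y \<in> (prime_field :: 'a::field set)"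
  "x \<in> prime_field \<Longrightarrow> y \<in> prime_field \<Longrightarrow> x + y \<in> (prime_field :: 'a::field set)"
  "x \<in> prime_field \<Longrightarrow> y \<in> prime_field \<Longrightarrow> x * y \<in> (prime_field :: 'a::field set)"
  "0 \<in> (prime_field :: 'a::field set)" "1 \<in> (prime_field :: 'a::field set)"
  unfolding prime_field_def
  by (auto simp flip: of_int_diff of_int_add of_int_mult)
     (metis of_int_0 rangeI, metis of_int_1 rangeI)

lemma finite_prime_field:
  assumes "CHAR('a::field) > 0"
  shows "finite (prime_field :: 'a set)"
proof -
  have "prime_field \<subseteq> (of_int ` {0..<int CHAR('a)} :: 'a set)"
  proof
    fix x :: 'a assume "x \<in> prime_field"
    then obtain i where i: "x = of_int i" by (auto simp: prime_field_def)
    have "(of_int i :: 'a) = of_int (i mod int CHAR('a) + int CHAR('a) * (i div int CHAR('a)))"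
      by (simp only: mod_mult_div_eq)
    also have "\<dots> = of_int (i mod int CHAR('a))"
      by (simp only: of_int_add of_int_mult of_int_of_nat_eq of_nat_CHAR mult_zero_left add_0_right)
    finally have "(of_int i :: 'a) = of_int (i mod int CHAR('a))" .
    then show "x \<in> of_int ` {0..<int CHAR('a)}" using i assms by auto
  qed
  then show ?thesis by (rule finite_subset) simp
qed

definition prime_field_polys :: "'a::field poly set" where
  "prime_field_polys = {f. \<forall>i. coeff f i \<in> prime_field}"

lemma prime_field_polys_closed:
  "f \<in> prime_field_polys \<Longrightarrow> g \<in> prime_field_polys \<Longrightarrow> f + g \<in> prime_field_polys"
  "f \<in> prime_field_polys \<Longrightarrow> g \<in> prime_field_polys \<Longrightarrow> f * g \<in> prime_field_polys"
  "0 \<in> prime_field_polys" "1 \<in> prime_field_polys"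
  "c \<in> prime_field \<Longrightarrow> [:c:] \<in> prime_field_polys"
proof -
  show "f \<in> prime_field_polys \<Longrightarrow> g \<in> prime_field_polys \<Longrightarrow> f + g \<in> prime_field_polys"
    by (simp add: prime_field_polys_def prime_field_closed)
  have sum: "(\<Sum>s\<in>S. h s) \<in> prime_field" if "\<And>s. s \<in> S \<Longrightarrow> h s \<in> prime_field" for S :: "nat set" and h :: "nat \<Rightarrow> 'a"
    using that by (induction S rule: infinite_finite_induct) (simp_all add: prime_field_closed)
  show "f \<in> prime_field_polys \<Longrightarrow> g \<in> prime_field_polys \<Longrightarrow> f * g \<in> prime_field_polys"
    by (simp add: prime_field_polys_def prime_field_closed coeff_mult sum)
  show "0 \<in> prime_field_polys" "1 \<in> prime_field_polys"
    "c \<in> prime_field \<Longrightarrow> [:c:] \<in> prime_field_polys"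
    by (auto simp: prime_field_polys_def prime_field_closed coeff_pCons split: nat.split)
qed

lemma prime_field_polys_prod:
  "(\<And>s. s \<in> S \<Longrightarrow> f s \<in> prime_field_polys) \<Longrightarrow> (\<Prod>s\<in>S. f s) \<in> prime_field_polys"
  by (induction S rule: infinite_finite_induct) (simp_all add: prime_field_polys_closed)

lemma card_prime_field_polys:
  fixes n :: nat
  assumes "CHAR('a::field) > 0"
  defines "P \<equiv> {f :: 'a poly. f \<in> prime_field_polys \<and> degree f \<le> n}"
  shows "finite P" "card P \<le> card (prime_field :: 'a set) ^ (n + 1)"
proof -
  let ?E = "{..n} \<rightarrow>\<^sub>E (prime_field :: 'a set)"
  have fin: "finite ?E" using finite_prime_field[OF assms(1)] by (intro finite_PiE) auto
  have inj: "inj_on (\<lambda>f. restrict (coeff f) {..n}) P"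
  proof (rule inj_onI, rule poly_eqI)
    fix f g :: "'a poly" and i
    assume fg: "f \<in> P" "g \<in> P" "restrict (coeff f) {..n} = restrict (coeff g) {..n}"
    show "coeff f i = coeff g i"
    proof (cases "i \<le> n")
      case True
      then show ?thesis using fun_cong[OF fg(3), of i] by simp
    qed (use fg in \<open>simp add: P_def coeff_eq_0\<close>)
  qed
  have sub: "(\<lambda>f. restrict (coeff f) {..n}) ` P \<subseteq> ?E"
    by (auto simp: P_def prime_field_polys_def PiE_iff extensional_def split: if_splits)
  show "finite P" using inj_on_finite[OF inj sub fin] .
  have "card P \<le> card ?E" using card_inj_on_le[OF inj sub fin] .
  then show "card P \<le> card (prime_field :: 'a set) ^ (n + 1)" by (simp add: card_PiE)
qed

text \<open>
\<open>F\<close> has transcendence degree \<open>1\<close>. The proof counts: let \<open>B\<close> span \<open>F\<close> over the rational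
functions in \<open>t\<close>, and let \<open>W m\<close> be the finite set of combinations of \<open>B\<close> whose coefficients
are polynomials in \<open>t\<close> of degree at most \<open>m\<close>. With a common denominator \<open>D\<close>, multiplication
by \<open>D x\<close>, \<open>D y\<close> or \<open>D\<close> raises \<open>m\<close> by at most a constant \<open>C\<close>. So all combinations of the
monomials \<open>D\<^bsup>2n+1\<^esup> x\<^sup>i y\<^sup>j\<close> with \<open>i, j \<le> n\<close> over the prime field lie in \<open>W ((2n+1) C)\<close>, and for
large \<open>n\<close> there are more coefficient families than elements of this set.
\<close>

lemma function_field_dependence:
  fixes x y :: "'f::field"
  assumes "global_function_field p TYPE('f)"
  shows "\<exists>c :: nat \<Rightarrow> 'f poly. \<exists>n. (\<forall>j. c j \<in> prime_field_polys) \<and>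
    (\<exists>j\<le>n. c j \<noteq> 0) \<and> (\<Sum>j\<le>n. poly (c j) x * y ^ j) = 0"
proof -
  let ?F = "prime_field :: 'f set" and ?PP = "prime_field_polys :: 'f poly set"
  have char: "CHAR('f) > 0" using assms prime_gt_0_nat by (auto simp: global_function_field_def)
  obtain t :: 'f and B :: "'f set" where B: "finite B"
    and gen: "\<And>x. \<exists>c. (\<forall>b\<in>B. c b \<in> rational_functions t) \<and> x = (\<Sum>b\<in>B. c b * b)"
    using assms unfolding global_function_field_def by blast
  define W where "W m = (\<lambda>h. \<Sum>b\<in>B. poly (h b) t * b) ` (B \<rightarrow>\<^sub>E {f \<in> ?PP. degree f \<le> m})" for m
  have W_iff: "z \<in> W m \<longleftrightarrow> (\<exists>h. (\<forall>b\<in>B. h b \<in> ?PP \<and> degree (h b) \<le> m) \<and> z = (\<Sum>b\<in>B. poly (h b) t * b))" for z m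
  proof
    assume "\<exists>h. (\<forall>b\<in>B. h b \<in> ?PP \<and> degree (h b) \<le> m) \<and> z = (\<Sum>b\<in>B. poly (h b) t * b)"
    then obtain h where h: "\<forall>b\<in>B. h b \<in> ?PP \<and> degree (h b) \<le> m" "z = (\<Sum>b\<in>B. poly (h b) t * b)" by blast
    then show "z \<in> W m" unfolding W_def by (intro image_eqI[of _ _ "restrict h B"]) auto
  qed (auto simp: W_def PiE_iff)
  have W_card: "finite (W m)" "card (W m) \<le> card ?F ^ (card B * (m + 1))" for m
  proof -
    note P = card_prime_field_polys[OF char, of m]
    have "finite (B \<rightarrow>\<^sub>E {f \<in> ?PP. degree f \<le> m})" using P(1) B by (intro finite_PiE) auto
    then show "finite (W m)" unfolding W_def by simp
    have "card (W m) \<le> card (B \<rightarrow>\<^sub>E {f \<in> ?PP. degree f \<le> m})"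
      unfolding W_def by (rule card_image_le) fact
    also have "\<dots> = card {f \<in> ?PP. degree f \<le> m} ^ card B" using B by (simp add: card_PiE)
    also have "\<dots> \<le> (card ?F ^ (m + 1)) ^ card B" using P(2) by (rule power_mono) simp
    also have "\<dots> = card ?F ^ (card B * (m + 1))" by (simp only: power_mult[symmetric] mult.commute)
    finally show "card (W m) \<le> card ?F ^ (card B * (m + 1))" .
  qed
  have W_add: "z + w \<in> W m" if "z \<in> W m" "w \<in> W m" for z w m
  proof -
    from that obtain h k where "\<forall>b\<in>B. h b \<in> ?PP \<and> degree (h b) \<le> m" "z = (\<Sum>b\<in>B. poly (h b) t * b)"
      "\<forall>b\<in>B. k b \<in> ?PP \<and> degree (k b) \<le> m" "w = (\<Sum>b\<in>B. poly (k b) t * b)"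
      by (auto simp: W_iff)
    then show ?thesis unfolding W_iff
      by (intro exI[of _ "\<lambda>b. h b + k b"])
        (auto simp: prime_field_polys_closed degree_add_le ring_distribs sum.distrib)
  qed
  have W_0: "0 \<in> W m" for m
    unfolding W_iff by (rule exI[of _ "\<lambda>_. 0"]) (simp add: prime_field_polys_closed)
  have W_sum: "(\<Sum>s\<in>S. w s) \<in> W m" if "\<And>s. s \<in> S \<Longrightarrow> w s \<in> W m" for S :: "'f set" and w m
    using that by (induction S rule: infinite_finite_induct) (simp_all add: W_0 W_add)
  have W_sum': "(\<Sum>s\<in>S. w s) \<in> W m" if "\<And>s. s \<in> S \<Longrightarrow> w s \<in> W m" for S :: "(nat \<times> nat) set" and w m
    using that by (induction S rule: infinite_finite_induct) (simp_all add: W_0 W_add)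
  have W_mult: "poly f t * w \<in> W (l + m)" if "f \<in> ?PP" "degree f \<le> l" "w \<in> W m" for f w l m
  proof -
    from that(3) obtain h where h: "\<forall>b\<in>B. h b \<in> ?PP \<and> degree (h b) \<le> m" "w = (\<Sum>b\<in>B. poly (h b) t * b)"
      by (auto simp: W_iff)
    then show ?thesis unfolding W_iff using that
      by (intro exI[of _ "\<lambda>b. f * h b"])
        (auto simp: prime_field_polys_closed sum_distrib_left mult.assoc
          intro!: order_trans[OF degree_mult_le] add_mono)
  qed
  have W_mono: "w \<in> W m'" if "w \<in> W m" "m \<le> m'" for w m m'
    using W_mult[of 1 "m' - m" w m] that by (simp add: prime_field_polys_closed)
  (* the product of the denominators of the coordinates of z *)
  have denom1: "\<exists>g\<in>?PP. poly g t \<noteq> 0 \<and> (\<exists>m. poly g t * z \<in> W m)" for z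
  proof -
    obtain c where c: "\<forall>b\<in>B. c b \<in> rational_functions t" "z = (\<Sum>b\<in>B. c b * b)" using gen by blast
    then have "\<forall>b\<in>B. \<exists>f g. f \<in> ?PP \<and> g \<in> ?PP \<and> poly g t \<noteq> 0 \<and> c b = poly f t / poly g t"
      unfolding rational_functions_def prime_field_polys_def by blast
    then obtain f g where fg: "\<And>b. b \<in> B \<Longrightarrow> f b \<in> ?PP" "\<And>b. b \<in> B \<Longrightarrow> g b \<in> ?PP"
      "\<And>b. b \<in> B \<Longrightarrow> poly (g b) t \<noteq> 0" "\<And>b. b \<in> B \<Longrightarrow> c b = poly (f b) t / poly (g b) t" by metis
    define G where "G = (\<Prod>b\<in>B. g b)"
    define h where "h b = f b * (\<Prod>b'\<in>B - {b}. g b')" for b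
    have "poly G t * c b = poly (h b) t" if "b \<in> B" for b
      using fg(3,4)[OF that] B that by (simp add: G_def h_def prod.remove)
    then have "poly G t * z = (\<Sum>b\<in>B. poly (h b) t * b)"
      by (simp add: c(2) sum_distrib_left flip: mult.assoc)
    moreover have "h b \<in> ?PP \<and> degree (h b) \<le> (\<Sum>b\<in>B. degree (h b))" if "b \<in> B" for b
      using fg that B member_le_sum[of b B "\<lambda>b. degree (h b)"]
      by (auto simp: h_def intro!: prime_field_polys_closed prime_field_polys_prod)
    ultimately have "poly G t * z \<in> W (\<Sum>b\<in>B. degree (h b))" unfolding W_iff by blast
    moreover have "G \<in> ?PP" "poly G t \<noteq> 0"
      using fg B by (auto simp: G_def poly_prod intro!: prime_field_polys_prod)
    ultimately show ?thesis by blast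
  qed
  have denom: "\<exists>g\<in>?PP. poly g t \<noteq> 0 \<and> (\<exists>m. \<forall>z\<in>Z. poly g t * z \<in> W m)" if "finite Z" for Z
    using that
  proof (induction Z)
    case empty
    then show ?case by (intro bexI[of _ 1]) (auto simp: prime_field_polys_closed)
  next
    case (insert z Z)
    obtain g m where g: "g \<in> ?PP" "poly g t \<noteq> 0" "\<forall>z\<in>Z. poly g t * z \<in> W m" using insert.IH by blast
    obtain h n where h: "h \<in> ?PP" "poly h t \<noteq> 0" "poly h t * z \<in> W n" using denom1[of z] by blast
    let ?m = "degree h + m + (degree g + n)"
    have "poly h t * (poly g t * w) \<in> W ?m" if "w \<in> Z" for w
    proof -
      have "poly h t * (poly g t * w) \<in> W (degree h + m)"
        using g that by (intro W_mult h(1) order_refl) auto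
      then show ?thesis by (rule W_mono) simp
    qed
    moreover have "poly g t * (poly h t * z) \<in> W ?m"
      using W_mult[OF g(1) order_refl h(3)] by (rule W_mono) auto
    ultimately show ?case
      using g h by (intro bexI[of _ "g * h"] conjI exI[of _ ?m])
        (auto simp: prime_field_polys_closed mult_ac)
  qed
  obtain D m where D: "D \<in> ?PP" "poly D t \<noteq> 0"
    and Dm: "\<And>z. z \<in> insert 1 ((*) x ` B \<union> (*) y ` B) \<Longrightarrow> poly D t * z \<in> W m"
    using denom[of "insert 1 ((*) x ` B \<union> (*) y ` B)"] B by blast
  define C where "C = m + degree D"
  have mult_gen: "poly D t * z * w \<in> W (l + C)" if z: "\<And>b. b \<in> B \<Longrightarrow> poly D t * (z * b) \<in> W m" and w: "w \<in> W l" for z w l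
  proof -
    from w obtain h where h: "\<forall>b\<in>B. h b \<in> ?PP \<and> degree (h b) \<le> l" "w = (\<Sum>b\<in>B. poly (h b) t * b)"
      by (auto simp: W_iff)
    have "(\<Sum>b\<in>B. poly (h b) t * (poly D t * (z * b))) \<in> W (l + m)"
      using h z by (intro W_sum W_mult) auto
    moreover have "(\<Sum>b\<in>B. poly (h b) t * (poly D t * (z * b))) = poly D t * z * w"
      by (simp add: h(2) sum_distrib_left mult_ac)
    ultimately show ?thesis by (auto simp: C_def intro: W_mono)
  qed
  have mult_D: "poly D t * w \<in> W (l + C)" if "w \<in> W l" for w l
    using W_mult[OF D(1) order_refl that] by (rule W_mono) (simp add: C_def)
  let ?d = "poly D t"
  have pow_gen: "(?d * z) ^ i * w \<in> W (l + i * C)"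
    if z: "\<And>w l. w \<in> W l \<Longrightarrow> ?d * z * w \<in> W (l + C)" and w: "w \<in> W l" for z w l i
  proof (induction i)
    case (Suc i)
    from z[OF this] show ?case by (simp add: mult.assoc add_ac)
  qed (use w in simp)
  (* i + j factors D go with x and y; the remaining ones only raise the degree, and the last one brings 1 into W C *)
  have mono: "?d ^ (2 * n + 1) * (x ^ i * y ^ j) \<in> W ((2 * n + 1) * C)" if "i \<le> n" "j \<le> n" for i j n
  proof -
    have "?d * 1 \<in> W C" using Dm[of 1] by (auto simp: C_def intro: W_mono)
    then have mem: "(?d * x) ^ i * ((?d * y) ^ j * ((?d * 1) ^ (2 * n - i - j) * (?d * 1)))
        \<in> W (C + (2 * n - i - j) * C + j * C + i * C)"
      using Dm by (intro pow_gen) (auto intro!: mult_gen mult_D)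
    have "(2 * n + 1) = Suc (i + (j + (2 * n - i - j)))" using that by simp
    then have monomial: "(?d * x) ^ i * ((?d * y) ^ j * ((?d * 1) ^ (2 * n - i - j) * (?d * 1)))
        = ?d ^ (2 * n + 1) * (x ^ i * y ^ j)"
      by (simp only: power_mult_distrib power_Suc power_add mult_ac mult_1_left mult_1_right power_one)
    have "C + (2 * n - i - j) * C + j * C + i * C = (1 + (2 * n - i - j) + j + i) * C"
      by (simp add: ring_distribs)
    also have "1 + (2 * n - i - j) + j + i = 2 * n + 1" using that by simp
    finally have index: "C + (2 * n - i - j) * C + j * C + i * C = (2 * n + 1) * C" .
    show ?thesis using mem unfolding monomial index .
  qed
  have "(0 :: 'f) \<noteq> 1" "{0, 1} \<subseteq> ?F" by (auto simp: prime_field_closed)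
  then have F2: "card ?F \<ge> 2" using card_mono[OF finite_prime_field[OF char], of "{0, 1}"] by simp
  obtain n where n: "card ?F ^ (card B * ((2 * n + 1) * C + 1)) < card ?F ^ ((n + 1) * (n + 1))"
    using pigeonhole_power_growth[OF F2] by blast
  let ?I = "{..n} \<times> {..n}"
  define E where "E = ?I \<rightarrow>\<^sub>E ?F"
  define ev where "ev c = (\<Sum>s\<in>?I. c s * (?d ^ (2 * n + 1) * (x ^ fst s * y ^ snd s)))" for c :: "nat \<times> nat \<Rightarrow> 'f"
  have "ev ` E \<subseteq> W ((2 * n + 1) * C)"
  proof safe
    fix c assume c: "c \<in> E"
    show "ev c \<in> W ((2 * n + 1) * C)"
      unfolding ev_def
    proof (rule W_sum')
      fix s assume s: "s \<in> ?I"
      then have "[:c s:] \<in> ?PP" using c by (auto simp: E_def intro!: prime_field_polys_closed)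
      from W_mult[OF this, of 0] mono[of "fst s" n "snd s"] s
      show "c s * (?d ^ (2 * n + 1) * (x ^ fst s * y ^ snd s)) \<in> W ((2 * n + 1) * C)" by auto
    qed
  qed
  moreover have "card (W ((2 * n + 1) * C)) < card E"
    using W_card(2)[of "(2 * n + 1) * C"] n
    by (simp add: E_def card_PiE card_cartesian_product)
  ultimately have "\<not> inj_on ev E" using W_card(1) card_inj_on_le[of ev E "W ((2 * n + 1) * C)"] by auto
  then obtain c c' where cc: "c \<in> E" "c' \<in> E" "c \<noteq> c'" "ev c = ev c'" by (auto simp: inj_on_def)
  (* two families with the same value differ by a nontrivial relation, whose terms are sorted by powers of y *)
  define k where "k s = c s - c' s" for s
  obtain s where s: "c s \<noteq> c' s" "s \<in> ?I" using cc(1-3) unfolding E_def by (metis PiE_ext)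
  have kF: "k s \<in> ?F" if "s \<in> ?I" for s
    using cc that by (auto simp: E_def k_def intro!: prime_field_closed)
  define P where "P j = (\<Sum>i\<le>n. monom (if j \<le> n then k (i, j) else 0) i)" for j
  have coeff_P: "coeff (P j) i = (if i \<le> n \<and> j \<le> n then k (i, j) else 0)" for i j
    by (simp add: P_def coeff_sum if_distrib[where f = "\<lambda>a. a = _"] sum.delta)
  have "0 = ev c - ev c'" using cc by simp
  also have "\<dots> = ?d ^ (2 * n + 1) * (\<Sum>s\<in>?I. k s * (x ^ fst s * y ^ snd s))"
    unfolding ev_def k_def sum_distrib_left sum_subtractf[symmetric]
    by (intro sum.cong refl) (simp add: algebra_simps)
  finally have "(\<Sum>s\<in>?I. k s * (x ^ fst s * y ^ snd s)) = 0" using D(2) by simp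
  moreover have "(\<Sum>s\<in>?I. k s * (x ^ fst s * y ^ snd s)) = (\<Sum>i\<le>n. \<Sum>j\<le>n. k (i, j) * (x ^ i * y ^ j))"
    by (simp add: sum.cartesian_product case_prod_beta)
  moreover have "\<dots> = (\<Sum>j\<le>n. \<Sum>i\<le>n. k (i, j) * (x ^ i * y ^ j))" by (rule sum.swap)
  moreover have "\<dots> = (\<Sum>j\<le>n. poly (P j) x * y ^ j)"
    by (intro sum.cong refl) (simp add: P_def poly_sum poly_monom sum_distrib_right mult.assoc)
  ultimately have "(\<Sum>j\<le>n. poly (P j) x * y ^ j) = 0" by simp
  moreover have "P j \<in> ?PP" for j
    using kF by (auto simp: prime_field_polys_def coeff_P prime_field_closed)
  moreover have "coeff (P (snd s)) (fst s) \<noteq> 0" using s by (auto simp: coeff_P k_def)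
  then have "P (snd s) \<noteq> 0" by auto
  moreover have "snd s \<le> n" using s by auto
  ultimately show ?thesis by blast
qed

section \<open>The field of fractions of the ring of functions\<close>

text \<open>
The element \<open>y = d\<^sub>n x\<close> is a root of a monic polynomial with coefficients in \<open>R\<close>. If \<open>y\<close> were
outside \<open>R\<close>, then \<open>1 / y\<close> would be in \<open>R\<close>, and division of the equation by \<open>y\<^bsup>n-1\<^esup>\<close> would express
\<open>y\<close> as an element of \<open>R\<close>.
\<close>

lemma place_integrally_closed:
  fixes R :: "'f::field set"
  assumes R: "is_place R" and d: "\<And>j. j \<le> n \<Longrightarrow> d j \<in> R"
    and eq: "(\<Sum>j\<le>n. d j * x ^ j) = 0" and n: "n > 0"
  shows "d n * x \<in> R"
proof (rule ccontr)
  assume nR: "d n * x \<notin> R"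
  define y where "y = d n * x"
  have R1: "1 \<in> R" "\<And>a b. a \<in> R \<Longrightarrow> b \<in> R \<Longrightarrow> a - b \<in> R" "\<And>a b. a \<in> R \<Longrightarrow> b \<in> R \<Longrightarrow> a * b \<in> R"
    using R by (auto simp: is_place_def is_subring_def)
  have R0: "0 \<in> R" using R1(2)[OF R1(1) R1(1)] by simp
  then have Rneg: "- a \<in> R" if "a \<in> R" for a using R1(2)[OF R0 that] by simp
  have Radd: "a + b \<in> R" if "a \<in> R" "b \<in> R" for a b using R1(2)[OF that(1) Rneg[OF that(2)]] by simp
  have Rpow: "a ^ k \<in> R" if "a \<in> R" for a and k :: nat using that R1 by (induction k) auto
  have Rsum: "(\<Sum>j\<in>S. f j) \<in> R" if "\<And>j. j \<in> S \<Longrightarrow> f j \<in> R" for S :: "nat set" and f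
    using that by (induction S rule: infinite_finite_induct) (auto simp: R0 Radd)
  have y0: "y \<noteq> 0" using nR R0 by (auto simp: y_def)
  then have dn: "d n \<noteq> 0" by (auto simp: y_def)
  have iy: "inverse y \<in> R" using nR R unfolding is_place_def y_def by blast
  obtain k where k: "n = Suc k" using n by (cases n) auto
  have "0 = d n ^ k * (\<Sum>j\<le>n. d j * x ^ j)" by (simp add: eq)
  also have "\<dots> = d n ^ k * d n * x ^ n + (\<Sum>j\<le>k. d n ^ k * (d j * x ^ j))"
    by (simp add: k ring_distribs sum_distrib_left mult_ac)
  also have "d n ^ k * d n * x ^ n = y ^ n"
    by (simp add: k y_def power_mult_distrib mult_ac)
  also have "(\<Sum>j\<le>k. d n ^ k * (d j * x ^ j)) = (\<Sum>j\<le>k. d j * d n ^ (k - j) * y ^ j)"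
  proof (rule sum.cong[OF refl])
    fix j assume "j \<in> {..k}"
    then have "d n ^ k = d n ^ (k - j) * d n ^ j" by (simp flip: power_add)
    then show "d n ^ k * (d j * x ^ j) = d j * d n ^ (k - j) * y ^ j"
      by (simp add: y_def power_mult_distrib mult_ac)
  qed
  finally have "y ^ n = - (\<Sum>j\<le>k. d j * d n ^ (k - j) * y ^ j)" by (simp add: eq_neg_iff_add_eq_0)
  then have "y ^ n * inverse y ^ k = - (\<Sum>j\<le>k. d j * d n ^ (k - j) * (y ^ j * inverse y ^ k))"
    by (simp add: sum_distrib_right mult.assoc)
  also have "y ^ n * inverse y ^ k = y" using y0 by (simp add: k power_inverse)
  also have "(\<Sum>j\<le>k. d j * d n ^ (k - j) * (y ^ j * inverse y ^ k))
      = (\<Sum>j\<le>k. d j * d n ^ (k - j) * inverse y ^ (k - j))"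
  proof (rule sum.cong[OF refl])
    fix j assume "j \<in> {..k}"
    then have "inverse y ^ k = inverse y ^ (k - j) * inverse y ^ j" by (simp flip: power_add)
    moreover have "y ^ j * inverse y ^ j = 1" using y0 by (simp flip: power_mult_distrib)
    ultimately have "y ^ j * inverse y ^ k = inverse y ^ (k - j)" by (metis mult.commute mult.assoc mult_1_right)
    then show "d j * d n ^ (k - j) * (y ^ j * inverse y ^ k) = d j * d n ^ (k - j) * inverse y ^ (k - j)" by simp
  qed
  also have "- \<dots> \<in> R" using d iy k by (intro Rneg Rsum R1 Rpow) auto
  finally show False using nR by (simp add: y_def)
qed

lemma regular_outside_subring: "is_subring (regular_outside Oinf)"
  unfolding regular_outside_def is_place_def is_subring_def by blast

context good_reduction_module
begin

lemma degree_psi_mult: "a \<in> A \<Longrightarrow> b \<in> A \<Longrightarrow> a \<noteq> 0 \<Longrightarrow> b \<noteq> 0 \<Longrightarrow>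
   degree (\<psi> a) + degree (\<psi> b) \<le> degree (\<psi> (a * b))"
proof (rule le_degree)
  assume ab: "a \<in> A" "b \<in> A" "a \<noteq> 0" "b \<noteq> 0"
  let ?m = "degree (\<psi> a)" and ?n = "degree (\<psi> b)"
  have "coeff (\<psi> (a * b)) (?m + ?n) = skew_mult (series_of_poly (\<psi> a)) (series_of_poly (\<psi> b)) (int (?m + ?n))"
    using ab psi_mult by (metis series_of_poly_nat)
  also have "\<dots> = (\<Sum>i\<le>?m. coeff (\<psi> a) i * (series_of_poly (\<psi> b) (int (?m + ?n) - int i)) ^ (CHAR('l) ^ i))"
    by (rule skew_mult_poly_left) simp
  also have "\<dots> = (\<Sum>i\<in>{?m}. coeff (\<psi> a) i * (series_of_poly (\<psi> b) (int (?m + ?n) - int i)) ^ (CHAR('l) ^ i))"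
  proof (rule sum.mono_neutral_right)
    show "\<forall>i\<in>{..?m} - {?m}. coeff (\<psi> a) i * (series_of_poly (\<psi> b) (int (?m + ?n) - int i)) ^ (CHAR('l) ^ i) = 0"
      using tau_degree_le_series_of_poly[of "\<psi> b"] by (auto simp: tau_degree_le_def char_pos)
  qed auto
  also have "\<dots> = lead_coeff (\<psi> a) * lead_coeff (\<psi> b) ^ (CHAR('l) ^ ?m)" by simp
  also have "\<dots> \<noteq> 0" using lead_nonzero ab by simp
  finally show "coeff (\<psi> (a * b)) (?m + ?n) \<noteq> 0" .
qed

lemma psi_of_int: "of_int i \<in> A" "\<psi> (of_int i) = of_int i"
proof -
  have "of_int i \<in> A \<and> \<psi> (of_int i) = of_int i"
    by (induction i rule: int_induct[of _ 0]) (auto simp: A_0 A_1 A_add A_diff psi_1 psi_add psi_diff)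
  then show "of_int i \<in> A" "\<psi> (of_int i) = of_int i" by auto
qed

text \<open>
Elements of the prime field act through constants, whereas \<open>\<psi>\<close> of a nonzero multiple of \<open>a\<close>
has positive degree. Hence \<open>c + a f(a)\<close> cannot vanish, and \<open>a\<close> is transcendental.
\<close>

lemma poly_nonconstant:
  assumes a: "a \<in> A" "degree (\<psi> a) > 0" and f: "f \<in> prime_field_polys"
  shows "poly f a \<in> A" "f \<noteq> 0 \<Longrightarrow> poly f a \<noteq> 0"
proof -
  have a0: "a \<noteq> 0" using a by auto
  have "poly f a \<in> A \<and> (f \<noteq> 0 \<longrightarrow> poly f a \<noteq> 0)"
    using f
  proof (induction f)
    case (pCons c f)
    obtain i where c: "c = of_int i"
      using pCons.prems by (auto simp: prime_field_polys_def prime_field_def coeff_pCons dest!: spec[of _ 0])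
    have "coeff f j \<in> prime_field" for j
      using pCons.prems by (auto simp: prime_field_polys_def dest!: spec[of _ "Suc j"])
    then have IH: "poly f a \<in> A" "f \<noteq> 0 \<Longrightarrow> poly f a \<noteq> 0"
      using pCons.IH by (auto simp: prime_field_polys_def)
    have "c + a * poly f a \<noteq> 0" if nz: "pCons c f \<noteq> 0"
    proof (cases "f = 0")
      case False
      show ?thesis
      proof
        assume "c + a * poly f a = 0"
        then have "a * poly f a = of_int (- i)" using c by (simp add: add_eq_0_iff)
        then have "degree (\<psi> (a * poly f a)) = 0" by (simp only: psi_of_int degree_of_int)
        with degree_psi_mult[OF a(1) IH(1) a0 IH(2)[OF False]] a(2) show False by simp
      qed
    qed (use nz in auto)
    then show ?case using c IH psi_of_int a by (auto intro!: A_add A_mult)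
  qed (simp add: A_0)
  then show "poly f a \<in> A" "f \<noteq> 0 \<Longrightarrow> poly f a \<noteq> 0" by auto
qed

text \<open>
A relation for \<open>x\<close> with coefficients polynomial in \<open>a\<close> has its leading coefficient \<open>d\<^sub>m\<close>
in \<open>A\<close>, and \<open>d\<^sub>m x\<close> is integral over \<open>A\<close>.
\<close>

lemma fraction_field:
  assumes F: "global_function_field p' TYPE('f)" and A: "A = regular_outside Oinf"
    and a: "a \<in> A" "degree (\<psi> a) > 0"
  shows "\<exists>e\<in>A. e \<noteq> 0 \<and> e * x \<in> A"
proof -
  obtain c n where c: "\<And>j. c j \<in> prime_field_polys" "\<exists>j\<le>n. c j \<noteq> 0"
    and eq: "(\<Sum>j\<le>n. poly (c j) a * x ^ j) = 0"
    using function_field_dependence[OF F, of a x] by blast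
  define d where "d j = poly (c j) a" for j
  have dA: "d j \<in> A" and d0: "c j \<noteq> 0 \<Longrightarrow> d j \<noteq> 0" for j
    using poly_nonconstant[OF a c(1)] by (auto simp: d_def)
  define S where "S = {j. j \<le> n \<and> d j \<noteq> 0}"
  define m where "m = Max S"
  obtain j0 where "j0 \<le> n" "c j0 \<noteq> 0" using c(2) by blast
  then have "j0 \<in> S" using d0 by (simp add: S_def)
  moreover have S: "finite S" by (simp add: S_def)
  ultimately have "m \<in> S" unfolding m_def by (intro Max_in) auto
  moreover have "j \<le> m" if "j \<le> n" "d j \<noteq> 0" for j
    unfolding m_def using S that by (intro Max_ge) (simp_all add: S_def)
  ultimately have m: "m \<le> n" "d m \<noteq> 0" "\<And>j. j \<le> n \<Longrightarrow> d j \<noteq> 0 \<Longrightarrow> j \<le> m"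
    by (auto simp: S_def)
  have eq': "(\<Sum>j\<le>m. d j * x ^ j) = 0"
  proof -
    have "(\<Sum>j\<le>m. d j * x ^ j) = (\<Sum>j\<le>n. d j * x ^ j)"
      using m by (intro sum.mono_neutral_left) force+
    then show ?thesis using eq by (simp add: d_def)
  qed
  have "m > 0" using eq' m by (cases m) auto
  have "d m * x \<in> R" if R: "is_place R" "R \<noteq> Oinf" for R
  proof (rule place_integrally_closed[OF R(1) _ eq' \<open>m > 0\<close>])
    show "d j \<in> R" for j using dA[of j] R by (auto simp: A regular_outside_def)
  qed
  then have "d m * x \<in> A" by (simp add: A regular_outside_def)
  then show ?thesis using dA m by blast
qed

end

text \<open>
If all \<open>\<psi>\<^sub>a\<close> were constants, the exponent \<open>0\<close> would satisfy the condition that defines the rank.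
\<close>

lemma good_drinfeld_module_nonconstant:
  assumes "good_drinfeld_module K v A (\<psi> :: 'f::field \<Rightarrow> 'l::field poly)"
  shows "\<exists>a\<in>A. degree (\<psi> a) > 0"
proof (rule ccontr)
  assume "\<not> (\<exists>a\<in>A. degree (\<psi> a) > 0)"
  then have "\<forall>a\<in>A - {0}. CHAR('l) ^ degree (\<psi> a) = card (quot A (a *o A)) ^ 0" by auto
  then have "drinfeld_rank A \<psi> = 0" unfolding drinfeld_rank_def by (rule Least_eq_0)
  then show False using assms by (simp add: good_drinfeld_module_def)
qed

section \<open>The perfection and the inertia group\<close>

context char_p_local_field
begin

lemmas M_coset_eq_iff = coset_eq_iff[OF M_0 M_diff]
lemmas M_coset_plus = coset_plus_coset[OF M_0 M_diff]

lemma perf_iff: "x \<in> perf K \<longleftrightarrow> (\<exists>n. x ^ (CHAR('l) ^ n) \<in> K)"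
  by (simp add: perf_def)

lemma perf_power_mono:
  assumes "x ^ (CHAR('l) ^ n) \<in> K" "n \<le> m"
  shows "x ^ (CHAR('l) ^ m) \<in> K"
proof -
  obtain k where "m = n + k" using assms(2) le_Suc_ex by blast
  then show ?thesis using K_power[OF assms(1), of "CHAR('l) ^ k"] by (simp add: power_add power_mult)
qed

lemma K_subset_perf: "x \<in> K \<Longrightarrow> x \<in> perf K"
  unfolding perf_iff by (rule exI[of _ 0]) simp

lemma perf_common:
  assumes "x \<in> perf K" "y \<in> perf K"
  obtains n where "x ^ (CHAR('l) ^ n) \<in> K" "y ^ (CHAR('l) ^ n) \<in> K"
proof -
  obtain i j where "x ^ (CHAR('l) ^ i) \<in> K" "y ^ (CHAR('l) ^ j) \<in> K" using assms by (auto simp: perf_iff)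
  then show ?thesis using that[of "max i j"] perf_power_mono by (meson max.cobounded1 max.cobounded2)
qed

lemma perf_add: "x \<in> perf K \<Longrightarrow> y \<in> perf K \<Longrightarrow> x + y \<in> perf K"
  by (rule perf_common[of x y]) (auto simp: perf_iff power_char_add intro: K_add)

lemma perf_mult: "x \<in> perf K \<Longrightarrow> y \<in> perf K \<Longrightarrow> x * y \<in> perf K"
  by (rule perf_common[of x y]) (auto simp: perf_iff power_mult_distrib intro: K_mult)

lemma perf_sum: "(\<And>s. s \<in> S \<Longrightarrow> f s \<in> perf K) \<Longrightarrow> (\<Sum>s\<in>S. f s) \<in> perf K"
  by (induction S rule: infinite_finite_induct) (simp_all add: perf_add K_subset_perf)

lemma perf_frob_pow:
  assumes "x \<in> perf K"
  shows "frob_pow j x \<in> perf K"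
proof -
  obtain n where n: "x ^ (CHAR('l) ^ n) \<in> K" using assms by (auto simp: perf_iff)
  have "(frob_pow j x) ^ (CHAR('l) ^ (nat \<bar>j\<bar> + n)) = x ^ (CHAR('l) ^ (nat (j + int (nat \<bar>j\<bar> + n))))"
    by (rule frob_pow_power_char_nat) simp
  also have "\<dots> \<in> K" using n by (rule perf_power_mono) simp
  finally show ?thesis unfolding perf_iff by blast
qed

text \<open>
Elements of the maximal ideal of \<open>K\<close> are divisible by a uniformizer \<open>\<pi>\<close>, and \<open>\<pi> \<eta>\<^bsup>1/p^n\<^esup>\<close> is
integral as soon as \<open>\<pi>\<^bsup>p^n\<^esup> \<eta>\<close> is. This is why \<open>\<chi>\<close> has only finitely many nonzero terms.
\<close>

lemma frob_pow_tail:
  "\<exists>N. \<forall>j\<le>- int N. \<forall>w\<in>\<M>K. w * frob_pow j \<eta> \<in> \<O>"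
proof -
  obtain \<pi> where pi: "\<pi> \<in> \<M>K" "v \<pi> = 1" by (rule uniformizer)
  then have pi0: "\<pi> \<noteq> 0" by auto
  have "\<exists>k::nat. \<forall>m\<ge>k. \<pi> ^ m * \<eta> \<in> \<O>"
  proof (cases "\<eta> = 0")
    case False
    from v_finite[OF this] obtain r where r: "v \<eta> = ereal r" by (cases "v \<eta>") auto
    have "\<pi> ^ m * \<eta> \<in> \<O>" if "m \<ge> nat \<lceil>- r\<rceil>" for m
      using that pi pi0 by (simp add: O_iff v_mult v_power r one_ereal_def zero_ereal_def)
    then show ?thesis by blast
  qed simp
  then obtain k where k: "\<And>m. m \<ge> k \<Longrightarrow> \<pi> ^ m * \<eta> \<in> \<O>" by blast
  show ?thesis
  proof (intro exI allI impI ballI)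
    fix j w assume j: "j \<le> - int k" and w: "w \<in> \<M>K"
    define n where "n = nat (- j)"
    have jn: "j = - int n" "k \<le> n" using j by (auto simp: n_def)
    have "n < CHAR('l) ^ n" using char_gt_1 by (intro less_le_trans[OF less_exp] power_mono) auto
    then have "\<pi> ^ (CHAR('l) ^ n) * \<eta> \<in> \<O>" using jn by (intro k) simp
    then have "(\<pi> * frob_pow j \<eta>) ^ (CHAR('l) ^ n) \<in> \<O>"
      by (simp add: power_mult_distrib jn frob_pow_root)
    then have "\<pi> * frob_pow j \<eta> \<in> \<O>" by (rule O_of_power) (simp add: char_pos)
    moreover have "w / \<pi> \<in> \<O>"
    proof (cases "w = 0")
      case False
      from v_finite[OF this] obtain r where "v w = ereal r" by (cases "v w") auto
      then show ?thesis
        using v_MK[OF w] pi v_inverse[OF pi0]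
        by (simp add: O_iff divide_inverse v_mult one_ereal_def zero_ereal_def)
    qed simp
    ultimately have "(w / \<pi>) * (\<pi> * frob_pow j \<eta>) \<in> \<O>" by (rule O_mult[rotated])
    then show "w * frob_pow j \<eta> \<in> \<O>" using pi0 by simp
  qed
qed

lemma inertiaD:
  assumes "\<gamma> \<in> carrier (inertia K v)"
  shows "bij \<gamma>" "\<gamma> (x + y) = \<gamma> x + \<gamma> y" "\<gamma> (x * y) = \<gamma> x * \<gamma> y"
    "z \<in> perf K \<Longrightarrow> \<gamma> z = z" "w \<in> \<O> \<Longrightarrow> \<gamma> w - w \<in> \<M>"
  using assms by (auto simp: inertia_def galois_perf_def)

lemma inertia_diff: "\<gamma> \<in> carrier (inertia K v) \<Longrightarrow> \<gamma> (x - y) = \<gamma> x - \<gamma> y"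
  using inertiaD(2)[of \<gamma> "x - y" y] by simp

lemma inertia_K: "\<gamma> \<in> carrier (inertia K v) \<Longrightarrow> x \<in> K \<Longrightarrow> \<gamma> x = x"
  by (simp add: inertiaD(4) K_subset_perf)

lemma inertia_power: "\<gamma> \<in> carrier (inertia K v) \<Longrightarrow> \<gamma> (x ^ n) = \<gamma> x ^ n"
  by (induction n) (simp_all add: inertiaD(3) inertia_K)

lemma inertia_sum: "\<gamma> \<in> carrier (inertia K v) \<Longrightarrow> \<gamma> (\<Sum>s\<in>S. f s) = (\<Sum>s\<in>S. \<gamma> (f s))"
  by (induction S rule: infinite_finite_induct) (simp_all add: inertiaD(2) inertia_K)

lemma inertia_frob_pow: "\<gamma> \<in> carrier (inertia K v) \<Longrightarrow> \<gamma> (frob_pow j x) = frob_pow j (\<gamma> x)"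
  by (rule frob_pow_eqI[of _ "nat \<bar>j\<bar>", symmetric])
    (simp_all add: inertia_power[symmetric] frob_pow_power_char_nat)

text \<open>
If \<open>x\<close> is not integral, then \<open>1 / x\<close> lies in the maximal ideal, and so does its image.
\<close>

lemma inertia_O_iff:
  assumes g: "\<gamma> \<in> carrier (inertia K v)"
  shows "\<gamma> x \<in> \<O> \<longleftrightarrow> x \<in> \<O>"
proof
  assume x: "x \<in> \<O>"
  show "\<gamma> x \<in> \<O>" using O_add[OF M_imp_O[OF inertiaD(5)[OF g x]] x] by simp
next
  assume gx: "\<gamma> x \<in> \<O>"
  show "x \<in> \<O>"
  proof (rule ccontr)
    assume "x \<notin> \<O>"
    then have x0: "x \<noteq> 0" and ix: "inverse x \<in> \<M>" by (auto intro: inverse_in_M)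
    have "\<gamma> (inverse x) \<in> \<M>"
      using M_add[OF inertiaD(5)[OF g M_imp_O[OF ix]] ix] by simp
    then have "\<gamma> x * \<gamma> (inverse x) \<in> \<M>" using gx by (intro M_mult_left)
    then have "\<gamma> (x * inverse x) \<in> \<M>" by (simp only: inertiaD(3)[OF g])
    then show False using x0 by (simp add: inertia_K[OF g])
  qed
qed

lemma inertia_M_iff:
  assumes g: "\<gamma> \<in> carrier (inertia K v)"
  shows "\<gamma> x \<in> \<M> \<longleftrightarrow> x \<in> \<M>"
proof -
  have "\<gamma> x - x \<in> \<M>" if "x \<in> \<O>" using that by (rule inertiaD(5)[OF g])
  then show ?thesis
    using M_add[of "\<gamma> x - x" x] M_diff[of "\<gamma> x" "\<gamma> x - x"] inertia_O_iff[OF g, of x] M_imp_O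
    by auto
qed

lemma group_inertia: "group (inertia K v)"
proof (rule groupI)
  fix \<gamma> \<delta> assume g: "\<gamma> \<in> carrier (inertia K v)" and d: "\<delta> \<in> carrier (inertia K v)"
  have "\<gamma> (\<delta> w) - w \<in> \<M>" if "w \<in> \<O>" for w
    using inertiaD(5)[OF g, of "\<delta> w"] inertiaD(5)[OF d that] inertia_O_iff[OF d, of w] that
    by (auto intro: M_diff_trans)
  then show "\<gamma> \<otimes>\<^bsub>inertia K v\<^esub> \<delta> \<in> carrier (inertia K v)"
    using inertiaD[OF g] inertiaD[OF d]
    by (auto simp: inertia_def galois_perf_def intro: bij_comp)
next
  show "\<one>\<^bsub>inertia K v\<^esub> \<in> carrier (inertia K v)"
    by (auto simp: inertia_def galois_perf_def)
next
  fix \<gamma> assume g: "\<gamma> \<in> carrier (inertia K v)"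
  let ?i = "inv_into UNIV \<gamma>"
  have b: "bij \<gamma>" by (rule inertiaD(1)[OF g])
  have gi [simp]: "\<gamma> (?i x) = x" for x using b by (simp add: bij_is_surj surj_f_inv_f)
  have ig: "?i (\<gamma> x) = x" for x using b by (simp add: bij_is_inj)
  have eqI: "?i x = y" if "x = \<gamma> y" for x y using that ig by simp
  have "?i w - w \<in> \<M>" if w: "w \<in> \<O>" for w
  proof -
    have "\<gamma> (?i w - w) = w - \<gamma> w" by (simp add: inertia_diff[OF g])
    also have "\<dots> \<in> \<M>" using inertiaD(5)[OF g w] by (simp add: M_diff_commute)
    finally show ?thesis by (simp add: inertia_M_iff[OF g])
  qed
  then have "?i \<in> carrier (inertia K v)"
    using bij_imp_bij_inv[OF b] inertiaD[OF g]
    by (auto simp: inertia_def galois_perf_def intro!: eqI)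
  moreover have "?i \<otimes>\<^bsub>inertia K v\<^esub> \<gamma> = \<one>\<^bsub>inertia K v\<^esub>"
    using ig by (auto simp: inertia_def)
  ultimately show "\<exists>\<delta>\<in>carrier (inertia K v). \<delta> \<otimes>\<^bsub>inertia K v\<^esub> \<gamma> = \<one>\<^bsub>inertia K v\<^esub>" by blast
qed (auto simp: inertia_def)

text \<open>
The whole inertia group is one of the subgroups in the intersection that defines the
kernel; otherwise that intersection could be the set of all maps.
\<close>

lemma J_kernel_subset: "J_kernel K v \<subseteq> carrier (inertia K v)" and id_in_J_kernel: "id \<in> J_kernel K v"
proof -
  interpret I: group "inertia K v" by (rule group_inertia)
  let ?I = "inertia K v"
  have rcos: "carrier ?I #>\<^bsub>?I\<^esub> x = carrier ?I" if "x \<in> carrier ?I" for x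
    using I.coset_join2[OF that I.subgroup_self that] .
  have norm: "normal (carrier ?I) ?I"
    unfolding I.normal_inv_iff using I.subgroup_self by auto
  have carr: "carrier (?I Mod carrier ?I) = {carrier ?I}"
    using I.one_closed rcos by (auto simp: carrier_FactGroup image_iff)
  have one: "c = \<one>\<^bsub>?I Mod carrier ?I\<^esub>" if "c \<in> carrier (?I Mod carrier ?I)" for c
    using that by (simp add: carr)
  interpret Q: group "?I Mod carrier ?I" by (rule normal.factorgroup_is_group[OF norm])
  have comm: "comm_group (?I Mod carrier ?I)"
    by (rule Q.group_comm_groupI) (metis one)
  have exp: "c [^]\<^bsub>?I Mod carrier ?I\<^esub> (CHAR('l)) = \<one>\<^bsub>?I Mod carrier ?I\<^esub>"
    if "c \<in> carrier (?I Mod carrier ?I)" for c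
    using one[OF that] Q.nat_pow_one by simp
  have "krull_closed_in (carrier ?I) (carrier ?I)" by (simp add: krull_closed_in_def)
  then show "J_kernel K v \<subseteq> carrier ?I"
    unfolding J_kernel_def using norm comm exp by blast
  show "id \<in> J_kernel K v"
    unfolding J_kernel_def
  proof (rule InterI, elim CollectE conjE)
    fix H assume "normal H ?I"
    then have "\<one>\<^bsub>?I\<^esub> \<in> H" by (intro subgroup.one_closed normal_imp_subgroup)
    then show "id \<in> H" by (simp add: inertia_def)
  qed
qed

lemma J_group_representative:
  assumes "g \<in> carrier (J_group K v)"
  shows "(SOME \<gamma>. \<gamma> \<in> g) \<in> carrier (inertia K v)"
proof -
  interpret I: group "inertia K v" by (rule group_inertia)
  obtain \<gamma> where g: "\<gamma> \<in> carrier (inertia K v)" "g = J_kernel K v #>\<^bsub>inertia K v\<^esub> \<gamma>"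
    using assms by (auto simp: J_group_def carrier_FactGroup)
  have "g \<subseteq> carrier (inertia K v)" using g I.r_coset_subset_G[OF J_kernel_subset] by simp
  moreover have "id \<otimes>\<^bsub>inertia K v\<^esub> \<gamma> \<in> g"
    unfolding g(2) r_coset_def using id_in_J_kernel by blast
  then have "(SOME \<gamma>. \<gamma> \<in> g) \<in> g" by (rule someI[of "\<lambda>\<gamma>. \<gamma> \<in> g"])
  ultimately show ?thesis by blast
qed

end

section \<open>The Kummer pairing\<close>

context good_reduction_module
begin

lemma psi_eval_O: "a \<in> A \<Longrightarrow> x \<in> \<O> \<Longrightarrow> tau_eval (\<psi> a) x \<in> \<O>"
  unfolding tau_eval_def using coeffs_OK by (intro O_sum O_mult O_power) (auto simp: OK_iff)

lemma psi_eval_M: "a \<in> A \<Longrightarrow> x \<in> \<M> \<Longrightarrow> tau_eval (\<psi> a) x \<in> \<M>"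
  unfolding tau_eval_def using coeffs_OK
  by (intro M_sum M_mult_left M_power) (auto simp: OK_iff char_pos)

text \<open>
If \<open>x\<close> is not integral, the term of \<open>\<psi>\<^sub>a x\<close> with the highest power of \<open>x\<close> dominates, since its
coefficient is a unit. Division by this power of \<open>x\<close> makes the argument algebraic.
\<close>

lemma psi_eval_O_imp:
  assumes a: "a \<in> A" "a \<noteq> 0" and x: "tau_eval (\<psi> a) x \<in> \<O>"
  shows "x \<in> \<O>"
proof (rule ccontr)
  assume nx: "x \<notin> \<O>"
  then have x0: "x \<noteq> 0" and w: "inverse x \<in> \<M>" by (auto intro: inverse_in_M)
  let ?d = "degree (\<psi> a)" and ?q = "\<lambda>i. CHAR('l) ^ i"
  have w_pow: "inverse x ^ ?q ?d * x ^ ?q i = inverse x ^ (?q ?d - ?q i)" if "i \<le> ?d" for i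
  proof -
    have "?q i \<le> ?q ?d" using that char_pos by (intro power_increasing) auto
    then have "inverse x ^ ?q ?d = inverse x ^ (?q ?d - ?q i) * inverse x ^ ?q i"
      by (simp flip: power_add)
    moreover have "inverse x ^ ?q i * x ^ ?q i = 1" using x0 by (simp flip: power_mult_distrib)
    ultimately show ?thesis by (simp add: mult.assoc)
  qed
  have "inverse x ^ ?q ?d * tau_eval (\<psi> a) x
      = (\<Sum>i\<le>?d. coeff (\<psi> a) i * (inverse x ^ ?q ?d * x ^ ?q i))"
    by (simp add: tau_eval_def sum_distrib_left mult_ac)
  also have "\<dots> = (\<Sum>i\<le>?d. coeff (\<psi> a) i * inverse x ^ (?q ?d - ?q i))"
    by (intro sum.cong refl) (simp only: atMost_iff w_pow)
  also have "\<dots> = (\<Sum>i<?d. coeff (\<psi> a) i * inverse x ^ (?q ?d - ?q i)) + lead_coeff (\<psi> a)"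
    by (simp add: lessThan_Suc_atMost[symmetric])
  finally have eq: "lead_coeff (\<psi> a) = inverse x ^ ?q ?d * tau_eval (\<psi> a) x
      - (\<Sum>i<?d. coeff (\<psi> a) i * inverse x ^ (?q ?d - ?q i))" by simp
  have "?q i < ?q ?d" if "i < ?d" for i using that char_gt_1 by (intro power_strict_increasing)
  then have "(\<Sum>i<?d. coeff (\<psi> a) i * inverse x ^ (?q ?d - ?q i)) \<in> \<M>"
    using coeffs_OK[OF a(1)] w by (intro M_sum M_mult_left M_power) (auto simp: OK_iff)
  moreover have "inverse x ^ ?q ?d * tau_eval (\<psi> a) x \<in> \<M>"
    using w x by (intro M_mult_right[OF M_power]) (simp_all add: char_pos)
  ultimately have "lead_coeff (\<psi> a) \<in> \<M>" unfolding eq by (intro M_diff)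
  with lead_unit[OF a] show False by (simp add: unit_iff)
qed

text \<open>
\<open>\<psi>\<^sub>a (x) - y\<close> is a nonconstant polynomial in \<open>x\<close>, of degree \<open>p\<^sup>d\<close> with \<open>d\<close> the degree in \<open>\<tau>\<close>.
\<close>

lemma psi_eval_surj:
  assumes a: "a \<in> A" "a \<noteq> 0"
  shows "\<exists>x. tau_eval (\<psi> a) x = y"
proof -
  let ?d = "degree (\<psi> a)" and ?q = "\<lambda>i. CHAR('l) ^ i"
  define P where "P = (\<Sum>i\<le>?d. monom (coeff (\<psi> a) i) (?q i)) - [:y:]"
  have q_inj: "?q i = ?q j \<longleftrightarrow> i = j" for i j using char_gt_1 by (simp add: power_inject_exp)
  have "coeff P (?q ?d) = lead_coeff (\<psi> a)"
    using char_pos by (simp add: P_def coeff_sum q_inj coeff_pCons split: nat.split)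
  also have "\<dots> \<noteq> 0" using lead_nonzero[OF a] .
  finally have "?q ?d \<le> degree P" by (rule le_degree)
  moreover have "?q ?d > 0" by (simp add: char_pos)
  ultimately have "degree P > 0" by (rule less_le_trans[rotated])
  then obtain x where "poly P x = 0" using alg_closed_imp_poly_has_root by blast
  then show ?thesis
    by (intro exI[of _ x]) (simp add: P_def tau_eval_def poly_sum poly_monom)
qed

lemma psi_eval_inertia:
  "\<gamma> \<in> carrier (inertia K v) \<Longrightarrow> a \<in> A \<Longrightarrow> \<gamma> (tau_eval (\<psi> a) x) = tau_eval (\<psi> a) (\<gamma> x)"
  using coeffs_OK by (simp add: tau_eval_def inertia_sum inertiaD(3) inertia_power inertia_K OK_iff)

text \<open>
Enlarging the denominator from \<open>a\<close> to \<open>a c\<close>: the elements \<open>\<eta>\<close> and \<open>\<psi>\<^sub>c \<zeta>\<close> differ by an element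
killed by \<open>\<psi>\<^sub>a\<close>. It is integral by good reduction, so \<open>\<gamma>\<close> moves it within the maximal ideal.
\<close>

lemma kummer_refine:
  assumes g: "\<gamma> \<in> carrier (inertia K v)" and a: "a \<in> A" "a \<noteq> 0" and b: "b \<in> A" and c: "c \<in> A"
    and eta: "tau_eval (\<psi> a) \<eta> = \<xi>" and zeta: "tau_eval (\<psi> (a * c)) \<zeta> = \<xi>"
  shows "tau_eval (\<psi> b) (\<gamma> \<eta> - \<eta>) - tau_eval (\<psi> (b * c)) (\<gamma> \<zeta> - \<zeta>) \<in> \<M>"
proof -
  define z where "z = \<eta> - tau_eval (\<psi> c) \<zeta>"
  have "tau_eval (\<psi> a) z = 0"
    using eta zeta a c by (simp add: z_def tau_eval_diff psi_eval_mult)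
  then have "z \<in> \<O>" by (intro psi_eval_O_imp[OF a, of z]) simp
  then have "tau_eval (\<psi> b) (\<gamma> z - z) \<in> \<M>" by (intro psi_eval_M[OF b] inertiaD(5)[OF g])
  also have "tau_eval (\<psi> b) (\<gamma> z - z)
      = tau_eval (\<psi> b) (\<gamma> \<eta> - \<eta>) - tau_eval (\<psi> b) (tau_eval (\<psi> c) (\<gamma> \<zeta> - \<zeta>))"
    by (simp add: z_def inertia_diff[OF g] psi_eval_inertia[OF g c] tau_eval_diff)
  also have "tau_eval (\<psi> b) (tau_eval (\<psi> c) (\<gamma> \<zeta> - \<zeta>)) = tau_eval (\<psi> (b * c)) (\<gamma> \<zeta> - \<zeta>)"
    using b c by (simp add: psi_eval_mult)
  finally show ?thesis .
qed

text \<open>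
Over the common denominator \<open>a a'\<close> the two values differ by \<open>\<psi>\<^sub>c (\<gamma> \<xi> - \<xi>)\<close> with
\<open>c = b / a - b' / a'\<close>, and \<open>\<gamma>\<close> fixes \<open>\<xi>\<close>.
\<close>

lemma kummer_independent:
  assumes g: "\<gamma> \<in> carrier (inertia K v)" and xi: "\<xi> \<in> perf K"
    and a: "a \<in> A" "a \<noteq> 0" and b: "b \<in> A" and eta: "tau_eval (\<psi> a) \<eta> = \<xi>"
    and a': "a' \<in> A" "a' \<noteq> 0" and b': "b' \<in> A" and eta': "tau_eval (\<psi> a') \<eta>' = \<xi>"
    and frac: "b / a - b' / a' \<in> A"
  shows "tau_eval (\<psi> b) (\<gamma> \<eta> - \<eta>) - tau_eval (\<psi> b') (\<gamma> \<eta>' - \<eta>') \<in> \<M>"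
proof -
  define c where "c = b / a - b' / a'"
  have c: "c \<in> A" using frac by (simp add: c_def)
  obtain \<zeta> where zeta: "tau_eval (\<psi> (a * a')) \<zeta> = \<xi>"
    using psi_eval_surj[of "a * a'" \<xi>] a a' by (auto simp: A_mult)
  have eq: "b * a' - b' * a = c * (a * a')" using a a' by (simp add: c_def field_simps)
  have "tau_eval (\<psi> (b * a')) (\<gamma> \<zeta> - \<zeta>) - tau_eval (\<psi> (b' * a)) (\<gamma> \<zeta> - \<zeta>)
      = tau_eval (\<psi> (b * a' - b' * a)) (\<gamma> \<zeta> - \<zeta>)"
    using a a' b b' by (simp add: psi_diff A_mult tau_eval_poly_diff)
  also have "\<dots> = tau_eval (\<psi> c) (\<gamma> \<xi> - \<xi>)"
    unfolding eq using a a' c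
    by (simp add: psi_eval_mult[OF c] A_mult tau_eval_diff psi_eval_inertia[OF g, symmetric] zeta)
  also have "\<dots> = 0" using inertiaD(4)[OF g xi] by simp
  finally have "tau_eval (\<psi> (b * a')) (\<gamma> \<zeta> - \<zeta>) = tau_eval (\<psi> (b' * a)) (\<gamma> \<zeta> - \<zeta>)" by simp
  moreover note kummer_refine[OF g a b a'(1) eta zeta]
  moreover have "tau_eval (\<psi> (a' * a)) \<zeta> = \<xi>" using zeta by (simp add: mult.commute)
  note kummer_refine[OF g a' b' a(1) eta' this]
  ultimately show ?thesis by (metis M_diff_commute M_diff_trans)
qed

lemmas A_coset_eq_iff = coset_eq_iff[OF A_0 A_diff]
lemmas A_coset_plus = coset_plus_coset[OF A_0 A_diff]

definition is_kummer_map :: "'l \<Rightarrow> ('l \<Rightarrow> 'l) \<Rightarrow> ('f set \<Rightarrow> 'l set) \<Rightarrow> bool" where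
  "is_kummer_map \<xi> \<gamma> f \<longleftrightarrow> f \<in> T_ad v A \<psi> \<and>
     (\<forall>a\<in>A - {0}. \<forall>b\<in>A. \<forall>\<xi>a. tau_eval (\<psi> a) \<xi>a = \<xi> \<longrightarrow>
        f ((b / a) +o A) = tau_eval (\<psi> b) (\<gamma> \<xi>a - \<xi>a) +o \<M>)"

lemma A_coset_fraction:
  assumes frac: "\<And>x. \<exists>e\<in>A. e \<noteq> 0 \<and> e * x \<in> A" and c: "c \<in> quot UNIV A"
  obtains a b where "a \<in> A" "a \<noteq> 0" "b \<in> A" "c = (b / a) +o A"
proof -
  obtain x where x: "c = x +o A" using c by (auto simp: quot_def)
  obtain e where e: "e \<in> A" "e \<noteq> 0" "e * x \<in> A" using frac by blast
  then show ?thesis using that[of e "e * x"] x by simp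
qed

text \<open>
Independence of the choices gives a function on \<open>F / A\<close>; it is linear because any two
classes can be written with the same denominator and the same root \<open>\<eta>\<close>.
\<close>

lemma is_kummer_map_exists:
  assumes frac: "\<And>x. \<exists>e\<in>A. e \<noteq> 0 \<and> e * x \<in> A"
    and g: "\<gamma> \<in> carrier (inertia K v)" and xi: "\<xi> \<in> perf K"
  shows "\<exists>f. is_kummer_map \<xi> \<gamma> f"
proof -
  (* the graph of the Kummer map, with all admissible choices *)
  define R where "R c m \<longleftrightarrow> (\<exists>a b \<eta>. a \<in> A \<and> a \<noteq> 0 \<and> b \<in> A \<and> tau_eval (\<psi> a) \<eta> = \<xi> \<and>
    c = (b / a) +o A \<and> m = tau_eval (\<psi> b) (\<gamma> \<eta> - \<eta>) +o \<M>)" for c m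
  have R_unique: "m = m'" if "R c m" "R c m'" for c m m'
  proof -
    from that(1) obtain a b \<eta> where 1: "a \<in> A" "a \<noteq> 0" "b \<in> A" "tau_eval (\<psi> a) \<eta> = \<xi>"
      "c = (b / a) +o A" "m = tau_eval (\<psi> b) (\<gamma> \<eta> - \<eta>) +o \<M>" by (auto simp: R_def)
    from that(2) obtain a' b' \<eta>' where 2: "a' \<in> A" "a' \<noteq> 0" "b' \<in> A" "tau_eval (\<psi> a') \<eta>' = \<xi>"
      "c = (b' / a') +o A" "m' = tau_eval (\<psi> b') (\<gamma> \<eta>' - \<eta>') +o \<M>" by (auto simp: R_def)
    have "b / a - b' / a' \<in> A" using 1(5) 2(5) A_coset_eq_iff[of "b / a" "b' / a'"] by metis
    then show ?thesis
      using kummer_independent[OF g xi 1(1-4) 2(1-4)] 1(6) 2(6) by (simp add: M_coset_eq_iff)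
  qed
  define f where "f = (\<lambda>c\<in>quot UNIV A. THE m. R c m)"
  have f_eq: "f ((b / a) +o A) = tau_eval (\<psi> b) (\<gamma> \<eta> - \<eta>) +o \<M>"
    if "a \<in> A" "a \<noteq> 0" "b \<in> A" "tau_eval (\<psi> a) \<eta> = \<xi>" for a b \<eta>
  proof -
    have R: "R ((b / a) +o A) (tau_eval (\<psi> b) (\<gamma> \<eta> - \<eta>) +o \<M>)" using that by (auto simp: R_def)
    then have "(THE m. R ((b / a) +o A) m) = tau_eval (\<psi> b) (\<gamma> \<eta> - \<eta>) +o \<M>"
      by (rule the_equality) (rule R_unique[OF _ R])
    then show ?thesis by (simp add: f_def quot_def)
  qed
  have common: "\<exists>a b b' \<eta>. a \<in> A \<and> a \<noteq> 0 \<and> b \<in> A \<and> b' \<in> A \<and> tau_eval (\<psi> a) \<eta> = \<xi> \<and>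
      c = (b / a) +o A \<and> d = (b' / a) +o A" if cd: "c \<in> quot UNIV A" "d \<in> quot UNIV A" for c d
  proof -
    obtain a b where 1: "a \<in> A" "a \<noteq> 0" "b \<in> A" "c = (b / a) +o A" using A_coset_fraction[OF frac cd(1)] .
    obtain a' b' where 2: "a' \<in> A" "a' \<noteq> 0" "b' \<in> A" "d = (b' / a') +o A" using A_coset_fraction[OF frac cd(2)] .
    obtain \<eta> where "tau_eval (\<psi> (a * a')) \<eta> = \<xi>"
      using psi_eval_surj[of "a * a'" \<xi>] 1 2 by (auto simp: A_mult)
    then show ?thesis using 1 2
      by (intro exI[of _ "a * a'"] exI[of _ "b * a'"] exI[of _ "b' * a"] exI[of _ \<eta>]) (auto simp: A_mult)
  qed
  have "f \<in> T_ad v A \<psi>"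
    unfolding T_ad_def
  proof (intro CollectI conjI ballI)
    show "f \<in> quot UNIV A \<rightarrow>\<^sub>E quot UNIV \<M>"
    proof
      fix c assume "c \<in> quot UNIV A"
      then obtain a b \<eta> where "a \<in> A" "a \<noteq> 0" "b \<in> A" "tau_eval (\<psi> a) \<eta> = \<xi>" "c = (b / a) +o A"
        using common by blast
      then show "f c \<in> quot UNIV \<M>" by (simp add: f_eq quot_def)
    qed (simp add: f_def)
  next
    fix c d assume "c \<in> quot UNIV A" "d \<in> quot UNIV A"
    then obtain a b b' \<eta> where *: "a \<in> A" "a \<noteq> 0" "b \<in> A" "b' \<in> A" "tau_eval (\<psi> a) \<eta> = \<xi>"
      "c = (b / a) +o A" "d = (b' / a) +o A" using common by blast
    have "c + d = ((b + b') / a) +o A" using * by (simp add: A_coset_plus add_divide_distrib)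
    then show "f (c + d) = f c + f d"
      using * by (simp add: f_eq A_add M_coset_plus psi_add tau_eval_poly_add)
  next
    fix e c assume e: "e \<in> A" and "c \<in> quot UNIV A"
    then obtain a b \<eta> where *: "a \<in> A" "a \<noteq> 0" "b \<in> A" "tau_eval (\<psi> a) \<eta> = \<xi>" "c = (b / a) +o A"
      using common by blast
    have "e *o c = (*) e ` c" by (auto simp: elt_set_times_def)
    then have "(e *o c) + A = (*) e ` ((b / a) +o A) + A" by (simp only: *(5))
    also have "\<dots> = (e * (b / a)) +o A"
      using e by (intro image_coset_plus) (auto simp: ring_distribs A_mult A_0 A_diff)
    finally have coset: "(e *o c) + A = (e * b / a) +o A" by (simp only: times_divide_eq_right)
    have "f ((e *o c) + A) = tau_eval (\<psi> (e * b)) (\<gamma> \<eta> - \<eta>) +o \<M>"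
      unfolding coset using * e by (intro f_eq A_mult)
    also have "\<dots> = tau_eval (\<psi> e) (tau_eval (\<psi> b) (\<gamma> \<eta> - \<eta>)) +o \<M>"
      using * e by (simp add: psi_eval_mult)
    also have "\<dots> = tau_eval (\<psi> e) ` (tau_eval (\<psi> b) (\<gamma> \<eta> - \<eta>) +o \<M>) + \<M>"
      using e by (intro image_coset_plus[symmetric]) (auto simp: tau_eval_add psi_eval_M M_diff)
    also have "tau_eval (\<psi> b) (\<gamma> \<eta> - \<eta>) +o \<M> = f c"
      unfolding *(5) using * by (intro f_eq[symmetric])
    finally show "f ((e *o c) + A) = tau_eval (\<psi> e) ` f c + \<M>" .
  qed
  then have "is_kummer_map \<xi> \<gamma> f" using f_eq by (auto simp: is_kummer_map_def)
  then show ?thesis by (rule exI[of _ f])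
qed

lemma T_ad_ext:
  assumes "f \<in> T_ad v A \<psi>1" "f' \<in> T_ad v A \<psi>2" "\<And>c. c \<in> quot UNIV A \<Longrightarrow> f c = f' c"
  shows "f = f'"
  using assms unfolding T_ad_def by (intro PiE_ext[of f "quot UNIV A" "\<lambda>_. quot UNIV \<M>" f']) auto

lemma kummer_elem:
  assumes frac: "\<And>x. \<exists>e\<in>A. e \<noteq> 0 \<and> e * x \<in> A"
    and g: "\<gamma> \<in> carrier (inertia K v)" and xi: "\<xi> \<in> perf K"
  shows "kummer_elem v A \<psi> \<xi> \<gamma> \<in> T_ad v A \<psi>"
    and "a \<in> A \<Longrightarrow> a \<noteq> 0 \<Longrightarrow> b \<in> A \<Longrightarrow> tau_eval (\<psi> a) \<eta> = \<xi> \<Longrightarrow>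
      kummer_elem v A \<psi> \<xi> \<gamma> ((b / a) +o A) = tau_eval (\<psi> b) (\<gamma> \<eta> - \<eta>) +o \<M>"
proof -
  obtain f where f: "is_kummer_map \<xi> \<gamma> f" using is_kummer_map_exists[OF assms] by blast
  have "f' = f" if f': "is_kummer_map \<xi> \<gamma> f'" for f'
  proof (rule T_ad_ext)
    show "f' \<in> T_ad v A \<psi>" "f \<in> T_ad v A \<psi>" using f f' by (auto simp: is_kummer_map_def)
    fix c assume "c \<in> quot UNIV A"
    then obtain a b where ab: "a \<in> A" "a \<noteq> 0" "b \<in> A" "c = (b / a) +o A" by (rule A_coset_fraction[OF frac])
    obtain \<eta> where "tau_eval (\<psi> a) \<eta> = \<xi>" using psi_eval_surj[OF ab(1,2)] by blast
    then show "f' c = f c" using f f' ab by (simp add: is_kummer_map_def)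
  qed
  then have "(THE f. is_kummer_map \<xi> \<gamma> f) = f" using f by (intro the_equality)
  then have "is_kummer_map \<xi> \<gamma> (THE f. is_kummer_map \<xi> \<gamma> f)" using f by simp
  moreover have "kummer_elem v A \<psi> \<xi> \<gamma> = (THE f. is_kummer_map \<xi> \<gamma> f)"
    by (simp only: kummer_elem_def is_kummer_map_def)
  ultimately have "is_kummer_map \<xi> \<gamma> (kummer_elem v A \<psi> \<xi> \<gamma>)" by simp
  then show "kummer_elem v A \<psi> \<xi> \<gamma> \<in> T_ad v A \<psi>"
    and "a \<in> A \<Longrightarrow> a \<noteq> 0 \<Longrightarrow> b \<in> A \<Longrightarrow> tau_eval (\<psi> a) \<eta> = \<xi> \<Longrightarrow>
      kummer_elem v A \<psi> \<xi> \<gamma> ((b / a) +o A) = tau_eval (\<psi> b) (\<gamma> \<eta> - \<eta>) +o \<M>"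
    by (simp_all add: is_kummer_map_def)
qed

end

section \<open>Comparison of the two pairings\<close>

context char_p_local_field
begin

text \<open>
Partial sums of \<open>\<chi>\<close>, as elements of the algebraically closed field instead of classes.
\<close>

definition chi_trunc :: "(int \<Rightarrow> 'l) \<Rightarrow> nat \<Rightarrow> 'l \<Rightarrow> 'l" where
  "chi_trunc x N \<eta> = (\<Sum>j=- int N..0. x j * frob_pow j \<eta>)"

lemma chi_trunc_diff: "chi_trunc x N \<eta> - chi_trunc x N \<zeta> = chi_trunc x N (\<eta> - \<zeta>)"
  by (simp add: chi_trunc_def frob_pow_diff right_diff_distrib sum_subtractf)

lemma chi_trunc_inertia:
  assumes "principal_series x" "\<gamma> \<in> carrier (inertia K v)"
  shows "\<gamma> (chi_trunc x N \<eta>) = chi_trunc x N (\<gamma> \<eta>)"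
proof -
  have "x j \<in> K" if "j \<le> 0" for j using assms(1) that by (auto simp: principal_series_def OK_iff)
  then show ?thesis
    using assms(2) by (simp add: chi_trunc_def inertia_sum inertiaD(3) inertia_K inertia_frob_pow)
qed

lemma chi_trunc_cong_M:
  assumes x: "principal_series x" and z: "\<zeta> \<in> \<O>"
  shows "chi_trunc x N \<zeta> - \<zeta> \<in> \<M>"
proof -
  have "{- int N..0} = insert 0 {- int N..<0}" by auto
  then have "chi_trunc x N \<zeta> - \<zeta> = (x 0 - 1) * \<zeta> + (\<Sum>j=- int N..<0. x j * frob_pow j \<zeta>)"
    by (simp add: chi_trunc_def left_diff_distrib)
  also have "\<dots> \<in> \<M>"
    using x z by (intro M_add M_sum M_mult_right frob_pow_O) (auto simp: principal_series_def MK_iff)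
  finally show ?thesis .
qed

end

context good_reduction_module
begin

text \<open>
In the difference, the terms with \<open>\<eta>\<^bsup>p^n\<^esup>\<close> form, for \<open>n \<ge> d - N\<close>, the complete coefficient of \<open>\<tau>\<^sup>n\<close>
in \<open>\<psi>\<^sub>b x - x \<phi>\<^sub>b\<close>, which is \<open>0\<close>. The truncation is felt only for \<open>n < d - N\<close>; those terms
involve a coefficient \<open>x\<^sub>j\<close> in the maximal ideal of \<open>K\<close> and are integral when \<open>N\<close> is large.
\<close>

lemma chi_trunc_intertwines:
  assumes x: "principal_series x" and b: "b \<in> A"
    and eq: "skew_mult (series_of_poly (\<psi> b)) x = skew_mult x (series_of_poly (\<phi> b))"
  shows "\<exists>N0. \<forall>N\<ge>N0. tau_eval (\<psi> b) (chi_trunc x N \<eta>) - chi_trunc x N (tau_eval (\<phi> b) \<eta>) \<in> \<O>"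
proof -
  let ?d = "degree (\<psi> b)" and ?f = "series_of_poly (\<psi> b)" and ?g = "series_of_poly (\<phi> b)"
  have dg: "degree (\<phi> b) = ?d" using b by (rule degree_reduction)
  have tx: "tau_degree_le x 0" using x by (simp add: principal_series_def tau_degree_le_def)
  have tf: "tau_degree_le ?f (int ?d)" by (rule tau_degree_le_series_of_poly)
  have tg: "tau_degree_le ?g (int ?d)" using tau_degree_le_series_of_poly[of "\<phi> b"] dg by simp
  obtain N1 where N1: "\<And>n w. n \<le> - int N1 \<Longrightarrow> w \<in> \<M>K \<Longrightarrow> w * frob_pow n \<eta> \<in> \<O>"
    using frob_pow_tail by blast
  define E where "E i j = ?f i * frob_pow i (x j) - x j * frob_pow j (?g i)" for i j
  have E_0: "E i j = 0" if "i < 0 \<or> i > int ?d" for i j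
    using that tf tg by (auto simp: E_def tau_degree_le_def)
  show ?thesis
  proof (intro exI allI impI)
    fix N assume N: "?d + N1 \<le> N"
    have "tau_eval (\<psi> b) (chi_trunc x N \<eta>)
        = (\<Sum>i=0..int ?d. \<Sum>j=- int N..0. ?f i * frob_pow i (x j) * frob_pow (i + j) \<eta>)"
      by (simp add: tau_eval_eq_sum[of 0 _ "int ?d"] chi_trunc_def frob_pow_sum frob_pow_mult
          frob_pow_frob_pow sum_distrib_left mult.assoc)
    also have "\<dots> = (\<Sum>j=- int N..0. \<Sum>i=0..int ?d. ?f i * frob_pow i (x j) * frob_pow (i + j) \<eta>)"
      by (rule sum.swap)
    finally have 1: "tau_eval (\<psi> b) (chi_trunc x N \<eta>) = \<dots>" .
    have 2: "chi_trunc x N (tau_eval (\<phi> b) \<eta>)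
        = (\<Sum>j=- int N..0. \<Sum>i=0..int ?d. x j * frob_pow j (?g i) * frob_pow (i + j) \<eta>)"
      by (simp add: tau_eval_eq_sum[of 0 _ "int ?d"] dg chi_trunc_def frob_pow_sum frob_pow_mult
          frob_pow_frob_pow sum_distrib_left mult.assoc add.commute)
    have "tau_eval (\<psi> b) (chi_trunc x N \<eta>) - chi_trunc x N (tau_eval (\<phi> b) \<eta>)
        = (\<Sum>j=- int N..0. \<Sum>i=0..int ?d. E i j * frob_pow (i + j) \<eta>)"
      unfolding 1 2 E_def by (simp add: sum_subtractf left_diff_distrib)
    also have "\<dots> = (\<Sum>j=- int N..0. \<Sum>n=- int N..int ?d. E (n - j) j * frob_pow n \<eta>)"
    proof (rule sum.cong[OF refl])
      fix j assume j: "j \<in> {- int N..0}"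
      have "(\<Sum>i=0..int ?d. E i j * frob_pow (i + j) \<eta>) = (\<Sum>n=j..int ?d + j. E (n - j) j * frob_pow n \<eta>)"
        by (rule sum.reindex_bij_witness[of _ "\<lambda>n. n - j" "\<lambda>i. i + j"]) auto
      also have "\<dots> = (\<Sum>n=- int N..int ?d. E (n - j) j * frob_pow n \<eta>)"
        using j by (intro sum.mono_neutral_left) (auto intro!: E_0)
      finally show "(\<Sum>i=0..int ?d. E i j * frob_pow (i + j) \<eta>) = (\<Sum>n=- int N..int ?d. E (n - j) j * frob_pow n \<eta>)" .
    qed
    also have "\<dots> = (\<Sum>n=- int N..int ?d. \<Sum>j=- int N..0. E (n - j) j * frob_pow n \<eta>)"
      by (rule sum.swap)
    also have "\<dots> \<in> \<O>"
    proof (rule O_sum)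
      fix n assume n: "n \<in> {- int N..int ?d}"
      show "(\<Sum>j=- int N..0. E (n - j) j * frob_pow n \<eta>) \<in> \<O>"
      proof (cases "n \<ge> int ?d - int N")
        case True
        (* both coefficients of degree n only involve indices j between - N and 0 *)
        have "skew_mult ?f x n = (\<Sum>i=n..n + int N. ?f i * frob_pow i (x (n - i)))"
          using True by (intro skew_mult_eq_interval[OF tf tx]) auto
        also have "\<dots> = (\<Sum>j=- int N..0. ?f (n - j) * frob_pow (n - j) (x j))"
          by (rule sum.reindex_bij_witness[of _ "\<lambda>j. n - j" "\<lambda>i. n - i"]) auto
        finally have "skew_mult ?f x n = (\<Sum>j=- int N..0. ?f (n - j) * frob_pow (n - j) (x j))" .
        moreover have "skew_mult x ?g n = (\<Sum>j=- int N..0. x j * frob_pow j (?g (n - j)))"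
          using True by (intro skew_mult_eq_interval[OF tx tg]) auto
        ultimately have "(\<Sum>j=- int N..0. E (n - j) j) = 0" using eq by (simp add: E_def sum_subtractf)
        then show ?thesis by (simp flip: sum_distrib_right)
      next
        case False
        show ?thesis
        proof (rule O_sum)
          fix j
          show "E (n - j) j * frob_pow n \<eta> \<in> \<O>"
          proof (cases "n - j < 0 \<or> n - j > int ?d")
            case True
            then show ?thesis by (simp add: E_0)
          next
            case nj: False
            then have j: "j < 0" and n': "n \<le> - int N1" using False N by auto
            obtain i where i: "n - j = int i" using nj by (metis nonneg_int_cases not_less)
            have xj: "x j \<in> \<M>K" using x j by (simp add: principal_series_def)
            then have "frob_pow (n - j) (x j) \<in> \<M>K"
              by (auto simp: MK_iff i frob_pow_nat intro!: K_power M_power char_pos)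
            then have "?f (n - j) * (frob_pow (n - j) (x j) * frob_pow n \<eta>) \<in> \<O>"
              using series_OK[OF b, of "n - j"] by (intro O_mult N1[OF n']) (simp_all add: OK_iff)
            moreover have "frob_pow j (?g (n - j)) * (x j * frob_pow n \<eta>) \<in> \<O>"
              using frob_pow_coeff_reduction[OF b, of j i] by (intro O_mult N1[OF n'] xj) (simp_all add: OK_iff i)
            ultimately have "?f (n - j) * (frob_pow (n - j) (x j) * frob_pow n \<eta>)
                - frob_pow j (?g (n - j)) * (x j * frob_pow n \<eta>) \<in> \<O>" by (rule O_diff)
            then show ?thesis by (simp add: E_def algebra_simps)
          qed
        qed
      qed
    qed
    finally show "tau_eval (\<psi> b) (chi_trunc x N \<eta>) - chi_trunc x N (tau_eval (\<phi> b) \<eta>) \<in> \<O>" .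
  qed
qed

lemma reduction_eval_cong_M:
  assumes b: "b \<in> A" and z: "\<zeta> \<in> \<O>"
  shows "tau_eval (\<psi> b) \<zeta> - tau_eval (\<phi> b) \<zeta> \<in> \<M>"
proof -
  have "tau_eval (\<psi> b) \<zeta> - tau_eval (\<phi> b) \<zeta>
      = (\<Sum>i\<le>degree (\<psi> b). (coeff (\<psi> b) i - coeff (\<phi> b) i) * \<zeta> ^ (CHAR('l) ^ i))"
    using b by (simp add: tau_eval_def degree_reduction left_diff_distrib sum_subtractf)
  also have "\<dots> \<in> \<M>"
    using coeff_diff_reduction[OF b] z by (intro M_sum M_mult_right O_power) auto
  finally show ?thesis .
qed

text \<open>
The sum that defines \<open>\<chi>\<close> leaves out integral terms only, and all nonintegral terms have
index at least \<open>- N\<close> for large \<open>N\<close>.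
\<close>

lemma chi_eq_trunc:
  assumes x: "principal_series (chi_series K v A \<psi>)" and u: "u \<in> P_perf K v"
    and xi': "\<xi>' \<in> chi K v A \<psi> u"
  shows "(SOME \<xi>. \<xi> \<in> u) \<in> perf K" "\<xi>' \<in> perf K"
    "\<exists>N0. \<forall>N\<ge>N0. \<xi>' - chi_trunc (chi_series K v A \<psi>) N (SOME \<xi>. \<xi> \<in> u) \<in> \<O>"
proof -
  let ?x = "chi_series K v A \<psi>" and ?O = "val_ring v (perf K)"
  define \<xi> where "\<xi> = (SOME \<xi>. \<xi> \<in> u)"
  have Op: "y \<in> ?O \<longleftrightarrow> y \<in> perf K \<and> y \<in> \<O>" for y by (auto simp: val_ring_def)
  obtain \<xi>0 where "\<xi>0 \<in> perf K" "u = \<xi>0 +o ?O" using u by (auto simp: P_perf_def quot_def)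
  moreover have "0 \<in> ?O" by (simp add: Op K_subset_perf)
  then have "\<xi>0 + 0 \<in> \<xi>0 +o ?O" by (rule set_plus_intro2)
  ultimately have "\<xi>0 + 0 \<in> u" "u \<subseteq> perf K" by (auto simp: elt_set_plus_def Op intro: perf_add)
  moreover from this(1) have "\<xi> \<in> u" unfolding \<xi>_def by (rule someI[of "\<lambda>\<xi>. \<xi> \<in> u"])
  ultimately have xi: "\<xi> \<in> perf K" by blast
  define S where "S = {j. j \<le> 0 \<and> ?x j * frob_pow j \<xi> \<notin> ?O}"
  have term_perf: "?x j * frob_pow j \<xi> \<in> perf K" if "j \<le> 0" for j
    using x that by (intro perf_mult[OF K_subset_perf perf_frob_pow[OF xi]]) (auto simp: principal_series_def OK_iff)
  obtain w where w: "w \<in> ?O" "\<xi>' = (\<Sum>j\<in>S. ?x j * frob_pow j \<xi>) + w"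
    using xi' by (auto simp: chi_def Let_def elt_set_plus_def S_def \<xi>_def)
  show "(SOME \<xi>. \<xi> \<in> u) \<in> perf K" using xi by (simp add: \<xi>_def)
  show "\<xi>' \<in> perf K"
    unfolding w(2) using w(1) by (intro perf_add perf_sum term_perf) (auto simp: Op S_def)
  obtain N1 where N1: "\<And>n w. n \<le> - int N1 \<Longrightarrow> w \<in> \<M>K \<Longrightarrow> w * frob_pow n \<xi> \<in> \<O>"
    using frob_pow_tail by blast
  have "\<xi>' - chi_trunc ?x N \<xi> \<in> \<O>" if N: "N \<ge> N1" for N
  proof -
    have S: "S \<subseteq> {- int N..0}"
    proof
      fix j assume j: "j \<in> S"
      show "j \<in> {- int N..0}"
      proof (rule ccontr)
        assume "j \<notin> {- int N..0}"
        then have "j < - int N" using j by (auto simp: S_def)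
        then have "?x j * frob_pow j \<xi> \<in> \<O>"
          using x N by (intro N1) (auto simp: principal_series_def)
        then show False using j term_perf[of j] by (simp add: S_def Op)
      qed
    qed
    have "chi_trunc ?x N \<xi> = (\<Sum>j\<in>{- int N..0} - S. ?x j * frob_pow j \<xi>) + (\<Sum>j\<in>S. ?x j * frob_pow j \<xi>)"
      unfolding chi_trunc_def using S by (intro sum.subset_diff) auto
    then have "\<xi>' - chi_trunc ?x N \<xi> = w - (\<Sum>j\<in>{- int N..0} - S. ?x j * frob_pow j \<xi>)"
      by (simp add: w(2))
    also have "\<dots> \<in> \<O>" using w(1) by (intro O_diff O_sum) (auto simp: S_def Op)
    finally show ?thesis .
  qed
  then show "\<exists>N0. \<forall>N\<ge>N0. \<xi>' - chi_trunc ?x N (SOME \<xi>. \<xi> \<in> u) \<in> \<O>"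
    unfolding \<xi>_def[symmetric] by blast
qed

text \<open>
The comparison for one denominator \<open>a\<close>. The truncation \<open>X \<eta>\<close> differs from \<open>\<theta>\<close> by an element \<open>z\<close>
with integral \<open>\<psi>\<^sub>a z\<close>; by good reduction \<open>z\<close> itself is integral, hence \<open>\<gamma> z - z\<close> lies in
the maximal ideal.
\<close>

lemma kummer_value_cong_M:
  assumes x: "principal_series x" and a: "a \<in> A" "a \<noteq> 0"
    and eq: "skew_mult (series_of_poly (\<psi> a)) x = skew_mult x (series_of_poly (\<phi> a))"
    and g: "\<gamma> \<in> carrier (inertia K v)" and xi: "\<xi> \<in> perf K"
    and eta: "tau_eval (\<phi> a) \<eta> = \<xi>" and theta: "tau_eval (\<psi> a) \<theta> = \<xi>'"
    and xi': "\<exists>N0. \<forall>N\<ge>N0. \<xi>' - chi_trunc x N \<xi> \<in> \<O>"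
  shows "\<gamma> \<eta> - \<eta> \<in> \<O>" "(\<gamma> \<theta> - \<theta>) - (\<gamma> \<eta> - \<eta>) \<in> \<M>"
proof -
  interpret red: good_reduction_module p K v A \<phi> by (rule reduction_good)
  define \<zeta> where "\<zeta> = \<gamma> \<eta> - \<eta>"
  have "tau_eval (\<phi> a) \<zeta> = 0"
    using inertiaD(4)[OF g xi] red.psi_eval_inertia[OF g a(1), of \<eta>] eta
    by (simp add: \<zeta>_def tau_eval_diff)
  then have zeta: "\<zeta> \<in> \<O>" by (intro red.psi_eval_O_imp[OF a, of \<zeta>]) simp
  obtain N0 where N0: "\<And>N. N \<ge> N0 \<Longrightarrow> \<xi>' - chi_trunc x N \<xi> \<in> \<O>" using xi' by blast
  obtain N1 where N1: "\<And>N. N \<ge> N1 \<Longrightarrow> tau_eval (\<psi> a) (chi_trunc x N \<eta>) - chi_trunc x N \<xi> \<in> \<O>"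
    using chi_trunc_intertwines[OF x a(1) eq, of \<eta>] eta by blast
  define N where "N = max N0 N1"
  define z where "z = \<theta> - chi_trunc x N \<eta>"
  have "tau_eval (\<psi> a) z
      = (\<xi>' - chi_trunc x N \<xi>) - (tau_eval (\<psi> a) (chi_trunc x N \<eta>) - chi_trunc x N \<xi>)"
    by (simp add: z_def tau_eval_diff theta)
  also have "\<dots> \<in> \<O>" by (rule O_diff[OF N0 N1]) (simp_all add: N_def)
  finally have "z \<in> \<O>" by (rule psi_eval_O_imp[OF a])
  then have "\<gamma> z - z \<in> \<M>" by (rule inertiaD(5)[OF g])
  then have in_M: "(\<gamma> z - z) + (chi_trunc x N \<zeta> - \<zeta>) \<in> \<M>" using chi_trunc_cong_M[OF x zeta] by (rule M_add)
  have "\<gamma> z - z = (\<gamma> \<theta> - \<theta>) - chi_trunc x N \<zeta>"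
    by (simp add: z_def \<zeta>_def inertia_diff[OF g] chi_trunc_inertia[OF x g] chi_trunc_diff[symmetric])
  then have "(\<gamma> z - z) + (chi_trunc x N \<zeta> - \<zeta>) = (\<gamma> \<theta> - \<theta>) - \<zeta>" by simp
  with in_M have "(\<gamma> \<theta> - \<theta>) - \<zeta> \<in> \<M>" by (simp only:)
  then show "(\<gamma> \<theta> - \<theta>) - (\<gamma> \<eta> - \<eta>) \<in> \<M>" unfolding \<zeta>_def .
  show "\<gamma> \<eta> - \<eta> \<in> \<O>" using zeta by (simp add: \<zeta>_def)
qed

lemma kummer_elem_reduction:
  assumes frac: "\<And>x. \<exists>e\<in>A. e \<noteq> 0 \<and> e * x \<in> A"
    and x: "principal_series x"
    and eq: "\<And>a. a \<in> A \<Longrightarrow> skew_mult (series_of_poly (\<psi> a)) x = skew_mult x (series_of_poly (\<phi> a))"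
    and g: "\<gamma> \<in> carrier (inertia K v)" and xi: "\<xi> \<in> perf K" and xi'_perf: "\<xi>' \<in> perf K"
    and xi': "\<exists>N0. \<forall>N\<ge>N0. \<xi>' - chi_trunc x N \<xi> \<in> \<O>"
  shows "kummer_elem v A \<psi> \<xi>' \<gamma> = kummer_elem v A \<phi> \<xi> \<gamma>"
    and "c \<in> quot UNIV A \<Longrightarrow> kummer_elem v A \<phi> \<xi> \<gamma> c \<in> quot \<O> \<M>"
proof -
  interpret red: good_reduction_module p K v A \<phi> by (rule reduction_good)
  note psi = kummer_elem[OF frac g xi'_perf] and phi = red.kummer_elem[OF frac g xi]
  have *: "kummer_elem v A \<psi> \<xi>' \<gamma> c = kummer_elem v A \<phi> \<xi> \<gamma> c
      \<and> kummer_elem v A \<phi> \<xi> \<gamma> c \<in> quot \<O> \<M>" if c: "c \<in> quot UNIV A" for c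
  proof -
    obtain a b where ab: "a \<in> A" "a \<noteq> 0" "b \<in> A" "c = (b / a) +o A" by (rule A_coset_fraction[OF frac c])
    obtain \<theta> where theta: "tau_eval (\<psi> a) \<theta> = \<xi>'" using psi_eval_surj[OF ab(1,2)] by blast
    obtain \<eta> where eta: "tau_eval (\<phi> a) \<eta> = \<xi>" using red.psi_eval_surj[OF ab(1,2)] by blast
    note val = kummer_value_cong_M[OF x ab(1,2) eq[OF ab(1)] g xi eta theta xi']
    have "tau_eval (\<psi> b) (\<gamma> \<theta> - \<theta>) - tau_eval (\<psi> b) (\<gamma> \<eta> - \<eta>) \<in> \<M>"
      using psi_eval_M[OF ab(3) val(2)] by (simp only: tau_eval_diff)
    then have "tau_eval (\<psi> b) (\<gamma> \<theta> - \<theta>) - tau_eval (\<phi> b) (\<gamma> \<eta> - \<eta>) \<in> \<M>"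
      using reduction_eval_cong_M[OF ab(3) val(1)] by (rule M_diff_trans)
    moreover have "tau_eval (\<phi> b) (\<gamma> \<eta> - \<eta>) \<in> \<O>" by (rule red.psi_eval_O[OF ab(3) val(1)])
    then have "tau_eval (\<phi> b) (\<gamma> \<eta> - \<eta>) +o \<M> \<in> quot \<O> \<M>"
      unfolding quot_def by (rule image_eqI[OF refl])
    ultimately show ?thesis
      using psi(2)[OF ab(1-3) theta] phi(2)[OF ab(1-3) eta] by (simp add: ab(4) M_coset_eq_iff)
  qed
  show "kummer_elem v A \<psi> \<xi>' \<gamma> = kummer_elem v A \<phi> \<xi> \<gamma>"
    using psi(1) phi(1) * by (intro T_ad_ext) auto
  show "c \<in> quot UNIV A \<Longrightarrow> kummer_elem v A \<phi> \<xi> \<gamma> c \<in> quot \<O> \<M>" using * by blast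
qed

lemma res_eqI:
  assumes "f \<in> T_ad v A \<psi>" "f \<in> T_ad v A \<phi>" "\<And>c. c \<in> quot UNIV A \<Longrightarrow> f c \<in> quot \<O> \<M>"
  shows "res K v A \<psi> f = f"
proof -
  have "(THE h. h \<in> T_ad v A \<phi> \<and> (\<forall>c\<in>quot UNIV A. h c \<in> quot \<O> \<M> \<and> h c = f c)) = f"
    using assms by (intro the_equality) (auto intro: T_ad_ext)
  then show ?thesis using assms by (simp add: res_def)
qed

end

lemma good_reduction_module_drinfeld:
  assumes "local_field p K v" "is_subring A" "good_drinfeld_module K v A \<psi>"
  shows "good_reduction_module p K v A \<psi>"
  using assms by unfold_locales (auto simp: good_drinfeld_module_def)

theorem proposition9p6:
  fixes p :: nat
    and K :: "'l::alg_closed_field set" and v :: "'l \<Rightarrow> ereal"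
    and Oinf A :: "'f::field set" and \<psi> :: "'f \<Rightarrow> 'l poly"
  assumes "local_field p K v"
    and "global_function_field p TYPE('f)"
    and "is_place Oinf" and "A = regular_outside Oinf"
    and "good_drinfeld_module K v A \<psi>"
    and "u \<in> P_perf K v" and "g \<in> carrier (J_group K v)"
  shows "res K v A \<psi> (kummer_pairing v A \<psi> (chi K v A \<psi> u) g)
       = kummer_pairing v A (reduction K v \<psi>) u g"
proof -
  have "is_subring A" using assms(4) regular_outside_subring by simp
  then interpret good_reduction_module p K v A \<psi>
    using assms by (intro good_reduction_module_drinfeld)
  interpret red: good_reduction_module p K v A \<phi> by (rule reduction_good)
  obtain a where a: "a \<in> A" "degree (\<psi> a) > 0"
    using good_drinfeld_module_nonconstant[OF assms(5)] by blast
  have frac: "\<exists>e\<in>A. e \<noteq> 0 \<and> e * x \<in> A" for x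
    by (rule fraction_field[OF assms(2,4) a])
  let ?x = "chi_series K v A \<psi>"
  have x: "principal_series ?x" by (rule chi_series(1)[OF a])
  define \<xi> where "\<xi> = (SOME \<xi>. \<xi> \<in> u)"
  define \<xi>' where "\<xi>' = (SOME \<xi>. \<xi> \<in> chi K v A \<psi> u)"
  define \<gamma> where "\<gamma> = (SOME \<gamma>. \<gamma> \<in> g)"
  have g: "\<gamma> \<in> carrier (inertia K v)" unfolding \<gamma>_def by (rule J_group_representative[OF assms(7)])
  have "0 \<in> val_ring v (perf K)" using K_subset_perf by (simp add: val_ring_def)
  then have "\<exists>y. y \<in> chi K v A \<psi> u" unfolding chi_def Let_def by (blast intro: set_plus_intro2)
  then have "\<xi>' \<in> chi K v A \<psi> u" unfolding \<xi>'_def by (rule someI_ex)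
  note xi = chi_eq_trunc[OF x assms(6) this, folded \<xi>_def]
  note eq = kummer_elem_reduction[OF frac x chi_series(2)[OF a] g xi]
  have "kummer_elem v A \<psi> \<xi>' \<gamma> \<in> T_ad v A \<psi>" by (rule kummer_elem(1)[OF frac g xi(2)])
  moreover have "kummer_elem v A \<phi> \<xi> \<gamma> \<in> T_ad v A \<phi>" by (rule red.kummer_elem(1)[OF frac g xi(1)])
  ultimately have "res K v A \<psi> (kummer_elem v A \<phi> \<xi> \<gamma>) = kummer_elem v A \<phi> \<xi> \<gamma>"
    using eq by (intro res_eqI) simp_all
  then show ?thesis
    unfolding kummer_pairing_def using eq(1) by (simp add: \<xi>_def \<xi>'_def \<gamma>_def)
qed

end
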